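(* Let $r_0\in(0,\frac12)$ be the unique real number $r\in(0,\frac12)$ such that $$(r-1)(r^4+r^2)=\frac{r^7+r^6+4r^5-2r^4-2r^3-8r^2+9r-3}{6}.$$ Then $r_0\approx 0.4350411707$ (up to ten significant digits), and $r_0$ is the least upper bound of the set of those $r\in(0,\frac12)$ for which, for all $n\ge 2$, the set $\beta_n(I)$ forms an optimal set of $n$-means for the uniform Cantor distribution $P$ with parameter $r$.
   Context: For $0<r<\frac12$ let $S_1(x)=rx$ and $S_2(x)=rx+1-r$ on $\mathbb R$, and let $P$ (the uniform Cantor distribution with parameter $r$) be the unique Borel probability measure on $\mathbb R$ with $P=\frac12 P\circ S_1^{-1}+\frac12 P\circ S_2^{-1}$, where $P\circ S_i^{-1}$ is the image measure of $P$ under $S_i$. For a word $\sigma=\sigma_1\cdots\sigma_k\in\{1,2\}^k$ put $S_\sigma=S_{\sigma_1}\circ\cdots\circ S_{\sigma_k}$ and $J_\sigma=S_\sigma([0,1])$; $\sigma\tau$ denotes concatenation of words. Let $a_\sigma=S_\sigma(\frac12)$ be the midpoint of $J_\sigma$. Optimal sets: for a finite set $\alpha\subset\mathbb R$ let $V(P,\alpha)=\int\min_{a\in\alpha}(x-a)^2\,dP(x)$ (distortion error), and let $V_n=V_n(P)=\inf\{V(P,\alpha):\alpha\subset\mathbb R,\ \mathrm{card}(\alpha)\le n\}$. A set $\alpha$ with $\mathrm{card}(\alpha)\le n$ is an optimal set of $n$-means for $P$ if $V(P,\alpha)=V_n$. The sets $\beta_n(I)$: for $n\ge2$ let $\ell(n)$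 be the unique natural number with $2^{\ell(n)}\le n<2^{\ell(n)+1}$. For any $I\subset\{1,2\}^{\ell(n)}$ with $\mathrm{card}(I)=n-2^{\ell(n)}$, $$\beta_n(I)=\{a_\sigma:\sigma\in\{1,2\}^{\ell(n)}\setminus I\}\cup\{a_{\sigma1}:\sigma\in I\}\cup\{a_{\sigma2}:\sigma\in I\}.$$ Statements about $\beta_n(I)$ are for every such $I$. *)

theory Defs
  imports "HOL-Probability.Probability" "HOL-Library.Lub_Glb"
begin

definition cantor_map :: "real \<Rightarrow> nat \<Rightarrow> real \<Rightarrow> real" where
  "cantor_map r i x = (if i = 1 then r * x else r * x + 1 - r)"

definition self_similar :: "real \<Rightarrow> real measure \<Rightarrow> bool" where
  "self_similar r P \<longleftrightarrow>
     prob_space P \<and> sets P = sets borel \<and>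
     (\<forall>A\<in>sets borel. measure P A =
        1/2 * measure (distr P borel (cantor_map r 1)) A +
        1/2 * measure (distr P borel (cantor_map r 2)) A)"

text \<open>For \<open>0 < r < 1/2\<close> there is exactly one such measure, so the description below is proper.\<close>

definition cantor_dist :: "real \<Rightarrow> real measure" where
  "cantor_dist r = (THE P. self_similar r P)"

definition distortion :: "real measure \<Rightarrow> real set \<Rightarrow> real" where
  "distortion P \<alpha> = (LINT x|P. Min ((\<lambda>a. (x - a)\<^sup>2) ` \<alpha>))"

text \<open>The empty set is excluded: the minimum over it is conventionally infinite, whereas
  \<open>Min {}\<close> is an unspecified real number.\<close>

definition codebooks :: "nat \<Rightarrow> real set set" where
  "codebooks n = {\<alpha>. finite \<alpha> \<and> \<alpha> \<noteq> {} \<and> card \<alpha> \<le> n}"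

definition quant_error :: "real measure \<Rightarrow> nat \<Rightarrow> real" where
  "quant_error P n = (INF \<alpha>\<in>codebooks n. distortion P \<alpha>)"

definition optimal_set :: "real measure \<Rightarrow> nat \<Rightarrow> real set \<Rightarrow> bool" where
  "optimal_set P n \<alpha> \<longleftrightarrow> \<alpha> \<in> codebooks n \<and> distortion P \<alpha> = quant_error P n"

definition words :: "nat \<Rightarrow> nat list set" where
  "words k = {\<sigma>. length \<sigma> = k \<and> set \<sigma> \<subseteq> {1, 2}}"

primrec word_map :: "real \<Rightarrow> nat list \<Rightarrow> real \<Rightarrow> real" where
  "word_map r [] = id"
| "word_map r (i # \<sigma>) = cantor_map r i \<circ> word_map r \<sigma>"

definition midpt :: "real \<Rightarrow> nat list \<Rightarrow> real" where
  "midpt r \<sigma> = word_map r \<sigma> (1/2)"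

definition ell :: "nat \<Rightarrow> nat" where
  "ell n = (THE l. 2 ^ l \<le> n \<and> n < 2 ^ (l + 1))"

definition beta_set :: "real \<Rightarrow> nat \<Rightarrow> nat list set \<Rightarrow> real set" where
  "beta_set r n I =
     midpt r ` (words (ell n) - I) \<union> (\<lambda>\<sigma>. midpt r (\<sigma> @ [1])) ` I \<union> (\<lambda>\<sigma>. midpt r (\<sigma> @ [2])) ` I"

definition beta_optimal :: "real \<Rightarrow> bool" where
  "beta_optimal r \<longleftrightarrow>
     (\<forall>n\<ge>2. \<forall>I. I \<subseteq> words (ell n) \<and> card I = n - 2 ^ ell n \<longrightarrow>
        optimal_set (cantor_dist r) n (beta_set r n I))"

definition critical_eq :: "real \<Rightarrow> bool" where
  "critical_eq r \<longleftrightarrow>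
     (r - 1) * (r^4 + r^2) = (r^7 + r^6 + 4*r^5 - 2*r^4 - 2*r^3 - 8*r^2 + 9*r - 3) / 6"

end

theory Submission
  imports Defs
begin

text \<open>
  Let \<open>V\<close> be the variance of \<open>P\<close>, and define \<open>w\<^sub>1 = V\<close> and \<open>w\<^sub>n = r\<^sup>2 / 2 * (w\<^sub>i + w\<^sub>j)\<close> for \<open>n \<ge> 2\<close>, where
  \<open>i + j = n\<close> and \<open>\<bar>i - j\<bar> \<le> 1\<close>. These numbers are \<open>V * split_val (r\<^sup>2) n\<close> below. The set \<open>\<beta>\<^sub>n(I)\<close> has distortion
  at most \<open>w\<^sub>n\<close> (\<open>err_beta_set_le\<close>). A codebook of \<open>n\<close> points in which different points are nearest to the two
  ends \<open>r\<close> and \<open>1 - r\<close> of the central gap consists of two rescaled codebooks, one for each half of the Cantor set.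
  Since \<open>w\<close> is convex, induction shows that its distortion is at least \<open>w\<^sub>n\<close>. So \<open>\<beta>\<^sub>n(I)\<close> can only be beaten by
  a crossing codebook, in which one point serves both sides of the gap.

  With three points there is a crossing codebook \<open>rival\<close> with the cells \<open>J\<^sub>1\<^sub>1 \<union> J\<^sub>1\<^sub>2\<^sub>1\<close>, \<open>J\<^sub>1\<^sub>2\<^sub>2 \<union> J\<^sub>2\<^sub>1\<^sub>1\<close> and
  \<open>J\<^sub>2\<^sub>1\<^sub>2 \<union> J\<^sub>2\<^sub>2\<close>. Its distortion is at most \<open>w\<^sub>3 + crit r / (48 * (1 + r))\<close>, where \<open>crit\<close> is the polynomial of the
  critical equation, which decreases on \<open>(0, 1/2)\<close>. Hence for \<open>r > r\<^sub>0\<close> it beats \<open>\<beta>\<^sub>3(I)\<close>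
  (\<open>not_beta_optimal\<close>). It remains to show that \<open>\<beta>\<^sub>n(I)\<close> is optimal for all \<open>n\<close> at \<open>r\<^sub>0\<close> itself
  (\<open>beta_optimal_critical\<close>); then \<open>r\<^sub>0\<close> is even the maximum of the set in question.

  So let \<open>r = r\<^sub>0\<close>. After rescaling (and reflecting the left half), a crossing codebook becomes a pair of
  codebooks for \<open>P\<close>, each with a distinguished point \<open>- d\<^sub>i\<close>, where \<open>d\<^sub>1 + d\<^sub>2 = 2 D\<close> and \<open>D = (1/2 - r) / r\<close>, and with
  all other points at or beyond \<open>\<bar>d\<^sub>i\<bar>\<close>. The sum of the two distortions has to be bounded from below
  (\<open>crossing\<close>). The parts of the Cantor set next to the gap are badly served. For \<open>n \<ge> 8\<close> this loss alone
  exceeds the value of an additional point, so comparison with codebooks of \<open>n + 1\<close> points suffices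
  (\<open>crossing_many\<close>). For \<open>4 \<le> n \<le> 7\<close> there is room for numerical lower bounds for the distortion of this
  point together with at most three other points (\<open>crossing_few\<close>). For \<open>n = 3\<close> equality occurs. Here the
  position of the shared point is eliminated by completing a square, which leaves a function of the two cut
  positions (\<open>pair_excess\<close>). Near the tie this function is a sum of squares because \<open>crit r = 0\<close>, and elsewhere
  it is bounded numerically.

  The numerical bounds express a distortion through the convex function \<open>G b = E (max 0 (b - x))\<close>, replace \<open>G\<close>
  by chords, and use branch and bound with Bernstein coefficients in integer arithmetic.
\<close>

section \<open>The self-similar measure\<close>

abbreviation coin :: "bool measure" where
  "coin \<equiv> measure_pmf (bernoulli_pmf (1/2))"

text \<open>The random map of the iterated function system: the coin selects one of the two similarities.\<close>

definition branch :: "real \<Rightarrow> bool \<times> real \<Rightarrow> real" where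
  "branch r bx = (if fst bx then r * snd bx + 1 - r else r * snd bx)"

lemma branch_measurable [measurable]: "branch r \<in> borel_measurable (coin \<Otimes>\<^sub>M borel)"
  unfolding branch_def by measurable

lemma cantor_map_measurable [measurable]: "cantor_map r i \<in> borel_measurable borel"
  unfolding cantor_map_def by measurable

lemma emeasure_mixture:
  assumes "prob_space P" and [measurable_cong]: "sets P = sets borel" and [measurable]: "A \<in> sets borel"
  shows "emeasure (distr (coin \<Otimes>\<^sub>M P) borel (branch r)) A =
     ennreal (1/2 * measure (distr P borel (cantor_map r 1)) A + 1/2 * measure (distr P borel (cantor_map r 2)) A)"
proof -
  interpret prob_space P by fact
  interpret D1: prob_space "distr P borel (cantor_map r 1)" by (rule prob_space_distr) measurable
  interpret D2: prob_space "distr P borel (cantor_map r 2)" by (rule prob_space_distr) measurable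
  have [simp]: "space P = UNIV" using sets_eq_imp_space_eq[OF assms(2)] by simp
  have br: "branch r \<in> borel_measurable (coin \<Otimes>\<^sub>M P)" by measurable
  have "emeasure (distr (coin \<Otimes>\<^sub>M P) borel (branch r)) A
      = emeasure (coin \<Otimes>\<^sub>M P) (branch r -` A \<inter> space (coin \<Otimes>\<^sub>M P))"
    by (rule emeasure_distr[OF br]) fact
  also have "\<dots> = (\<integral>\<^sup>+ b. emeasure P (Pair b -` (branch r -` A \<inter> space (coin \<Otimes>\<^sub>M P))) \<partial>coin)"
    by (rule emeasure_pair_measure_alt) (rule measurable_sets[OF br assms(3)])
  also have "\<dots> = emeasure P (cantor_map r 2 -` A) * ennreal (1/2) + emeasure P (cantor_map r 1 -` A) * ennreal (1/2)"
    by (subst nn_integral_bernoulli_pmf)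
       (auto simp: branch_def cantor_map_def vimage_def space_pair_measure)
  also have "emeasure P (cantor_map r 2 -` A) = ennreal (measure (distr P borel (cantor_map r 2)) A)"
    by (subst D2.emeasure_eq_measure[symmetric], subst emeasure_distr) auto
  also have "emeasure P (cantor_map r 1 -` A) = ennreal (measure (distr P borel (cantor_map r 1)) A)"
    by (subst D1.emeasure_eq_measure[symmetric], subst emeasure_distr) auto
  finally have "emeasure (distr (coin \<Otimes>\<^sub>M P) borel (branch r)) A
      = ennreal (measure (distr P borel (cantor_map r 2)) A) * ennreal (1/2)
        + ennreal (measure (distr P borel (cantor_map r 1)) A) * ennreal (1/2)" .
  also have "\<dots> = ennreal (measure (distr P borel (cantor_map r 2)) A * (1/2)
        + measure (distr P borel (cantor_map r 1)) A * (1/2))"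
    by (subst (1 2) ennreal_mult[symmetric]) (auto simp del: ennreal_half)
  finally show ?thesis by (simp add: ac_simps)
qed

text \<open>Self-similarity says that \<open>P\<close> is the law of \<open>branch r (b, x)\<close> for an independent fair coin \<open>b\<close> and
  a \<open>P\<close>-distributed \<open>x\<close>. In this form it can be integrated against functions by Fubini's theorem.\<close>

lemma self_similar_iff_mixture:
  "self_similar r P \<longleftrightarrow> prob_space P \<and> sets P = sets borel \<and> distr (coin \<Otimes>\<^sub>M P) borel (branch r) = P"
proof -
  have "(\<forall>A\<in>sets borel. measure P A = 1/2 * measure (distr P borel (cantor_map r 1)) A +
           1/2 * measure (distr P borel (cantor_map r 2)) A)
      \<longleftrightarrow> distr (coin \<Otimes>\<^sub>M P) borel (branch r) = P" (is "?L \<longleftrightarrow> ?R")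
    if P: "prob_space P" and S: "sets P = sets borel"
  proof -
    interpret prob_space P by fact
    show ?thesis
    proof
      assume L: ?L
      show ?R
      proof (rule measure_eqI)
        fix A assume "A \<in> sets (distr (coin \<Otimes>\<^sub>M P) borel (branch r))"
        then have A: "A \<in> sets borel" by simp
        show "emeasure (distr (coin \<Otimes>\<^sub>M P) borel (branch r)) A = emeasure P A"
          unfolding emeasure_mixture[OF P S A] emeasure_eq_measure using L A by simp
      qed (simp add: S)
    next
      assume R: ?R
      show ?L
      proof
        fix A :: "real set" assume A: "A \<in> sets borel"
        have "ennreal (measure P A) = ennreal (1/2 * measure (distr P borel (cantor_map r 1)) A +
           1/2 * measure (distr P borel (cantor_map r 2)) A)"
          using emeasure_mixture[OF P S A, of r] R emeasure_eq_measure[of A] by simp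
        then show "measure P A = 1/2 * measure (distr P borel (cantor_map r 1)) A +
           1/2 * measure (distr P borel (cantor_map r 2)) A"
          by (subst (asm) ennreal_inj) auto
      qed
    qed
  qed
  then show ?thesis unfolding self_similar_def by blast
qed

lemma integral_self_similar:
  fixes f :: "real \<Rightarrow> 'b::{banach, second_countable_topology}"
  assumes P: "self_similar r P" and int: "integrable P f"
  shows "(LINT x|P. f x) = (1/2) *\<^sub>R (LINT x|P. f (r * x)) + (1/2) *\<^sub>R (LINT x|P. f (r * x + 1 - r))"
proof -
  have *: "prob_space P" and [measurable_cong]: "sets P = sets borel"
    and eq: "distr (coin \<Otimes>\<^sub>M P) borel (branch r) = P"
    using P unfolding self_similar_iff_mixture by auto
  interpret prob_space P by fact
  interpret PP: pair_prob_space coin P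
    by (simp add: pair_prob_space_def pair_sigma_finite_def * measure_pmf.prob_space_axioms
        measure_pmf.sigma_finite_measure_axioms sigma_finite_measure_axioms)
  have [measurable]: "f \<in> borel_measurable borel"
    using borel_measurable_integrable[OF int] by simp
  have br: "branch r \<in> borel_measurable (coin \<Otimes>\<^sub>M P)" by measurable
  have "integrable (distr (coin \<Otimes>\<^sub>M P) borel (branch r)) f" using eq int by simp
  then have int2: "integrable (coin \<Otimes>\<^sub>M P) (\<lambda>x. f (branch r x))"
    by (subst (asm) integrable_distr_eq[OF br]) auto
  have "(LINT x|P. f x) = (LINT x|distr (coin \<Otimes>\<^sub>M P) borel (branch r). f x)" using eq by simp
  also have "\<dots> = (LINT x|(coin \<Otimes>\<^sub>M P). f (branch r x))" by (rule integral_distr[OF br]) simp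
  also have "\<dots> = (LINT b|coin. (LINT x|P. f (branch r (b, x))))"
    by (rule PP.integral_fst'[symmetric, OF int2])
  also have "\<dots> = (1/2) *\<^sub>R (LINT x|P. f (r * x)) + (1/2) *\<^sub>R (LINT x|P. f (r * x + 1 - r))"
    by (subst integral_measure_pmf[of UNIV]) (auto simp: UNIV_bool branch_def)
  finally show ?thesis .
qed

lemma char_self_similar:
  assumes P: "self_similar r P"
  shows "char P t = (1/2) * (1 + iexp (t * (1 - r))) * char P (r * t)"
proof -
  have *: "prob_space P" and [measurable_cong]: "sets P = sets borel"
    using P unfolding self_similar_def by auto
  interpret prob_space P by fact
  have "integrable P (\<lambda>x. iexp (t * x))" by (rule integrable_iexp) auto
  from integral_self_similar[OF P this]
  have "char P t = (1/2) *\<^sub>R char P (r * t) + (1/2) *\<^sub>R (CLINT x|P. iexp (t * (r * x + 1 - r)))"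
    by (simp add: char_def mult_ac)
  also have "(\<lambda>x. iexp (t * (r * x + 1 - r))) = (\<lambda>x. iexp (t * (1 - r)) * iexp (r * t * x))"
    by (auto simp: fun_eq_iff exp_add[symmetric] algebra_simps)
  also have "(CLINT x|P. iexp (t * (1 - r)) * iexp (r * t * x)) = iexp (t * (1 - r)) * char P (r * t)"
    unfolding char_def by (rule integral_mult_right_zero)
  finally show ?thesis by (simp add: scaleR_conv_of_real algebra_simps)
qed

text \<open>The functional equation of the characteristic function expresses \<open>char P t\<close> through
  \<open>char P (r ^ n * t)\<close> with a factor of modulus at most one, and every characteristic function is
  continuous at \<open>0\<close> with value \<open>1\<close>.\<close>

lemma self_similar_unique:
  assumes r: "0 < r" "r < 1" and P: "self_similar r P" and Q: "self_similar r Q"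
  shows "P = Q"
proof (rule Levy_uniqueness)
  have pP: "prob_space P" "sets P = sets borel" and pQ: "prob_space Q" "sets Q = sets borel"
    using P Q unfolding self_similar_def by auto
  show rP: "real_distribution P" and rQ: "real_distribution Q"
    using pP pQ by (auto simp: real_distribution_def real_distribution_axioms_def)
  show "char P = char Q"
  proof
    fix t
    have step: "norm (char P t - char Q t) \<le> norm (char P (r ^ n * t) - char Q (r ^ n * t))" for n
    proof (induction n)
      case (Suc n)
      let ?u = "r ^ n * t"
      have "char P ?u - char Q ?u = (1/2) * (1 + iexp (?u * (1 - r))) * (char P (r * ?u) - char Q (r * ?u))"
        by (simp only: char_self_similar[OF P, of ?u] char_self_similar[OF Q, of ?u] right_diff_distrib)
      then have "norm (char P ?u - char Q ?u)
          = norm ((1/2) * (1 + iexp (?u * (1 - r)))) * norm (char P (r * ?u) - char Q (r * ?u))"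
        by (simp only: norm_mult)
      also have "norm ((1/2) * (1 + iexp (?u * (1 - r)))) \<le> 1"
        using norm_triangle_ineq[of 1 "iexp (?u * (1 - r))"] by (simp add: norm_mult)
      finally have "norm (char P ?u - char Q ?u) \<le> norm (char P (r * ?u) - char Q (r * ?u))"
        by (simp add: mult_right_mono)
      with Suc show ?case by (simp add: mult_ac)
    qed simp
    have lim: "(\<lambda>n. r ^ n * t) \<longlonglongrightarrow> 0"
      using tendsto_mult_left_zero[OF LIMSEQ_power_zero[of r], of t] r by simp
    have "(\<lambda>n. char P (r ^ n * t) - char Q (r ^ n * t)) \<longlonglongrightarrow> char P 0 - char Q 0"
      by (intro tendsto_diff isCont_tendsto_compose[OF _ lim]
          real_distribution.isCont_char rP rQ)
    then have "(\<lambda>n. norm (char P (r ^ n * t) - char Q (r ^ n * t))) \<longlonglongrightarrow> 0"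
      using real_distribution.char_zero[OF rP] real_distribution.char_zero[OF rQ]
      by (simp add: tendsto_norm_zero_iff)
    then have "norm (char P t - char Q t) \<le> 0"
      by (rule LIMSEQ_le_const) (use step in auto)
    then show "char P t = char Q t" by simp
  qed
qed

subsection \<open>Existence\<close>

text \<open>The point whose address in the Cantor set is the given sequence of left and right choices.\<close>

definition cantor_sum :: "real \<Rightarrow> bool stream \<Rightarrow> real" where
  "cantor_sum r s = (\<Sum>k. (1 - r) * r ^ k * (if s !! k then 1 else 0))"

lemma cantor_sum_summable:
  fixes r :: real
  assumes "0 < r" "r < 1"
  shows "summable (\<lambda>k. (1 - r) * r ^ k * (if s !! k then 1 else 0 :: real))"
  by (rule summable_comparison_test[of _ "\<lambda>k. (1 - r) * r ^ k"])
     (use assms in \<open>auto intro!: summable_mult summable_geometric exI[of _ 0]\<close>)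

lemma cantor_sum_Stream:
  assumes "0 < r" "r < 1"
  shows "cantor_sum r (b ## s) = branch r (b, cantor_sum r s)"
proof -
  have "cantor_sum r (b ## s) = (1 - r) * (if b then 1 else 0) + (\<Sum>k. (1 - r) * r ^ Suc k * (if s !! k then 1 else 0))"
    using suminf_split_head[OF cantor_sum_summable[OF assms, of "b ## s"]]
    by (simp add: cantor_sum_def del: power_Suc)
  also have "(\<Sum>k. (1 - r) * r ^ Suc k * (if s !! k then 1 else 0)) = r * cantor_sum r s"
    unfolding cantor_sum_def
    by (subst suminf_mult[OF cantor_sum_summable[OF assms], symmetric]) (simp add: mult_ac)
  finally show ?thesis by (auto simp: branch_def)
qed

lemma cantor_sum_range:
  assumes "0 < r" "r < 1"
  shows "0 \<le> cantor_sum r s" "cantor_sum r s \<le> 1"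
proof -
  show "0 \<le> cantor_sum r s" unfolding cantor_sum_def
    by (rule suminf_nonneg[OF cantor_sum_summable]) (use assms in auto)
  have "cantor_sum r s \<le> (\<Sum>k. (1 - r) * r ^ k)" unfolding cantor_sum_def
    by (rule suminf_le[OF _ cantor_sum_summable])
       (use assms in \<open>auto intro!: summable_mult summable_geometric\<close>)
  also have "\<dots> = (1 - r) * (1 / (1 - r))"
    using assms by (subst suminf_mult) (auto simp: suminf_geometric)
  finally show "cantor_sum r s \<le> 1" using assms by simp
qed

lemma cantor_sum_measurable [measurable]: "cantor_sum r \<in> borel_measurable (stream_space coin)"
  unfolding cantor_sum_def by measurable

text \<open>Prepending a coin toss to the sequence applies one of the two similarities to the series, and
  prepending an independent toss does not change the law of the sequence.\<close>

lemma self_similar_distr_cantor_sum: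
  assumes r: "0 < r" "r < 1"
  shows "self_similar r (distr (stream_space coin) borel (cantor_sum r))" (is "self_similar r ?P")
proof -
  interpret S: prob_space "stream_space coin"
    by (rule prob_space.prob_space_stream_space) (rule measure_pmf.prob_space_axioms)
  interpret P: prob_space ?P by (rule S.prob_space_distr) simp
  have "distr (coin \<Otimes>\<^sub>M ?P) borel (branch r) = ?P"
  proof (rule measure_eqI)
    fix A assume "A \<in> sets (distr (coin \<Otimes>\<^sub>M ?P) borel (branch r))"
    then have A[measurable]: "A \<in> sets borel" by simp
    have br: "branch r \<in> borel_measurable (coin \<Otimes>\<^sub>M ?P)" by measurable
    have "emeasure (distr (coin \<Otimes>\<^sub>M ?P) borel (branch r)) A
      = emeasure (coin \<Otimes>\<^sub>M ?P) (branch r -` A \<inter> space (coin \<Otimes>\<^sub>M ?P))"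
      by (rule emeasure_distr[OF br A])
    also have "\<dots> = (\<integral>\<^sup>+ b. emeasure ?P (Pair b -` (branch r -` A \<inter> space (coin \<Otimes>\<^sub>M ?P))) \<partial>coin)"
      by (rule P.emeasure_pair_measure_alt) (rule measurable_sets[OF br A])
    also have "\<dots> = (\<integral>\<^sup>+ b. emeasure (stream_space coin)
         {s \<in> space (stream_space coin). b ## s \<in> cantor_sum r -` A \<inter> space (stream_space coin)} \<partial>coin)"
    proof (rule nn_integral_cong)
      fix b
      have "Pair b -` (branch r -` A \<inter> space (coin \<Otimes>\<^sub>M ?P)) = {x. branch r (b, x) \<in> A}"
        by (auto simp: space_pair_measure)
      moreover have "{x. branch r (b, x) \<in> A} \<in> sets borel"
      proof -
        have "(\<lambda>x. branch r (b, x)) \<in> borel_measurable borel"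
          by (cases b) (simp_all add: branch_def)
        from measurable_sets[OF this A] show ?thesis by (simp add: vimage_def)
      qed
      ultimately show "emeasure ?P (Pair b -` (branch r -` A \<inter> space (coin \<Otimes>\<^sub>M ?P)))
        = emeasure (stream_space coin)
         {s \<in> space (stream_space coin). b ## s \<in> cantor_sum r -` A \<inter> space (stream_space coin)}"
        by (simp add: emeasure_distr cantor_sum_Stream[OF r] space_stream_space vimage_def)
    qed
    also have "\<dots> = emeasure (stream_space coin) (cantor_sum r -` A \<inter> space (stream_space coin))"
      by (rule prob_space.emeasure_stream_space[symmetric, OF measure_pmf.prob_space_axioms]) measurable
    also have "\<dots> = emeasure ?P A" by (simp add: emeasure_distr)
    finally show "emeasure (distr (coin \<Otimes>\<^sub>M ?P) borel (branch r)) A = emeasure ?P A" .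
  qed simp
  then show ?thesis unfolding self_similar_iff_mixture using P.prob_space_axioms by simp
qed

lemma cantor_dist_eq:
  assumes r: "0 < r" "r < 1"
  shows "cantor_dist r = distr (stream_space coin) borel (cantor_sum r)"
  unfolding cantor_dist_def
  by (rule the_equality) (use self_similar_distr_cantor_sum[OF r] self_similar_unique[OF r] in auto)

lemma self_similar_cantor_dist:
  assumes r: "0 < r" "r < 1"
  shows "self_similar r (cantor_dist r)"
  using self_similar_distr_cantor_sum[OF r] cantor_dist_eq[OF r] by simp

lemma AE_cantor_dist:
  assumes r: "0 < r" "r < 1"
  shows "AE x in cantor_dist r. 0 \<le> x \<and> x \<le> 1"
  unfolding cantor_dist_eq[OF r]
  by (subst AE_distr_iff) (auto simp: cantor_sum_range[OF r])

text \<open>Reflection exchanges the two maps, so the reflected measure is self-similar as well.\<close>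

lemma cantor_dist_reflect:
  assumes r: "0 < r" "r < 1"
  shows "distr (cantor_dist r) borel (\<lambda>x. 1 - x) = cantor_dist r"
proof (rule self_similar_unique[OF r _ self_similar_cantor_dist[OF r]])
  let ?P = "cantor_dist r" and ?R = "\<lambda>x::real. 1 - x"
  have ss: "self_similar r ?P" by (rule self_similar_cantor_dist[OF r])
  have p: "prob_space ?P" and [measurable_cong]: "sets ?P = sets borel"
    using ss unfolding self_similar_def by auto
  have [simp]: "space ?P = UNIV"
    using sets_eq_imp_space_eq[of ?P borel] \<open>sets ?P = sets borel\<close> by simp
  have swap: "measure (distr (distr ?P borel ?R) borel (cantor_map r i)) A
      = measure (distr ?P borel (cantor_map r j)) (?R -` A)"
    if "A \<in> sets borel" and ij: "{i, j} = {1, 2}" for A i j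
  proof -
    have [measurable]: "A \<in> sets borel" by fact
    have "?R -` A \<in> sets borel" using measurable_sets[of ?R borel borel A] that by simp
    moreover have "cantor_map r i (?R x) = ?R (cantor_map r j x)" for x
      using ij by (auto simp: cantor_map_def doubleton_eq_iff algebra_simps)
    ultimately show ?thesis
      by (simp add: distr_distr measure_distr vimage_def)
  qed
  show "self_similar r (distr ?P borel ?R)"
    unfolding self_similar_def
  proof (intro conjI ballI)
    show "prob_space (distr ?P borel ?R)" by (rule prob_space.prob_space_distr[OF p]) measurable
    fix A :: "real set" assume A: "A \<in> sets borel"
    have RA: "?R -` A \<in> sets borel" using measurable_sets[of ?R borel borel A] A by simp
    have "measure (distr ?P borel ?R) A = measure ?P (?R -` A)"
      using A by (simp add: measure_distr)
    also have "\<dots> = 1/2 * measure (distr ?P borel (cantor_map r 1)) (?R -` A) +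
           1/2 * measure (distr ?P borel (cantor_map r 2)) (?R -` A)"
      using ss RA unfolding self_similar_def by blast
    finally show "measure (distr ?P borel ?R) A =
        1/2 * measure (distr (distr ?P borel ?R) borel (cantor_map r 1)) A +
        1/2 * measure (distr (distr ?P borel ?R) borel (cantor_map r 2)) A"
      using swap[OF A, of 1 2] swap[OF A, of 2 1] by (simp add: insert_commute)
  qed simp
qed

section \<open>Expectations under the Cantor distribution\<close>

locale cantor_parameter =
  fixes r :: real
  assumes r_pos: "0 < r" and r_less: "r < 1/2"
begin

abbreviation P :: "real measure" where "P \<equiv> cantor_dist r"

definition E :: "(real \<Rightarrow> real) \<Rightarrow> real" where "E f = (LINT x|P. f x)"

text \<open>The variance of the Cantor distribution, see \<open>E_square_dist\<close> below.\<close>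

definition V :: real where "V = (1 - r) / (4 * (1 + r))"

lemma r_bounds: "0 < r" "r < 1" "r \<noteq> 0" "0 \<le> r"
  using r_pos r_less by auto

lemma self_similar_P: "self_similar r P"
  by (rule self_similar_cantor_dist) (rule r_bounds)+

lemma prob_space_P: "prob_space P" and sets_P [measurable_cong]: "sets P = sets borel"
  using self_similar_P unfolding self_similar_def by auto

lemma AE_P: "AE x in P. 0 \<le> x \<and> x \<le> 1"
  by (rule AE_cantor_dist) (rule r_bounds)+

text \<open>All integrands below are continuous, and \<open>P\<close> lives on the compact interval \<open>[0, 1]\<close>. Hence
  integrability and comparison of integrals reduce to continuity and to inequalities on \<open>[0, 1]\<close>.\<close>

lemma integrable_P:
  assumes "continuous_on UNIV f"
  shows "integrable P (f :: real \<Rightarrow> real)"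
proof -
  interpret prob_space P by (rule prob_space_P)
  have [measurable]: "f \<in> borel_measurable borel"
    by (rule borel_measurable_continuous_onI) fact
  have "compact (f ` {0..1})"
    by (intro compact_continuous_image continuous_on_subset[OF assms]) auto
  then obtain B where B: "\<And>y. y \<in> f ` {0..1} \<Longrightarrow> norm y \<le> B"
    using compact_imp_bounded bounded_iff by metis
  have "norm (f x) \<le> B" if "0 \<le> x \<and> x \<le> 1" for x using B[of "f x"] that by simp
  then have "AE x in P. norm (f x) \<le> B" by (rule eventually_mono[OF AE_P])
  then show ?thesis by (rule integrable_const_bound) measurable
qed

lemma E_mono:
  assumes "continuous_on UNIV f" "continuous_on UNIV g" "\<And>x. 0 \<le> x \<Longrightarrow> x \<le> 1 \<Longrightarrow> f x \<le> g x"
  shows "E f \<le> E g"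
  unfolding E_def
  by (rule integral_mono_AE[OF integrable_P integrable_P]) (use assms AE_P in auto)

lemma E_cong:
  assumes "continuous_on UNIV f" "continuous_on UNIV g" "\<And>x. 0 \<le> x \<Longrightarrow> x \<le> 1 \<Longrightarrow> f x = g x"
  shows "E f = E g"
  using E_mono[of f g] E_mono[of g f] assms by (metis antisym order_refl)

lemma E_add:
  assumes "continuous_on UNIV f" "continuous_on UNIV g"
  shows "E (\<lambda>x. f x + g x) = E f + E g"
  unfolding E_def using assms by (intro Bochner_Integration.integral_add integrable_P)

lemma E_diff:
  assumes "continuous_on UNIV f" "continuous_on UNIV g"
  shows "E (\<lambda>x. f x - g x) = E f - E g"
  unfolding E_def using assms by (intro Bochner_Integration.integral_diff integrable_P)

lemma E_cmult: "E (\<lambda>x. c * f x) = c * E f"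
  unfolding E_def by simp

lemma E_const: "E (\<lambda>x. c) = c"
  using prob_space.prob_space[OF prob_space_P] by (simp add: E_def)

lemma E_split:
  assumes "continuous_on UNIV f"
  shows "E f = (E (\<lambda>x. f (r * x)) + E (\<lambda>x. f (r * x + 1 - r))) / 2"
  unfolding E_def using integral_self_similar[OF self_similar_P integrable_P[OF assms]] by simp

lemma E_reflect:
  assumes "continuous_on UNIV f"
  shows "E (\<lambda>x. f (1 - x)) = E f"
proof -
  have [measurable]: "f \<in> borel_measurable borel"
    by (rule borel_measurable_continuous_onI) fact
  have "E f = (LINT x|distr P borel (\<lambda>x. 1 - x). f x)"
    unfolding E_def using cantor_dist_reflect[of r] r_bounds by simp
  also have "\<dots> = E (\<lambda>x. f (1 - x))"
    unfolding E_def by (rule integral_distr) measurable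
  finally show ?thesis by simp
qed

lemma E_nonneg:
  assumes "continuous_on UNIV f" "\<And>x. 0 \<le> x \<Longrightarrow> x \<le> 1 \<Longrightarrow> 0 \<le> f x"
  shows "0 \<le> E f"
  using E_mono[of "\<lambda>_. 0" f] assms by (simp add: E_const)

lemma E_id: "E (\<lambda>x. x) = 1/2"
proof -
  have "E (\<lambda>x. x) = E (\<lambda>x. 1 - x)" by (rule E_reflect[symmetric]) (intro continuous_intros)
  also have "\<dots> = 1 - E (\<lambda>x. x)" by (subst E_diff) (auto intro!: continuous_intros simp: E_const)
  finally show ?thesis by simp
qed

lemma E_affine: "E (\<lambda>x. a * x + b) = a / 2 + b"
  by (subst E_add) (auto intro!: continuous_intros simp: E_const E_cmult E_id)

lemma V_pos: "0 < V"
  using r_bounds by (simp add: V_def)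

lemma V_eq: "V = r\<^sup>2 * V + (1 - r)\<^sup>2 / 4"
proof -
  have "1 + r \<noteq> 0" using r_pos by auto
  have "4 * (1 + r) * V = 1 - r" using \<open>1 + r \<noteq> 0\<close> unfolding V_def by simp
  then have "(1 - r) * (4 * (1 + r) * V) = (1 - r) * (1 - r)" by (rule arg_cong)
  then have "4 * V - 4 * (r\<^sup>2 * V) = (1 - r)\<^sup>2" by (simp add: power2_eq_square algebra_simps)
  then show ?thesis by linarith
qed

text \<open>By self-similarity the second central moment is a fixed point of \<open>M \<mapsto> r\<^sup>2 M + (1 - r)\<^sup>2 / 4\<close>, and \<open>V\<close> is
  the only one.\<close>

lemma E_square_dist: "E (\<lambda>x. (x - a)\<^sup>2) = V + (a - 1/2)\<^sup>2"
proof -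
  let ?M = "E (\<lambda>x. (x - 1/2)\<^sup>2)"
  have shift: "E (\<lambda>x. s * (x - 1/2)\<^sup>2 + (t * x + u)) = s * ?M + (t / 2 + u)" for s t u
    by (subst E_add) (auto intro!: continuous_intros simp: E_cmult E_affine)
  have 1: "(\<lambda>x. (r * x - 1/2)\<^sup>2) = (\<lambda>x. r\<^sup>2 * (x - 1/2)\<^sup>2 + ((r\<^sup>2 - r) * x + (1/4 - r\<^sup>2 / 4)))"
    and 2: "(\<lambda>x. (r * x + 1 - r - 1/2)\<^sup>2)
      = (\<lambda>x. r\<^sup>2 * (x - 1/2)\<^sup>2 + ((r - r\<^sup>2) * x + ((1/2 - r)\<^sup>2 - r\<^sup>2 / 4)))"
    by (auto simp: fun_eq_iff power2_eq_square algebra_simps)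
  have "?M = (E (\<lambda>x. (r * x - 1/2)\<^sup>2) + E (\<lambda>x. (r * x + 1 - r - 1/2)\<^sup>2)) / 2"
    by (rule E_split) (intro continuous_intros)
  also have "\<dots> = r\<^sup>2 * ?M + (1 - r)\<^sup>2 / 4"
    unfolding 1 2 shift by (simp add: power2_eq_square field_simps)
  finally have "(1 - r\<^sup>2) * ?M = (1 - r\<^sup>2) * V"
    using V_eq by (simp add: algebra_simps)
  moreover have "1 - r\<^sup>2 \<noteq> 0" using r_bounds by (simp add: power2_eq_1_iff)
  ultimately have M: "?M = V" by simp
  have "(\<lambda>x. (x - a)\<^sup>2) = (\<lambda>x. 1 * (x - 1/2)\<^sup>2 + ((1 - 2 * a) * x + (a\<^sup>2 - 1/4)))"
    by (auto simp: fun_eq_iff power2_eq_square algebra_simps)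
  then have "E (\<lambda>x. (x - a)\<^sup>2) = 1 * ?M + ((1 - 2 * a) / 2 + (a\<^sup>2 - 1/4))" by (simp only: shift)
  then show ?thesis using M by (simp add: power2_eq_square field_simps)
qed

lemma E_square_affine: "E (\<lambda>x. (s * x + t)\<^sup>2) = s\<^sup>2 * V + (s / 2 + t)\<^sup>2"
proof (cases "s = 0")
  case False
  have "(\<lambda>x. (s * x + t)\<^sup>2) = (\<lambda>x. s\<^sup>2 * (x - (- t / s))\<^sup>2)"
    using False by (auto simp: fun_eq_iff power2_eq_square field_simps)
  then have "E (\<lambda>x. (s * x + t)\<^sup>2) = s\<^sup>2 * (V + (- t / s - 1/2)\<^sup>2)"
    by (simp only: E_cmult E_square_dist)
  also have "\<dots> = s\<^sup>2 * V + (s / 2 + t)\<^sup>2" using False by (simp add: power2_eq_square field_simps)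
  finally show ?thesis .
qed (simp add: E_const)

subsection \<open>The expected positive part\<close>

text \<open>Moving from a codepoint \<open>a\<close> to a codepoint \<open>b > a\<close> changes the squared distance to \<open>x\<close> by
  \<open>2 (b - a) ((a + b) / 2 - x)\<close>. Therefore every distortion can be expressed through the values of \<open>G\<close> at
  the points \<open>(a + b) / 2\<close> where the nearest codepoint changes.\<close>

definition G :: "real \<Rightarrow> real" where "G b = E (\<lambda>x. max 0 (b - x))"

lemma G_nonpos: assumes "b \<le> 0" shows "G b = 0"
proof -
  have "G b = E (\<lambda>_. 0)" unfolding G_def using assms by (intro E_cong continuous_intros) auto
  then show ?thesis by (simp add: E_const)
qed

lemma G_ge_1: assumes "1 \<le> b" shows "G b = b - 1/2"
proof -
  have "G b = E (\<lambda>x. (-1) * x + b)" unfolding G_def using assms by (intro E_cong continuous_intros) auto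
  then show ?thesis by (simp only: E_affine)
qed

lemma G_nonneg: "0 \<le> G b"
  unfolding G_def by (intro E_nonneg continuous_intros) auto

lemma G_mono: assumes "a \<le> b" shows "G a \<le> G b"
  unfolding G_def using assms by (intro E_mono continuous_intros) auto

lemma G_step: "G b = r / 2 * G (b / r) + r / 2 * G (1 - (1 - b) / r)"
proof -
  have "G b = (E (\<lambda>x. max 0 (b - r * x)) + E (\<lambda>x. max 0 (b - (r * x + 1 - r)))) / 2"
    unfolding G_def by (rule E_split) (intro continuous_intros)
  moreover have "(\<lambda>x. max 0 (b - r * x)) = (\<lambda>x. r * max 0 (b / r - x))"
    using r_pos by (auto simp: fun_eq_iff max_def field_simps)
  moreover have "(\<lambda>x. max 0 (b - (r * x + 1 - r))) = (\<lambda>x. r * max 0 (1 - (1 - b) / r - x))"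
    using r_pos by (auto simp: fun_eq_iff max_def field_simps)
  ultimately show ?thesis by (simp add: E_cmult G_def algebra_simps)
qed

lemma G_convex:
  assumes "0 \<le> t" "t \<le> 1"
  shows "G ((1 - t) * a + t * b) \<le> (1 - t) * G a + t * G b"
proof -
  have "G ((1 - t) * a + t * b) \<le> E (\<lambda>x. (1 - t) * max 0 (a - x) + t * max 0 (b - x))"
    unfolding G_def
  proof (intro E_mono continuous_intros)
    fix x
    have "(1 - t) * a + t * b - x = (1 - t) * (a - x) + t * (b - x)" by (simp add: algebra_simps)
    also have "\<dots> \<le> (1 - t) * max 0 (a - x) + t * max 0 (b - x)"
      using assms by (intro add_mono mult_left_mono) auto
    finally show "max 0 ((1 - t) * a + t * b - x) \<le> (1 - t) * max 0 (a - x) + t * max 0 (b - x)"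
      using assms by auto
  qed
  also have "\<dots> = (1 - t) * G a + t * G b"
    by (subst E_add) (auto intro!: continuous_intros simp: E_cmult G_def)
  finally show ?thesis .
qed

text \<open>This is how finitely many values of the convex function \<open>G\<close> yield upper bounds everywhere.\<close>

lemma G_chord:
  assumes "lo \<le> b" "b \<le> hi" "G lo \<le> u * lo + w" "G hi \<le> u * hi + w"
  shows "G b \<le> u * b + w"
proof (cases "lo = hi")
  case False
  define t where "t = (b - lo) / (hi - lo)"
  have t01: "0 \<le> t" "t \<le> 1" using assms False by (auto simp: t_def field_simps)
  have "t * (hi - lo) = b - lo" using False by (simp add: t_def)
  then have t: "0 \<le> t" "t \<le> 1" "b = (1 - t) * lo + t * hi"
    using t01 by (auto simp: algebra_simps)
  have "G b \<le> (1 - t) * G lo + t * G hi" unfolding t(3) by (rule G_convex) fact+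
  also have "\<dots> \<le> (1 - t) * (u * lo + w) + t * (u * hi + w)"
    using assms t by (intro add_mono mult_left_mono) auto
  also have "\<dots> = u * b + w" unfolding t(3) by (simp add: algebra_simps)
  finally show ?thesis .
qed (use assms in auto)

subsection \<open>Distortion\<close>

definition sq_dist :: "real set \<Rightarrow> real \<Rightarrow> real" where
  "sq_dist \<alpha> x = Min ((\<lambda>a. (x - a)\<^sup>2) ` \<alpha>)"

lemma distortion_eq: "distortion P \<alpha> = E (sq_dist \<alpha>)"
  by (simp add: distortion_def E_def sq_dist_def)

lemma sq_dist_le: "finite \<alpha> \<Longrightarrow> a \<in> \<alpha> \<Longrightarrow> sq_dist \<alpha> x \<le> (x - a)\<^sup>2"
  by (simp add: sq_dist_def)

lemma sq_dist_geI: "finite \<alpha> \<Longrightarrow> \<alpha> \<noteq> {} \<Longrightarrow> (\<And>a. a \<in> \<alpha> \<Longrightarrow> y \<le> (x - a)\<^sup>2) \<Longrightarrow> y \<le> sq_dist \<alpha> x"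
  by (simp add: sq_dist_def)

lemma sq_dist_attained: "finite \<alpha> \<Longrightarrow> \<alpha> \<noteq> {} \<Longrightarrow> \<exists>a\<in>\<alpha>. sq_dist \<alpha> x = (x - a)\<^sup>2"
proof -
  assume "finite \<alpha>" "\<alpha> \<noteq> {}"
  then have "Min ((\<lambda>a. (x - a)\<^sup>2) ` \<alpha>) \<in> (\<lambda>a. (x - a)\<^sup>2) ` \<alpha>" by (intro Min_in) auto
  then show ?thesis by (auto simp only: sq_dist_def image_iff)
qed

lemma sq_dist_nonneg: "finite \<alpha> \<Longrightarrow> \<alpha> \<noteq> {} \<Longrightarrow> 0 \<le> sq_dist \<alpha> x"
  by (rule sq_dist_geI) auto

lemma continuous_on_sq_dist:
  assumes "finite \<alpha>" "\<alpha> \<noteq> {}"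
  shows "continuous_on UNIV (sq_dist \<alpha>)"
  using assms
proof (induction rule: finite_ne_induct)
  case (singleton a)
  then show ?case by (simp add: sq_dist_def) (intro continuous_intros)
next
  case (insert a \<alpha>)
  then have "sq_dist (insert a \<alpha>) = (\<lambda>x. min ((x - a)\<^sup>2) (sq_dist \<alpha> x))"
    by (auto simp: sq_dist_def fun_eq_iff)
  then show ?case using insert by (auto intro!: continuous_intros)
qed

lemma continuous_on_sq_dist_comp [continuous_intros]:
  assumes "finite \<alpha>" "\<alpha> \<noteq> {}" "continuous_on UNIV f"
  shows "continuous_on UNIV (\<lambda>x. sq_dist \<alpha> (f x))"
  by (rule continuous_on_compose2[OF continuous_on_sq_dist[OF assms(1,2)] assms(3)]) auto

lemma sq_dist_affine:
  assumes "finite \<alpha>" "\<alpha> \<noteq> {}" "s \<noteq> 0"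
  shows "sq_dist \<alpha> (s * x + t) = s\<^sup>2 * sq_dist ((\<lambda>a. (a - t) / s) ` \<alpha>) x"
proof -
  have eq: "(s * x + t - a)\<^sup>2 = s\<^sup>2 * (x - (a - t) / s)\<^sup>2" for a
    using assms(3) by (simp add: power2_eq_square field_simps)
  have "sq_dist \<alpha> (s * x + t) = Min ((\<lambda>y. s\<^sup>2 * y) ` (\<lambda>a. (x - (a - t) / s)\<^sup>2) ` \<alpha>)"
    unfolding sq_dist_def image_image eq ..
  also have "\<dots> = s\<^sup>2 * Min ((\<lambda>a. (x - (a - t) / s)\<^sup>2) ` \<alpha>)"
    by (rule mono_Min_commute[symmetric]) (auto intro!: monoI mult_left_mono simp: assms)
  finally show ?thesis by (simp add: sq_dist_def image_image)
qed

definition err :: "real set \<Rightarrow> real" where "err \<alpha> = E (sq_dist \<alpha>)"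

lemma err_eq: "distortion P \<alpha> = err \<alpha>"
  by (simp add: err_def distortion_eq)

lemma err_nonneg: "finite \<alpha> \<Longrightarrow> \<alpha> \<noteq> {} \<Longrightarrow> 0 \<le> err \<alpha>"
  unfolding err_def by (intro E_nonneg continuous_intros sq_dist_nonneg)

lemma err_singleton: "err {a} = V + (a - 1/2)\<^sup>2"
  by (simp add: err_def sq_dist_def[abs_def] E_square_dist)

lemma err_reflect:
  assumes "finite \<alpha>" "\<alpha> \<noteq> {}"
  shows "err ((\<lambda>a. 1 - a) ` \<alpha>) = err \<alpha>"
proof -
  have "sq_dist \<alpha> (1 - x) = sq_dist ((\<lambda>a. 1 - a) ` \<alpha>) x" for x
    using sq_dist_affine[OF assms, of "-1" x 1] by simp
  then show ?thesis
    using E_reflect[OF continuous_on_sq_dist[OF assms]] by (simp add: err_def)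
qed

text \<open>The two halves of the Cantor set may be served by different parts of the codebook. The parts need only
  do as well as \<open>\<alpha>\<close> on their own half, so a point that serves both halves is put into both parts.\<close>

lemma err_split:
  assumes fin: "finite \<alpha>" "finite \<alpha>1" "finite \<alpha>2" and ne: "\<alpha> \<noteq> {}" "\<alpha>1 \<noteq> {}" "\<alpha>2 \<noteq> {}"
    and left: "\<And>x. 0 \<le> x \<Longrightarrow> x \<le> r \<Longrightarrow> sq_dist \<alpha>1 x \<le> sq_dist \<alpha> x"
    and right: "\<And>x. 1 - r \<le> x \<Longrightarrow> x \<le> 1 \<Longrightarrow> sq_dist \<alpha>2 x \<le> sq_dist \<alpha> x"
  shows "r\<^sup>2 / 2 * (err ((\<lambda>a. a / r) ` \<alpha>1) + err ((\<lambda>a. (a - (1 - r)) / r) ` \<alpha>2)) \<le> err \<alpha>"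
proof -
  have 1: "r\<^sup>2 * err ((\<lambda>a. a / r) ` \<alpha>1) \<le> E (\<lambda>x. sq_dist \<alpha> (r * x))"
  proof -
    have "r\<^sup>2 * err ((\<lambda>a. a / r) ` \<alpha>1) = E (\<lambda>x. sq_dist \<alpha>1 (r * x))"
      unfolding err_def E_cmult[symmetric]
      using sq_dist_affine[OF fin(2) ne(2) r_bounds(3), of _ 0] by simp
    also have "\<dots> \<le> E (\<lambda>x. sq_dist \<alpha> (r * x))"
      using fin ne r_bounds mult_left_le[of _ r]
      by (intro E_mono continuous_intros left) auto
    finally show ?thesis .
  qed
  have 2: "r\<^sup>2 * err ((\<lambda>a. (a - (1 - r)) / r) ` \<alpha>2) \<le> E (\<lambda>x. sq_dist \<alpha> (r * x + 1 - r))"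
  proof -
    have "r\<^sup>2 * err ((\<lambda>a. (a - (1 - r)) / r) ` \<alpha>2) = E (\<lambda>x. sq_dist \<alpha>2 (r * x + (1 - r)))"
      unfolding err_def E_cmult[symmetric]
      using sq_dist_affine[OF fin(3) ne(3) r_bounds(3), of _ "1 - r"] by simp
    also have "\<dots> \<le> E (\<lambda>x. sq_dist \<alpha> (r * x + (1 - r)))"
      using fin ne r_bounds mult_left_le[of _ r]
      by (intro E_mono continuous_intros right) auto
    finally show ?thesis by (simp add: algebra_simps)
  qed
  have "err \<alpha> = (E (\<lambda>x. sq_dist \<alpha> (r * x)) + E (\<lambda>x. sq_dist \<alpha> (r * x + 1 - r))) / 2"
    unfolding err_def by (rule E_split[OF continuous_on_sq_dist[OF fin(1) ne(1)]])
  with 1 2 show ?thesis by (simp add: algebra_simps)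
qed

subsection \<open>A lower bound in terms of the points where the nearest codepoint changes\<close>

text \<open>For a sorted codebook the minimum of the squared distances telescopes: start with the distance to
  the last point and subtract, at each boundary between neighbouring cells, what is gained to its left.\<close>

fun lower_fun :: "real \<Rightarrow> real \<Rightarrow> real list \<Rightarrow> real" where
  "lower_fun x c [] = (x - c)\<^sup>2"
| "lower_fun x c (c' # cs) = lower_fun x c' cs - 2 * (c' - c) * max 0 ((c + c') / 2 - x)"

fun lower_val :: "real \<Rightarrow> real list \<Rightarrow> real" where
  "lower_val c [] = V + (c - 1/2)\<^sup>2"
| "lower_val c (c' # cs) = lower_val c' cs - 2 * (c' - c) * G ((c + c') / 2)"

lemma continuous_on_lower_fun: "continuous_on UNIV (\<lambda>x. lower_fun x c cs)"
  by (induction cs arbitrary: c) (auto intro!: continuous_intros)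

lemma E_lower_fun: "E (\<lambda>x. lower_fun x c cs) = lower_val c cs"
proof (induction cs arbitrary: c)
  case (Cons c' cs)
  have "E (\<lambda>x. lower_fun x c (c' # cs))
      = E (\<lambda>x. lower_fun x c' cs) - E (\<lambda>x. 2 * (c' - c) * max 0 ((c + c') / 2 - x))"
    unfolding lower_fun.simps by (intro E_diff continuous_on_lower_fun continuous_intros)
  also have "E (\<lambda>x. 2 * (c' - c) * max 0 ((c + c') / 2 - x)) = 2 * (c' - c) * G ((c + c') / 2)"
    unfolding G_def by (rule E_cmult)
  finally show ?case using Cons by simp
qed (simp add: E_square_dist)

text \<open>The squared distances to neighbours differ by \<open>2 (c' - c) ((c + c') / 2 - x)\<close>, which is at most the
  positive part that is subtracted.\<close>

lemma lower_fun_le: "sorted (c # cs) \<Longrightarrow> a \<in> set (c # cs) \<Longrightarrow> lower_fun x c cs \<le> (x - a)\<^sup>2"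
proof (induction cs arbitrary: c a)
  case (Cons c' cs)
  let ?t = "2 * (c' - c) * max 0 ((c + c') / 2 - x)"
  have "0 \<le> ?t" using Cons.prems by auto
  have "c \<le> c'" using Cons.prems by simp
  show ?case
  proof (cases "a = c")
    case True
    have "lower_fun x c' cs \<le> (x - c')\<^sup>2" using Cons.IH[of c' c'] Cons.prems by simp
    also have "\<dots> = (x - c)\<^sup>2 + 2 * (c' - c) * ((c + c') / 2 - x)"
      by (simp add: power2_eq_square field_simps)
    also have "\<dots> \<le> (x - c)\<^sup>2 + ?t"
      using \<open>c \<le> c'\<close> by (intro add_left_mono mult_left_mono) auto
    finally show ?thesis using True by simp
  next
    case False
    then have "lower_fun x c' cs \<le> (x - a)\<^sup>2" using Cons by simp
    with \<open>0 \<le> ?t\<close> show ?thesis by simp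
  qed
qed simp

lemma err_ge_lower_val:
  assumes "sorted (c # cs)"
  shows "lower_val c cs \<le> err (set (c # cs))"
  unfolding E_lower_fun[symmetric] err_def
  by (intro E_mono continuous_on_lower_fun continuous_on_sq_dist sq_dist_geI lower_fun_le[OF assms]) auto

end

section \<open>The expected optimal values\<close>

text \<open>In units of \<open>V\<close> and with \<open>q = r\<^sup>2\<close>: the distortion that results from always distributing the points
  as evenly as possible over the two halves. The value at \<open>0\<close> is a default.\<close>

fun split_val :: "real \<Rightarrow> nat \<Rightarrow> real" where
  "split_val q n = (if n \<le> 1 then 1 else q / 2 * (split_val q (n div 2) + split_val q (n - n div 2)))"

declare split_val.simps [simp del]

lemma split_val_1 [simp]: "split_val q 1 = 1" "split_val q (Suc 0) = 1"
  by (simp_all add: split_val.simps)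

lemma split_val_step: "2 \<le> n \<Longrightarrow> split_val q n = q / 2 * (split_val q (n div 2) + split_val q (n - n div 2))"
  by (subst split_val.simps) auto

definition drop_val :: "real \<Rightarrow> nat \<Rightarrow> real" where
  "drop_val q n = split_val q n - split_val q (Suc n)"

lemma drop_val_1: "drop_val q 1 = 1 - q"
  by (simp add: drop_val_def split_val_step)

text \<open>One more point is given to the half that has fewer points, so the drop is inherited from that half.\<close>

lemma drop_val_step:
  assumes "2 \<le> n"
  shows "drop_val q n = q / 2 * drop_val q (n div 2)"
proof (cases "even n")
  case True
  then obtain m where m: "n = 2 * m" "1 \<le> m" using assms by (auto elim!: evenE)
  then have "Suc n div 2 = m" "Suc n - m = Suc m" "n div 2 = m" "n - m = m" by auto
  then show ?thesis
    using split_val_step[of n q] split_val_step[of "Suc n" q] assms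
    by (simp add: drop_val_def algebra_simps)
next
  case False
  then obtain m where m: "n = 2 * m + 1" by (auto elim!: oddE)
  then have "Suc n div 2 = Suc m" "Suc n - Suc m = Suc m" "n div 2 = m" "n - m = Suc m" by auto
  then show ?thesis
    using split_val_step[of n q] split_val_step[of "Suc n" q] assms
    by (simp add: drop_val_def algebra_simps)
qed

lemma drop_val_nonneg:
  assumes "0 < q" "q < 1" "1 \<le> n"
  shows "0 \<le> drop_val q n"
  using assms(3)
proof (induction n rule: less_induct)
  case (less n)
  show ?case
  proof (cases "n = 1")
    case True
    then show ?thesis using drop_val_1[of q] assms by simp
  next
    case False
    then have "2 \<le> n" "1 \<le> n div 2" "n div 2 < n" using less.prems by auto
    then show ?thesis using less.IH[of "n div 2"] assms by (simp add: drop_val_step)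
  qed
qed

lemma drop_val_Suc_le:
  assumes "0 < q" "q < 1" "1 \<le> n"
  shows "drop_val q (Suc n) \<le> drop_val q n"
  using assms(3)
proof (induction n rule: less_induct)
  case (less n)
  show ?case
  proof (cases "n = 1")
    case True
    have "q / 2 * (1 - q) \<le> 1 * (1 - q)" using assms by (intro mult_right_mono) auto
    then show ?thesis
      using True drop_val_1[of q] drop_val_step[of 2 q] by (simp add: numeral_2_eq_2)
  next
    case False
    then have n: "2 \<le> n" "1 \<le> n div 2" "n div 2 < n" using less.prems by auto
    have "drop_val q (Suc n div 2) \<le> drop_val q (n div 2)"
    proof (cases "Suc n div 2 = n div 2")
      case False
      then have "Suc n div 2 = Suc (n div 2)" by auto
      then show ?thesis using less.IH[of "n div 2"] n by simp
    qed simp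
    then show ?thesis using n assms by (simp add: drop_val_step)
  qed
qed

lemma drop_val_antimono:
  assumes "0 < q" "q < 1" "1 \<le> m" "m \<le> n"
  shows "drop_val q n \<le> drop_val q m"
  using assms(4)
proof (induction n rule: dec_induct)
  case (step n)
  then show ?case using drop_val_Suc_le[of q n] assms by simp
qed simp

lemma split_val_antimono:
  assumes "0 < q" "q < 1" "1 \<le> m" "m \<le> n"
  shows "split_val q n \<le> split_val q m"
  using assms(4)
proof (induction n rule: dec_induct)
  case (step n)
  then show ?case using drop_val_nonneg[of q n] assms by (simp add: drop_val_def)
qed simp

text \<open>The successive drops decrease, so among all ways of distributing \<open>m + n\<close> points over the two
  halves the most even one is best.\<close>

lemma split_val_add_ge:
  assumes "0 < q" "q < 1" "1 \<le> m" "m \<le> n"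
  shows "split_val q ((m + n) div 2) + split_val q (m + n - (m + n) div 2) \<le> split_val q m + split_val q n"
  using assms(3,4)
proof (induction "n - m" arbitrary: m n rule: less_induct)
  case less
  show ?case
  proof (cases "n \<le> Suc m")
    case True
    then have "n = m \<or> n = Suc m" using less.prems by auto
    then have "(m + n) div 2 = m" "m + n - m = n" by auto
    then show ?thesis by simp
  next
    case False
    then have mn: "Suc m \<le> n - 1" "n - 1 - Suc m < n - m" "Suc m + (n - 1) = m + n" by auto
    have "drop_val q (n - 1) \<le> drop_val q m"
      using assms less.prems mn by (intro drop_val_antimono) auto
    then have "split_val q (Suc m) + split_val q (n - 1) \<le> split_val q m + split_val q n"
      using mn by (simp add: drop_val_def)
    moreover have "split_val q ((m + n) div 2) + split_val q (m + n - (m + n) div 2)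
        \<le> split_val q (Suc m) + split_val q (n - 1)"
      using less.hyps[of "n - 1" "Suc m"] mn by simp
    ultimately show ?thesis by simp
  qed
qed

text \<open>Between two powers of \<open>2\<close> each additional point splits one piece of level \<open>l\<close>, so the values are
  affine there.\<close>

lemma split_val_closed_form:
  "k \<le> 2 ^ l \<Longrightarrow> split_val q (2 ^ l + k) = (q / 2) ^ l * (2 ^ l - real k + real k * q)"
proof (induction l arbitrary: k)
  case 0
  then have "k = 0 \<or> k = 1" by auto
  then show ?case using split_val_step[of 2 q] by (auto simp: numeral_2_eq_2)
next
  case (Suc l)
  define i where "i = k div 2"
  define j where "j = k - k div 2"
  have ij: "i \<le> 2 ^ l" "j \<le> 2 ^ l" "k = i + j" using Suc.prems by (auto simp: i_def j_def)
  have "(2 ^ Suc l + k) div 2 = 2 ^ l + i" "2 ^ Suc l + k - (2 ^ l + i) = 2 ^ l + j"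
    by (auto simp: i_def j_def)
  moreover have "(2::nat) \<le> 2 ^ Suc l + k"
  proof -
    have "(1::nat) \<le> 2 ^ l" by simp
    then show ?thesis unfolding power_Suc by linarith
  qed
  ultimately have "split_val q (2 ^ Suc l + k) = q / 2 * (split_val q (2 ^ l + i) + split_val q (2 ^ l + j))"
    by (subst split_val_step) auto
  then show ?case unfolding Suc.IH[OF ij(1)] Suc.IH[OF ij(2)] ij(3)
    by (simp add: algebra_simps add_divide_distrib)
qed

section \<open>Words and the distortion of the candidate sets\<close>

lemma words_0: "words 0 = {[]}"
  by (auto simp: words_def)

lemma words_Suc: "words (Suc k) = (#) 1 ` words k \<union> (#) 2 ` words k"
  by (auto simp: words_def length_Suc_conv)

lemma words_disjoint: "(#) 1 ` words k \<inter> (#) 2 ` words k = {}"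
  by auto

lemma finite_words: "finite (words k)"
  by (induction k) (auto simp: words_0 words_Suc)

lemma card_words: "card (words k) = 2 ^ k"
proof (induction k)
  case (Suc k)
  have "card (words (Suc k)) = card ((#) 1 ` words k) + card ((#) 2 ` words k)"
    unfolding words_Suc by (rule card_Un_disjoint) (simp_all only: finite_words finite_imageI words_disjoint)
  then show ?case using Suc by (simp add: card_image)
qed (simp add: words_0)

lemma ell_bounds:
  assumes "1 \<le> n"
  shows "2 ^ ell n \<le> n" "n < 2 ^ (ell n + 1)"
proof -
  obtain l where l: "2 ^ l \<le> n" "n < 2 ^ (l + 1)"
    using ex_power_ivl1[of 2 n] assms by auto
  have "ell n = l"
    unfolding ell_def
  proof (rule the_equality)
    fix l' assume l': "2 ^ l' \<le> n \<and> n < 2 ^ (l' + 1)"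
    have "(2::nat) ^ l' < 2 ^ (l + 1)" "(2::nat) ^ l < 2 ^ (l' + 1)" using l l' by linarith+
    then have "l' < l + 1" "l < l' + 1" by (simp_all only: power_strict_increasing_iff[of "2::nat"] one_less_numeral_iff semiring_norm)
    then show "l' = l" by simp
  qed (use l in simp)
  then show "2 ^ ell n \<le> n" "n < 2 ^ (ell n + 1)" using l by auto
qed

lemma cantor_map_continuous: "continuous_on UNIV (cantor_map r i)"
  unfolding cantor_map_def[abs_def] by (cases "i = 1") (auto intro!: continuous_intros)

lemma word_map_continuous: "continuous_on UNIV (word_map r \<sigma>)"
proof (induction \<sigma>)
  case (Cons i \<sigma>)
  show ?case unfolding word_map.simps comp_def
    by (rule continuous_on_compose2[OF cantor_map_continuous Cons]) auto
qed (simp add: id_def)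

lemma word_map_affine: "word_map r \<sigma> x - word_map r \<sigma> y = r ^ length \<sigma> * (x - y)"
proof (induction \<sigma>)
  case (Cons i \<sigma>)
  have "word_map r (i # \<sigma>) x - word_map r (i # \<sigma>) y = r * (word_map r \<sigma> x - word_map r \<sigma> y)"
    by (simp add: cantor_map_def algebra_simps)
  then show ?case using Cons by simp
qed simp

lemma word_map_append: "word_map r (\<sigma> @ \<tau>) x = word_map r \<sigma> (word_map r \<tau> x)"
  by (induction \<sigma>) auto

context cantor_parameter
begin

lemma q_bounds: "0 < r\<^sup>2" "r\<^sup>2 < 1"
  using r_bounds by (auto simp: power_less_one_iff)

lemma E_words:
  assumes "continuous_on UNIV f"
  shows "E f = (\<Sum>\<sigma>\<in>words k. E (\<lambda>x. f (word_map r \<sigma> x))) / 2 ^ k"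
  using assms
proof (induction k arbitrary: f)
  case (Suc k)
  have c: "continuous_on UNIV (\<lambda>x. f (cantor_map r i x))" for i
    by (rule continuous_on_compose2[OF Suc.prems cantor_map_continuous]) auto
  have "E f = (E (\<lambda>x. f (cantor_map r 1 x)) + E (\<lambda>x. f (cantor_map r 2 x))) / 2"
    using E_split[OF Suc.prems] by (simp add: cantor_map_def)
  also have "\<dots> = ((\<Sum>\<sigma>\<in>words k. E (\<lambda>x. f (word_map r (1 # \<sigma>) x)))
      + (\<Sum>\<sigma>\<in>words k. E (\<lambda>x. f (word_map r (2 # \<sigma>) x)))) / 2 ^ Suc k"
    unfolding Suc.IH[OF c[of 1]] Suc.IH[OF c[of 2]] by (simp add: add_divide_distrib)
  also have "\<dots> = (\<Sum>\<sigma>\<in>words (Suc k). E (\<lambda>x. f (word_map r \<sigma> x))) / 2 ^ Suc k"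
    unfolding words_Suc
    by (subst sum.union_disjoint) (auto simp: finite_words words_disjoint sum.reindex)
  finally show ?case .
qed (simp add: words_0)

lemma E_word_map_square: "E (\<lambda>x. (word_map r \<sigma> x - c)\<^sup>2) = r ^ (2 * length \<sigma>) * V + (midpt r \<sigma> - c)\<^sup>2"
proof -
  have "(\<lambda>x. (word_map r \<sigma> x - c)\<^sup>2)
      = (\<lambda>x. (r ^ length \<sigma> * x + (midpt r \<sigma> - c - r ^ length \<sigma> / 2))\<^sup>2)"
  proof
    fix x
    have "word_map r \<sigma> x = r ^ length \<sigma> * (x - 1/2) + midpt r \<sigma>"
      using word_map_affine[of r \<sigma> x "1/2"] by (simp add: midpt_def)
    then have "word_map r \<sigma> x - c = r ^ length \<sigma> * x + (midpt r \<sigma> - c - r ^ length \<sigma> / 2)"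
      by (simp add: algebra_simps)
    then show "(word_map r \<sigma> x - c)\<^sup>2 = (r ^ length \<sigma> * x + (midpt r \<sigma> - c - r ^ length \<sigma> / 2))\<^sup>2"
      by (rule arg_cong)
  qed
  then show ?thesis by (simp only: E_square_affine) (simp add: power_mult power2_eq_square algebra_simps)
qed

text \<open>Assign to the midpoint \<open>midpt r \<sigma>\<close> the piece with address \<open>\<sigma>\<close>: a piece of level \<open>k\<close> contributes
  \<open>r ^ (2 * k) * V / 2 ^ k\<close>. The sum over all pieces is the closed form of \<open>split_val\<close>.\<close>

lemma err_beta_set_le:
  assumes n: "1 \<le> n" and I: "I \<subseteq> words (ell n)" "card I = n - 2 ^ ell n"
  shows "beta_set r n I \<in> codebooks n" "err (beta_set r n I) \<le> V * split_val (r\<^sup>2) n"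
proof -
  let ?l = "ell n" and ?\<beta> = "beta_set r n I"
  define k where "k = n - 2 ^ ?l"
  note l = ell_bounds[OF n]
  have nk: "n = 2 ^ ?l + k" "k \<le> 2 ^ ?l" using l by (auto simp: k_def)
  have finI: "finite I" using I finite_words finite_subset by blast
  have fin: "finite ?\<beta>" using finI by (simp add: beta_set_def finite_words)
  have cW: "card (words ?l - I) = 2 ^ ?l - k"
    using I finI by (simp add: card_Diff_subset card_words k_def)
  have "card ?\<beta> \<le> card (midpt r ` (words ?l - I)) + card ((\<lambda>\<sigma>. midpt r (\<sigma> @ [1])) ` I)
      + card ((\<lambda>\<sigma>. midpt r (\<sigma> @ [2])) ` I)"
    unfolding beta_set_def by (intro order_trans[OF card_Un_le] add_right_mono card_Un_le)
  also have "\<dots> \<le> card (words ?l - I) + card I + card I"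
    using finI by (intro add_mono card_image_le) (auto simp: finite_words)
  also have "\<dots> = n" using cW I nk by (simp add: k_def)
  finally have cb: "card ?\<beta> \<le> n" .
  have ne: "?\<beta> \<noteq> {}"
  proof (cases "I = {}")
    case True
    have "words ?l \<noteq> {}" using card_words[of ?l] by (metis card.empty power_not_zero zero_neq_numeral)
    with True show ?thesis by (simp add: beta_set_def)
  qed (simp add: beta_set_def)
  show "?\<beta> \<in> codebooks n" using fin ne cb by (simp add: codebooks_def)
  have outer: "E (\<lambda>x. sq_dist ?\<beta> (word_map r \<sigma> x)) \<le> r ^ (2 * ?l) * V" if "\<sigma> \<in> words ?l - I" for \<sigma>
  proof -
    have "midpt r \<sigma> \<in> ?\<beta>" using that by (auto simp: beta_set_def)
    then have "E (\<lambda>x. sq_dist ?\<beta> (word_map r \<sigma> x)) \<le> E (\<lambda>x. (word_map r \<sigma> x - midpt r \<sigma>)\<^sup>2)"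
      by (intro E_mono continuous_intros fin ne word_map_continuous sq_dist_le)
    also have "length \<sigma> = ?l" using that by (simp add: words_def)
    ultimately show ?thesis by (simp add: E_word_map_square)
  qed
  have inner: "E (\<lambda>x. sq_dist ?\<beta> (word_map r \<sigma> x)) \<le> r ^ (2 * ?l) * (r\<^sup>2 * V)" if "\<sigma> \<in> I" for \<sigma>
  proof -
    have len: "length \<sigma> = ?l" using that I by (auto simp: words_def)
    have half: "E (\<lambda>x. sq_dist ?\<beta> (word_map r \<sigma> (cantor_map r i x))) \<le> r ^ (2 * ?l) * (r\<^sup>2 * V)"
      if i: "i = 1 \<or> i = 2" for i
    proof -
      have "midpt r (\<sigma> @ [i]) \<in> ?\<beta>" using \<open>\<sigma> \<in> I\<close> i by (auto simp: beta_set_def)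
      then have "E (\<lambda>x. sq_dist ?\<beta> (word_map r (\<sigma> @ [i]) x)) \<le> E (\<lambda>x. (word_map r (\<sigma> @ [i]) x - midpt r (\<sigma> @ [i]))\<^sup>2)"
        by (intro E_mono continuous_intros fin ne word_map_continuous sq_dist_le)
      also have "\<dots> = r ^ (2 * ?l) * (r\<^sup>2 * V)"
        by (simp only: E_word_map_square) (simp add: len power_add power2_eq_square)
      finally show ?thesis by (simp add: word_map_append)
    qed
    have "E (\<lambda>x. sq_dist ?\<beta> (word_map r \<sigma> x))
      = (E (\<lambda>x. sq_dist ?\<beta> (word_map r \<sigma> (cantor_map r 1 x))) + E (\<lambda>x. sq_dist ?\<beta> (word_map r \<sigma> (cantor_map r 2 x)))) / 2"
      by (subst E_split) (auto intro!: continuous_intros fin ne word_map_continuous simp: cantor_map_def)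
    then show ?thesis using half[of 1] half[of 2] by simp
  qed
  have "err ?\<beta> = (\<Sum>\<sigma>\<in>words ?l. E (\<lambda>x. sq_dist ?\<beta> (word_map r \<sigma> x))) / 2 ^ ?l"
    unfolding err_def by (rule E_words[OF continuous_on_sq_dist[OF fin ne]])
  also have "(\<Sum>\<sigma>\<in>words ?l. E (\<lambda>x. sq_dist ?\<beta> (word_map r \<sigma> x)))
      = (\<Sum>\<sigma>\<in>words ?l - I. E (\<lambda>x. sq_dist ?\<beta> (word_map r \<sigma> x))) + (\<Sum>\<sigma>\<in>I. E (\<lambda>x. sq_dist ?\<beta> (word_map r \<sigma> x)))"
    by (rule sum.subset_diff[OF I(1) finite_words])
  also have "\<dots> \<le> real (card (words ?l - I)) * (r ^ (2 * ?l) * V) + real (card I) * (r ^ (2 * ?l) * (r\<^sup>2 * V))"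
    by (intro add_mono sum_bounded_above outer inner)
  also have "\<dots> = (2 ^ ?l - real k) * (r ^ (2 * ?l) * V) + real k * (r ^ (2 * ?l) * (r\<^sup>2 * V))"
    using cW I nk by (simp add: k_def of_nat_diff)
  finally have "err ?\<beta> \<le> ((2 ^ ?l - real k) * (r ^ (2 * ?l) * V) + real k * (r ^ (2 * ?l) * (r\<^sup>2 * V))) / 2 ^ ?l"
    by (simp add: divide_right_mono)
  also have "r ^ (2 * ?l) = 2 ^ ?l * (r\<^sup>2 / 2) ^ ?l" by (simp add: power_mult power_divide)
  also have "((2 ^ ?l - real k) * (2 ^ ?l * (r\<^sup>2 / 2) ^ ?l * V)
      + real k * (2 ^ ?l * (r\<^sup>2 / 2) ^ ?l * (r\<^sup>2 * V))) / 2 ^ ?l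
      = V * ((r\<^sup>2 / 2) ^ ?l * (2 ^ ?l - real k + real k * r\<^sup>2))"
    by (simp add: add_divide_distrib) (simp add: algebra_simps)
  also have "\<dots> = V * split_val (r\<^sup>2) n"
    using split_val_closed_form[OF nk(2), of "r\<^sup>2"] nk(1) by simp
  finally show "err ?\<beta> \<le> V * split_val (r\<^sup>2) n" .
qed

section \<open>Above the critical parameter\<close>

lemma G_reflect: "G (1 - y) = 1/2 - y + G y"
proof -
  have "G (1 - y) = E (\<lambda>x. max 0 (1 - y - (1 - x)))"
    unfolding G_def by (rule E_reflect[symmetric]) (intro continuous_intros)
  also have "\<dots> = E (\<lambda>x. (1 * x + - y) + max 0 (y - x))"
    by (intro E_cong continuous_intros) (auto simp: max_def)
  also have "\<dots> = E (\<lambda>x. 1 * x + - y) + G y"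
    unfolding G_def by (intro E_add continuous_intros)
  also have "\<dots> = 1/2 - y + G y" using E_affine[of 1 "- y"] by simp
  finally show ?thesis .
qed

lemma G_mult_r: "r * y \<le> 1 - r \<Longrightarrow> G (r * y) = r / 2 * G y"
  using G_step[of "r * y"] G_nonpos[of "1 - (1 - r * y) / r"] r_pos by (simp add: field_simps)

lemma G_gap:
  assumes "r \<le> b" "b \<le> 1 - r"
  shows "G b = (b - r / 2) / 2"
proof -
  have "G b = r / 2 * G (b / r) + r / 2 * G (1 - (1 - b) / r)" by (rule G_step)
  moreover have "G (1 - (1 - b) / r) = 0" using assms r_pos by (intro G_nonpos) (simp add: field_simps)
  moreover have "G (b / r) = b / r - 1/2" using assms r_pos by (intro G_ge_1) (simp add: field_simps)
  ultimately have "G b = r / 2 * (b / r - 1/2)" by simp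
  also have "\<dots> = (b - r / 2) / 2" using r_pos by (simp add: right_diff_distrib)
  finally show ?thesis .
qed

text \<open>The interval \<open>{r - r ^ 4 .. r}\<close> carries a sixteenth of the mass. There \<open>G\<close> exceeds the affine function of the gap by a convex term that vanishes at \<open>r\<close>.\<close>

lemma G_before_gap:
  assumes "r - r ^ 4 \<le> b" "b \<le> r"
  shows "G b \<le> (b - r / 2) / 2 + (r - b) / 32"
proof -
  have le: "r * y \<le> 1 - r" if "y \<le> 1" for y
  proof -
    have "r * y \<le> r * 1" using that r_pos by (intro mult_left_mono) auto
    then show ?thesis using r_less by simp
  qed
  have p: "r ^ k \<le> 1" for k using r_bounds by (simp add: power_le_one)
  have mult: "G (r ^ Suc k) = r / 2 * G (r ^ k)" for k
    using G_mult_r[OF le[OF p]] by simp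
  have "G (r ^ k) = (r / 2) ^ k * G 1" for k
    by (induction k) (use mult in auto)
  then have "G (r ^ 3) = (r / 2) ^ 3 * G 1" .
  also have "G 1 = 1/2" by (subst G_ge_1) auto
  finally have "G (1 - r ^ 3) = 1/2 - r ^ 3 + (r / 2) ^ 3 / 2"
    using G_reflect[of "r ^ 3"] by simp
  moreover have "G (r * (1 - r ^ 3)) = r / 2 * G (1 - r ^ 3)"
    using r_bounds by (intro G_mult_r[OF le]) simp
  ultimately have "G (r * (1 - r ^ 3)) = r / 2 * (1/2 - r ^ 3 + (r / 2) ^ 3 / 2)" by simp
  moreover have "r * (1 - r ^ 3) = r - r ^ 4" by (simp add: algebra_simps power_numeral_reduce)
  ultimately have lo: "G (r - r ^ 4) = (r - r ^ 4 - r / 2) / 2 + r ^ 4 / 32"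
    by (simp add: power_divide power_numeral_reduce right_diff_distrib diff_divide_distrib)
  have hi: "G r = r / 4" using G_gap[of r] r_less by simp
  have "G b \<le> (1/2 - 1/32) * b + (r / 32 - r / 4)"
  proof (rule G_chord[OF assms])
    show "G (r - r ^ 4) \<le> (1/2 - 1/32) * (r - r ^ 4) + (r / 32 - r / 4)"
      unfolding lo by (simp add: field_simps)
    show "G r \<le> (1/2 - 1/32) * r + (r / 32 - r / 4)"
      unfolding hi by (simp add: field_simps)
  qed
  then show ?thesis by (simp add: field_simps)
qed

text \<open>The competitor of \<open>\<beta>\<^sub>3(I)\<close>: the middle point serves the pieces \<open>122\<close> and \<open>211\<close> on both sides of the
  central gap, the outer points are the centroids of the pieces \<open>11, 121\<close> and \<open>212, 22\<close>.\<close>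

definition rival :: "real set" where
  "rival = {(r + r ^ 3 / 2) / 3, 1/2, 1 - (r + r ^ 3 / 2) / 3}"

lemma err_rival_le:
  "err rival \<le> r ^ 6 * V + ((r ^ 3 / 2 - (r + r ^ 3 / 2) / 3)\<^sup>2 + (r\<^sup>2 - r ^ 3 / 2 - (r + r ^ 3 / 2) / 3)\<^sup>2
     + (r - r\<^sup>2 + r ^ 3 / 2 - (r + r ^ 3 / 2) / 3)\<^sup>2 + (r - r ^ 3 / 2 - 1/2)\<^sup>2) / 4"
proof -
  let ?c = "(r + r ^ 3 / 2) / 3"
  have fin: "finite rival" "rival \<noteq> {}" by (auto simp: rival_def)
  have w3: "words 3 = {[1,1,1],[1,1,2],[1,2,1],[1,2,2],[2,1,1],[2,1,2],[2,2,1],[2,2,2]}"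
    by (simp add: numeral_eq_Suc words_Suc words_0 insert_commute)
  define near where "near \<sigma> = (if \<sigma> = [1,2,2] \<or> \<sigma> = [2,1,1] then 1/2 else if hd \<sigma> = 1 then ?c else 1 - ?c)"
    for \<sigma> :: "nat list"
  have le: "E (\<lambda>x. sq_dist rival (word_map r \<sigma> x)) \<le> r ^ 6 * V + (midpt r \<sigma> - near \<sigma>)\<^sup>2"
    if "\<sigma> \<in> words 3" for \<sigma>
  proof -
    have "near \<sigma> \<in> rival" by (simp add: near_def rival_def)
    then have "E (\<lambda>x. sq_dist rival (word_map r \<sigma> x)) \<le> E (\<lambda>x. (word_map r \<sigma> x - near \<sigma>)\<^sup>2)"
      by (intro E_mono continuous_intros fin word_map_continuous sq_dist_le)
    then show ?thesis using that by (simp add: E_word_map_square words_def)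
  qed
  have "err rival = (\<Sum>\<sigma>\<in>words 3. E (\<lambda>x. sq_dist rival (word_map r \<sigma> x))) / 2 ^ 3"
    unfolding err_def by (rule E_words[OF continuous_on_sq_dist[OF fin]])
  also have "\<dots> \<le> (\<Sum>\<sigma>\<in>words 3. r ^ 6 * V + (midpt r \<sigma> - near \<sigma>)\<^sup>2) / 2 ^ 3"
    using le by (intro divide_right_mono sum_mono) auto
  also have "\<dots> = r ^ 6 * V + ((r ^ 3 / 2 - ?c)\<^sup>2 + (r\<^sup>2 - r ^ 3 / 2 - ?c)\<^sup>2
     + (r - r\<^sup>2 + r ^ 3 / 2 - ?c)\<^sup>2 + (r - r ^ 3 / 2 - 1/2)\<^sup>2) / 4"
    unfolding w3
    by (simp add: near_def midpt_def cantor_map_def power2_eq_square power3_eq_cube add_divide_distrib)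
       (simp add: field_simps)
  finally show ?thesis .
qed

lemma V_mult: "4 * V * (1 + r) = 1 - r"
proof -
  have "4 * (1 + r) \<noteq> 0" using r_pos by simp
  then have "V * (4 * (1 + r)) = 1 - r"
    using nonzero_eq_divide_eq[of "4 * (1 + r)" V "1 - r"] V_def by blast
  then show ?thesis by (simp add: mult_ac)
qed

text \<open>The first cell of \<open>\<beta>\<^sub>3\<close> is the left half of the Cantor set as long as its right boundary, the point
  \<open>t\<close> in the proof, lies in the central gap. For larger \<open>r\<close> the boundary has moved into the piece \<open>1222\<close>; the
  maximum bounds what \<open>\<beta>\<^sub>3\<close> gains from this.\<close>

lemma err_beta_3_ge:
  "V * (r\<^sup>2 * (1 + r\<^sup>2) / 2) - max 0 ((1 - r) * (2 - r) * (5 * r - 2 - r\<^sup>2) / 128)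
     \<le> err {r / 2, 1 - r + r\<^sup>2 / 2, 1 - r\<^sup>2 / 2}"
proof -
  let ?c1 = "r / 2" and ?c2 = "1 - r + r\<^sup>2 / 2" and ?c3 = "1 - r\<^sup>2 / 2"
  define t where "t = (2 - r + r\<^sup>2) / 4"
  have r2: "r\<^sup>2 < r / 2" using r_pos r_less by (simp add: power2_eq_square)
  have sorted: "sorted [?c1, ?c2, ?c3]"
  proof -
    have "0 \<le> r\<^sup>2" by simp
    then have "r \<le> 1" "3 * r \<le> 2 + r\<^sup>2" "r\<^sup>2 \<le> r" using r_pos r_less r2 by linarith+
    then show ?thesis by (simp add: field_simps)
  qed
  have mid: "(?c1 + ?c2) / 2 = t" "(?c2 + ?c3) / 2 = 1 - r / 2" by (auto simp: t_def field_simps)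
  have G12: "G (1/2) = (1/2 - r / 2) / 2" using r_less by (intro G_gap) auto
  have "G (r * (1/2)) = r / 2 * G (1/2)" using r_less r_pos by (intro G_mult_r) auto
  then have G23: "G (1 - r / 2) = 1/2 - r / 2 + r / 2 * ((1/2 - r / 2) / 2)"
    using G_reflect[of "r / 2"] G12 by simp
  have Gt: "G t \<le> (t - r / 2) / 2 + max 0 ((r - t) / 32)"
  proof (cases "r \<le> t")
    case True
    have "t \<le> 1 - r"
    proof -
      have "r\<^sup>2 + 3 * r \<le> 2" using r2 r_less by linarith
      then show ?thesis by (simp add: t_def)
    qed
    then show ?thesis using G_gap[OF True] True by simp
  next
    case False
    have "0 \<le> (1/2 - r) * (4 - 2 * r - 2 * r\<^sup>2 - 4 * r ^ 3) / 4"
    proof -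
      have "r ^ 3 \<le> r\<^sup>2 / 2" using r_less r_pos by (simp add: power3_eq_cube power2_eq_square mult_left_mono)
      then have "0 \<le> 4 - 2 * r - 2 * r\<^sup>2 - 4 * r ^ 3" using r2 r_less by linarith
      then show ?thesis using r_less by simp
    qed
    then have "r - r ^ 4 \<le> t" 
      by (simp add: t_def power2_eq_square power3_eq_cube power4_eq_xxxx algebra_simps)
    from G_before_gap[OF this] False show ?thesis by simp
  qed
  have c21: "0 \<le> ?c2 - ?c1" using sorted by simp
  have "lower_val ?c1 [?c2, ?c3] = V + (?c3 - 1/2)\<^sup>2 - 2 * (?c3 - ?c2) * G (1 - r / 2) - 2 * (?c2 - ?c1) * G t"
    by (simp only: lower_val.simps mid)
  moreover have "2 * (?c2 - ?c1) * G t \<le> 2 * (?c2 - ?c1) * ((t - r / 2) / 2 + max 0 ((r - t) / 32))"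
    using c21 Gt by (intro mult_left_mono) auto
  moreover have "2 * (?c2 - ?c1) * max 0 ((r - t) / 32) = max 0 ((1 - r) * (2 - r) * (5 * r - 2 - r\<^sup>2) / 128)"
  proof -
    have "2 * (?c2 - ?c1) * ((r - t) / 32) = (1 - r) * (2 - r) * (5 * r - 2 - r\<^sup>2) / 128"
      by (simp add: t_def power2_eq_square field_simps)
    moreover have "2 * (?c2 - ?c1) * max 0 ((r - t) / 32) = max 0 (2 * (?c2 - ?c1) * ((r - t) / 32))"
      using c21 by (subst max_mult_distrib_left) auto
    ultimately show ?thesis by (simp only:)
  qed
  moreover have "V + (?c3 - 1/2)\<^sup>2 - 2 * (?c3 - ?c2) * G (1 - r / 2) - 2 * (?c2 - ?c1) * ((t - r / 2) / 2)
      = V * (r\<^sup>2 * (1 + r\<^sup>2) / 2)"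
  proof -
    note V = V_mult
    have "V - V * (r\<^sup>2 * (1 + r\<^sup>2) / 2) = 4 * V * (1 + r) * ((1 - r) * (2 + r\<^sup>2)) / 8"
      by (simp add: power2_eq_square algebra_simps add_divide_distrib diff_divide_distrib)
    also have "\<dots> = (1 - r) * ((1 - r) * (2 + r\<^sup>2)) / 8" unfolding V ..
    finally show ?thesis unfolding G23 t_def
      by (simp add: power2_eq_square field_simps)
  qed
  ultimately have "V * (r\<^sup>2 * (1 + r\<^sup>2) / 2) - max 0 ((1 - r) * (2 - r) * (5 * r - 2 - r\<^sup>2) / 128)
      \<le> lower_val ?c1 [?c2, ?c3]"
    by (smt (verit) distrib_left)
  also have "\<dots> \<le> err (set [?c1, ?c2, ?c3])" by (rule err_ge_lower_val[OF sorted])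
  finally show ?thesis by simp
qed

text \<open>Apart from the possible gain of \<open>\<beta>\<^sub>3\<close>, the difference of the two distortions is a multiple of the
  polynomial in the hypothesis. In terms of \<open>y = 1/2 - r\<close> the gain occurs only for \<open>y < 1/16\<close>, where the
  terms of degree at most two decide.\<close>

lemma err_rival_less:
  assumes "6 * (r - 1) * (r ^ 4 + r\<^sup>2) < r ^ 7 + r ^ 6 + 4 * r ^ 5 - 2 * r ^ 4 - 2 * r ^ 3 - 8 * r\<^sup>2 + 9 * r - 3"
  shows "err rival < err {r / 2, 1 - r + r\<^sup>2 / 2, 1 - r\<^sup>2 / 2}"
proof -
  let ?crit = "r ^ 7 + r ^ 6 + 4 * r ^ 5 - 2 * r ^ 4 - 2 * r ^ 3 - 8 * r\<^sup>2 + 9 * r - 3 - 6 * (r - 1) * (r ^ 4 + r\<^sup>2)"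
  let ?U = "r ^ 6 * V + ((r ^ 3 / 2 - (r + r ^ 3 / 2) / 3)\<^sup>2 + (r\<^sup>2 - r ^ 3 / 2 - (r + r ^ 3 / 2) / 3)\<^sup>2
     + (r - r\<^sup>2 + r ^ 3 / 2 - (r + r ^ 3 / 2) / 3)\<^sup>2 + (r - r ^ 3 / 2 - 1/2)\<^sup>2) / 4"
  let ?g = "(1 - r) * (2 - r) * (5 * r - 2 - r\<^sup>2) / 128"
  note V = V_mult
  have "(1 + r) * (V * (r\<^sup>2 * (1 + r\<^sup>2) / 2) - ?U)
      = 4 * V * (1 + r) * (r\<^sup>2 * (1 + r\<^sup>2) / 8 - r ^ 6 / 4)
        - (1 + r) * (((r ^ 3 / 2 - (r + r ^ 3 / 2) / 3)\<^sup>2 + (r\<^sup>2 - r ^ 3 / 2 - (r + r ^ 3 / 2) / 3)\<^sup>2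
     + (r - r\<^sup>2 + r ^ 3 / 2 - (r + r ^ 3 / 2) / 3)\<^sup>2 + (r - r ^ 3 / 2 - 1/2)\<^sup>2) / 4)"
    by (simp add: algebra_simps add_divide_distrib diff_divide_distrib)
  also have "\<dots> = ?crit / 48"
    unfolding V by (simp add: power2_eq_square power_numeral_reduce field_simps)
  finally have diff: "(1 + r) * (V * (r\<^sup>2 * (1 + r\<^sup>2) / 2) - ?U) = ?crit / 48" .
  have "?U < V * (r\<^sup>2 * (1 + r\<^sup>2) / 2) - max 0 ?g"
  proof (cases "5 * r - 2 - r\<^sup>2 \<le> 0")
    case True
    then have "?g \<le> 0" using r_less by (simp add: mult_nonneg_nonpos)
    then have "max 0 ?g = 0" by simp
    moreover have "0 < (1 + r) * (V * (r\<^sup>2 * (1 + r\<^sup>2) / 2) - ?U)" unfolding diff using assms by simp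
    then have "0 < V * (r\<^sup>2 * (1 + r\<^sup>2) / 2) - ?U"
      using r_pos by (metis add_pos_pos zero_less_mult_pos zero_less_one)
    ultimately show ?thesis by linarith
  next
    case False
    define y where "y = 1/2 - r"
    have r: "r = 1/2 - y" by (simp add: y_def)
    have y0: "0 < y" using r_less by (simp add: y_def)
    have "4 * y + y\<^sup>2 < 1/4" using False unfolding r by (simp add: power2_eq_square algebra_simps)
    moreover have "0 \<le> y\<^sup>2" by simp
    ultimately have y1: "y < 1/16" by linarith
    have "y\<^sup>2 \<le> (1/16)\<^sup>2" using y0 y1 by (intro power_mono) auto
    then have "y\<^sup>2 \<le> 1/256" by (simp add: power2_eq_square)
    moreover have "53 * y ^ 5 \<le> 43 * y ^ 4" "8 * y ^ 7 \<le> 36 * y ^ 6"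
    proof -
      have "53 * y * y ^ 4 \<le> 43 * y ^ 4" "8 * y * y ^ 6 \<le> 36 * y ^ 6"
        using y1 y0 by (intro mult_right_mono; simp)+
      then show "53 * y ^ 5 \<le> 43 * y ^ 4" "8 * y ^ 7 \<le> 36 * y ^ 6" by (simp_all add: power_numeral_reduce)
    qed
    moreover have "0 \<le> y ^ 3" "0 \<le> y ^ 4" "0 \<le> y ^ 6" using y0 by simp_all
    ultimately have "0 < 27/32 - 153/16 * y - 81/2 * y\<^sup>2 + 4 * y ^ 3 + 87/2 * y ^ 4 - 53 * y ^ 5 + 36 * y ^ 6 - 8 * y ^ 7"
      using y1 by linarith
    also have "\<dots> = 8 * ?crit - 3 * (1 - r\<^sup>2) * (2 - r) * (5 * r - 2 - r\<^sup>2)"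
      unfolding r by (simp add: power2_eq_square power_numeral_reduce field_simps)
    also have "3 * (1 - r\<^sup>2) * (2 - r) * (5 * r - 2 - r\<^sup>2) = 384 * ((1 + r) * ?g)"
      by (simp add: power2_eq_square field_simps)
    finally have "(1 + r) * ?g < ?crit / 48" by simp
    then have "(1 + r) * ?g < (1 + r) * (V * (r\<^sup>2 * (1 + r\<^sup>2) / 2) - ?U)" unfolding diff .
    then have "?g < V * (r\<^sup>2 * (1 + r\<^sup>2) / 2) - ?U"
      by (rule mult_less_cancel_left_pos[THEN iffD1, rotated]) (use r_pos in simp)
    moreover have "0 \<le> ?g" using False r_less by simp
    ultimately show ?thesis by linarith
  qed
  then show ?thesis using err_rival_le err_beta_3_ge by linarith
qed

lemma not_beta_optimal:
  assumes "6 * (r - 1) * (r ^ 4 + r\<^sup>2) < r ^ 7 + r ^ 6 + 4 * r ^ 5 - 2 * r ^ 4 - 2 * r ^ 3 - 8 * r\<^sup>2 + 9 * r - 3"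
  shows "\<not> beta_optimal r"
proof
  assume opt: "beta_optimal r"
  have "2 ^ ell 3 \<le> (3::nat)" "(3::nat) < 2 ^ (ell 3 + 1)" using ell_bounds[of 3] by auto
  then have ell: "ell 3 = 1"
  proof -
    have "ell 3 < 2" 
    proof (rule ccontr)
      assume "\<not> ell 3 < 2"
      then have "(2::nat) ^ 2 \<le> 2 ^ ell 3" by (intro power_increasing) auto
      with \<open>2 ^ ell 3 \<le> (3::nat)\<close> show False by simp
    qed
    moreover have "ell 3 \<noteq> 0" using \<open>(3::nat) < 2 ^ (ell 3 + 1)\<close> by (intro notI) simp
    ultimately show ?thesis by simp
  qed
  have words1: "words 1 = {[1],[2]}" by (auto simp: words_Suc words_0)
  have "{[2]} \<subseteq> words (ell 3)" "card {[2::nat]} = 3 - 2 ^ ell 3"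
    unfolding ell words1 by simp_all
  then have opt3: "optimal_set P 3 (beta_set r 3 {[2]})"
    using opt[unfolded beta_optimal_def, rule_format, of 3 "{[2]}"] by linarith
  have W: "words 1 - {[2]} = {[1]}" unfolding words1 by auto
  note opt3
  moreover have "beta_set r 3 {[2]} = {r / 2, 1 - r + r\<^sup>2 / 2, 1 - r\<^sup>2 / 2}"
  proof -
    have "midpt r [1] = r / 2" "midpt r ([2] @ [1]) = 1 - r + r\<^sup>2 / 2" "midpt r ([2] @ [2]) = 1 - r\<^sup>2 / 2"
      by (simp_all add: midpt_def cantor_map_def power2_eq_square algebra_simps)
    then show ?thesis unfolding beta_set_def ell W by auto
  qed
  ultimately have "err {r / 2, 1 - r + r\<^sup>2 / 2, 1 - r\<^sup>2 / 2} = quant_error P 3"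
    by (simp add: optimal_set_def err_eq)
  also have "\<dots> \<le> distortion P rival"
    unfolding quant_error_def
  proof (rule cINF_lower)
    show "bdd_below (distortion P ` codebooks 3)"
      by (rule bdd_belowI[of _ 0]) (auto simp: err_eq codebooks_def intro!: err_nonneg)
    show "rival \<in> codebooks 3" by (auto simp: codebooks_def rival_def card_insert_if)
  qed
  finally show False using err_rival_less[OF assms] by (simp add: err_eq)
qed

end

section \<open>Integer computations\<close>

text \<open>The recursion \<open>G_step\<close> in integers, in units of \<open>10 ^ (- 8)\<close> and rounded upwards. The parameter \<open>r\<close> is
  replaced by whichever of its bounds \<open>43504117069\<close> and \<open>43504117070\<close>, in units of \<open>10 ^ (- 11)\<close>, makes the result
  larger; at depth \<open>0\<close> the recursion ends with \<open>G b \<le> b / 2\<close>.\<close>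

fun G_upper :: "nat \<Rightarrow> int \<Rightarrow> int" where
  "G_upper k x = (if x \<le> 0 then 0 else if 100000000 \<le> x then x - 50000000
     else case k of 0 \<Rightarrow> x div 2 + 1
     | Suc m \<Rightarrow> 43504117070 * (G_upper m (x * 100000000000 div 43504117069 + 1)
          + G_upper m (100000000 - (100000000 - x) * 100000000000 div 43504117070)) div 200000000000 + 1)"

declare G_upper.simps [simp del]

text \<open>Upper bounds for \<open>10 ^ 6 * G (0.0149 * i)\<close>, \<open>i = 0, \<dots>, 68\<close>.\<close>

definition gtable :: "int list" where
  "gtable = [
    0, 223, 786, 1675, 2780, 4236, 6029, 7892, 9909, 12278, 14990, 17898, 21157, 24768, 28493,
    32218, 35943, 39732, 43857, 48331, 53025, 58044, 63400, 68987, 74603, 80537, 86800, 93330,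
    100154, 107302, 114740, 122190, 129640, 137090, 144540, 151990, 159440, 166890, 174343, 182051,
    190088, 198442, 207030, 215962, 225224, 234537, 244034, 253881, 264062, 274447, 285184, 296268,
    307443, 318618, 329793, 341052, 352654, 364609, 376770, 389264, 402104, 415142, 428223, 441632,
    455381, 469373, 483676, 498305, 513200]"

definition gval :: "int \<Rightarrow> int" where
  "gval i = (if i \<le> 0 then 0 else gtable ! nat i)"

text \<open>The slope of the chord of the table between two indices, rounded upwards.\<close>

definition slope :: "int \<Rightarrow> int \<Rightarrow> int" where
  "slope i j = - ((gval i - gval j) div (j - i))"

text \<open>Twice the smallest Bernstein coefficient of \<open>p x\<^sup>2 + q x\<close> on the interval \<open>[a, b]\<close>; the factor two
  keeps the middle coefficient integral.\<close>

definition bernstein_min :: "int \<Rightarrow> int \<Rightarrow> int \<Rightarrow> int \<Rightarrow> int" where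
  "bernstein_min p q a b = min (2 * p * a * a + 2 * q * a) (min (2 * p * a * b + q * (a + b)) (2 * p * b * b + 2 * q * b))"

text \<open>If the codepoints are confined to intervals, each cut position is confined to an interval too, and
  there \<open>G\<close> may be replaced by a chord \<open>u b + w\<close>. Then \<open>2 (c' - c) G ((c + c') / 2)\<close> becomes the difference of
  \<open>u x\<^sup>2 + 2 w x\<close> at \<open>c'\<close> and \<open>c\<close>, so the lower bound is a sum of quadratic polynomials in one codepoint each and
  can be minimised separately. The arguments \<open>p, q\<close> carry the polynomial that the preceding cut has left at
  the current codepoint. Positions are integral multiples of \<open>0.0298\<close>; the last codepoint contributes
  \<open>(0.0298 x - 1/2)\<^sup>2 - 1/4\<close>, which in the chosen units is \<open>14900 x\<^sup>2 - 500000 x\<close>.\<close>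

fun box_bound :: "int \<Rightarrow> int \<Rightarrow> (int \<times> int) list \<Rightarrow> int" where
  "box_bound p q [] = 0"
| "box_bound p q [(a, b)] = bernstein_min (14900 - p) (- 500000 - q) a b"
| "box_bound p q ((a, b) # (a', b') # bs) =
     (let s = slope (a + a') (b + b'); w = gval (a + a') - s * (a + a')
      in bernstein_min (s - p) (w - q) a b + box_bound s w ((a', b') # bs))"

fun unsorted :: "(int \<times> int) list \<Rightarrow> bool" where
  "unsorted ((a, b) # (a', b') # bs) = (if b' < a then True else unsorted ((a', b') # bs))"
| "unsorted _ = False"

fun cut_box :: "int \<Rightarrow> (int \<times> int) list \<Rightarrow> (int \<times> int) list \<times> (int \<times> int) list" where
  "cut_box w [] = ([], [])"
| "cut_box w ((a, b) # bs) = (if b - a = w then ((a, (a + b) div 2) # bs, ((a + b) div 2, b) # bs)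
     else (case cut_box w bs of (l, u) \<Rightarrow> ((a, b) # l, (a, b) # u)))"

fun width :: "(int \<times> int) list \<Rightarrow> int" where
  "width [] = 0"
| "width ((a, b) # bs) = max (b - a) (width bs)"

text \<open>Branch and bound: bisect the longest edge until the bound reaches the threshold or the box contains
  no sorted list. The first codepoint is fixed at \<open>- d\<close>. Conditionals are used in place of conjunctions so
  that rewriting evaluates them lazily.\<close>

fun box_check :: "nat \<Rightarrow> int \<Rightarrow> int \<Rightarrow> (int \<times> int) list \<Rightarrow> bool" where
  "box_check 0 d thr bx = False"
| "box_check (Suc n) d thr bx =
     (if unsorted bx then True
      else if thr \<le> box_bound 0 0 ((- d, - d) # bx) then True
      else case cut_box (width bx) bx of (l, u) \<Rightarrow>
        (if box_check n d thr l then box_check n d thr u else False))"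

text \<open>Pairs of an even cut position and an even upper bound for \<open>G\<close> there, both in units of \<open>10 ^ (- 8)\<close>;
  evenness makes midpoints integral. The subdivision contains the ends \<open>18927000\<close> and \<open>24577000\<close> of the interval
  on which the tie occurs.\<close>

definition pair_nodes :: "(int \<times> int) list" where
  "pair_nodes = [
    (0, 0), (1182938, 14400), (2365876, 51108), (3548812, 109886), (4731750, 183902),
    (5914688, 274008), (7097624, 385930), (8280562, 520470), (9463500, 668338), (10646438, 816204),
    (11829376, 977418), (13012312, 1161248), (14195250, 1366896), (15378188, 1588616),
    (16561124, 1825592), (17744062, 2084634), (18927000, 2365990), (19280124, 2454272),
    (19633250, 2542554), (19986376, 2630834), (20339500, 2719116), (20692624, 2807396),
    (21045750, 2895678), (21398876, 2983960), (21752000, 3072240), (22105124, 3160522),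
    (22458250, 3248804), (22811376, 3337086), (23164500, 3425366), (23517624, 3513646),
    (23870750, 3601928), (24223876, 3690210), (24577000, 3778490), (24889500, 3857898),
    (25202000, 3939246), (25514500, 4022258), (25827000, 4106938), (26139500, 4193564),
    (26452000, 4281454), (26764500, 4369730), (27077000, 4459930), (27389500, 4552138),
    (27702000, 4645570), (28014500, 4741026), (28327000, 4838364), (28639500, 4936022),
    (28952000, 5033678), (29264500, 5131356), (29577000, 5230552), (30447444, 5516218),
    (31317890, 5813998), (32188334, 6122506), (33058780, 6444428), (33929224, 6770844),
    (34799670, 7097262), (35670114, 7425654), (36540560, 7766538), (37411004, 8119264),
    (38281448, 8482978), (39151894, 8859996), (40022338, 9240972), (40892784, 9631634),
    (41763228, 10035640), (42633674, 10449114), (43504118, 10876030), (44316104, 11282024),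
    (45128088, 11688016), (45940074, 12094008), (46752060, 12500002), (47564044, 12905994),
    (48376030, 13311986), (49188014, 13717978), (50000000, 14123972), (50811986, 14529964),
    (51623970, 14935956), (52435956, 15341950), (53247940, 15747942), (54059926, 16153934),
    (54871912, 16559928), (55683896, 16965920), (56495882, 17371912), (67371912, 23655302),
    (78247940, 31320196), (89123970, 39969346), (100000000, 50000000)]"

text \<open>The form \<open>pair_form\<close> defined below in units of \<open>10 ^ (- 16)\<close>, with \<open>0.14931651\<close> in place of \<open>D\<close>, where
  \<open>35068349 = 50000000 - 14931651\<close>, and with a constant term that is about \<open>3 / 10 ^ 8\<close> too small; this absorbs
  the error in \<open>D\<close>.\<close>

definition pair_val :: "int \<Rightarrow> int \<Rightarrow> int \<Rightarrow> int \<Rightarrow> int" where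
  "pair_val b g c h = 2 * (b + c - 35068349) * (b + c - 35068349) - 2 * (g - h) * (g - h)
     - 4 * ((c + 14931651) * g + (b + 14931651) * h) + 797945890000000"

text \<open>The nine Bernstein coefficients, up to positive factors, of \<open>pair_val\<close> on the product of two segments
  in the plane of positions and bounds: corners, edges, centre.\<close>

definition pair_box :: "int \<times> int \<Rightarrow> int \<times> int \<Rightarrow> int \<times> int \<Rightarrow> int \<times> int \<Rightarrow> bool" where
  "pair_box u v y z = (case (u, v, y, z) of ((b, g), (b', g'), (c, h), (c', h')) \<Rightarrow>
     let f00 = pair_val b g c h; f02 = pair_val b g c' h';
         f20 = pair_val b' g' c h; f22 = pair_val b' g' c' h'
     in if f00 < 0 then False else if f02 < 0 then False else if f20 < 0 then False else if f22 < 0 then False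
     else let bm = (b + b') div 2; gm = (g + g') div 2; cm = (c + c') div 2; hm = (h + h') div 2;
         f10 = pair_val bm gm c h; f12 = pair_val bm gm c' h';
         f01 = pair_val b g cm hm; f21 = pair_val b' g' cm hm
     in if 4 * f10 < f00 + f20 then False else if 4 * f12 < f02 + f22 then False
     else if 4 * f01 < f00 + f02 then False else if 4 * f21 < f20 + f22 then False
     else 4 * (f01 + f21 + f10 + f12) \<le> 16 * pair_val bm gm cm hm + (f00 + f02 + f20 + f22))"

text \<open>Branch and bound over sublists of the nodes. By symmetry only pairs of cuts in increasing order
  matter; the square around the tie is left to a separate argument.\<close>

fun pair_check :: "nat \<Rightarrow> (int \<times> int) list \<Rightarrow> (int \<times> int) list \<Rightarrow> bool" where
  "pair_check 0 xs ys = False"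
| "pair_check (Suc n) xs ys =
     (if fst (last ys) < fst (hd xs) then True
      else if 18927000 \<le> fst (hd xs) \<and> fst (last xs) \<le> 24577000
          \<and> 18927000 \<le> fst (hd ys) \<and> fst (last ys) \<le> 24577000 then True
      else if pair_box (hd xs) (last xs) (hd ys) (last ys) then True
      else if length xs < length ys then
        (let k = length ys div 2 in
          if pair_check n xs (take (Suc k) ys) then pair_check n xs (drop k ys) else False)
      else
        (let k = length xs div 2 in
          if pair_check n (take (Suc k) xs) ys then pair_check n (drop k xs) ys else False))"

lemma gtable_check: "\<forall>i\<in>set [0..<69]. G_upper 12 (1490000 * int i) \<le> 100 * gtable ! i" by code_simp

lemma pair_nodes_check: "\<forall>x\<in>set pair_nodes. even (fst x) \<and> even (snd x) \<and> G_upper 14 (fst x) \<le> snd x" by code_simp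

lemma box_check_1: "box_check 14 1 (-10767243) [(1, 34)]" by code_simp

lemma box_check_2: "box_check 14 1 (-11252748) [(1, 34), (1, 34)]"
  "box_check 14 5 (-11133849) [(5, 34), (5, 34)]" by code_simp+

lemma box_check_3a: "box_check 14 1 (-11506069) [(1, 34), (1, 34), (1, 34)]" by code_simp

lemma box_check_3b: "box_check 14 5 (-11387170) [(5, 34), (5, 34), (5, 34)]" by code_simp

lemma pair_check_nodes: "pair_check 20 pair_nodes pair_nodes" by code_simp

section \<open>The critical parameter\<close>

definition crit :: "real \<Rightarrow> real" where
  "crit r = 6 * (r - 1) * (r ^ 4 + r\<^sup>2) - (r ^ 7 + r ^ 6 + 4 * r ^ 5 - 2 * r ^ 4 - 2 * r ^ 3 - 8 * r\<^sup>2 + 9 * r - 3)"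

lemma critical_eq_iff: "critical_eq r \<longleftrightarrow> crit r = 0"
proof -
  have "X = Y / 6 \<longleftrightarrow> 6 * X - Y = 0" for X Y :: real by auto
  then show ?thesis unfolding critical_eq_def crit_def mult.assoc[of 6] .
qed

text \<open>The derivative is negative, hence the critical equation has at most one solution.\<close>

lemma crit_decreasing:
  assumes "0 \<le> x" "x < y" "y \<le> 1/2"
  shows "crit y < crit x"
proof (rule DERIV_neg_imp_decreasing[OF assms(2)])
  fix t assume t: "x \<le> t" "t \<le> y"
  have "DERIV crit t :> 6 * (t ^ 4 + t\<^sup>2) + 6 * (t - 1) * (4 * t ^ 3 + 2 * t)
      - (7 * t ^ 6 + 6 * t ^ 5 + 20 * t ^ 4 - 8 * t ^ 3 - 6 * t\<^sup>2 - 16 * t + 9)"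
    unfolding crit_def[abs_def]
    by (auto intro!: derivative_eq_intros simp: power2_eq_square power_numeral_reduce algebra_simps)
  moreover have "6 * (t ^ 4 + t\<^sup>2) + 6 * (t - 1) * (4 * t ^ 3 + 2 * t)
      - (7 * t ^ 6 + 6 * t ^ 5 + 20 * t ^ 4 - 8 * t ^ 3 - 6 * t\<^sup>2 - 16 * t + 9) < 0"
  proof -
    have t01: "0 \<le> t" "t \<le> 1/2" using t assms by auto
    have "t * t \<le> (1/2) * (1/2)" using t01 by (intro mult_mono) auto
    then have "t\<^sup>2 \<le> 1/4" by (simp add: power2_eq_square)
    moreover have "t * t ^ 3 \<le> (1/2) * t ^ 3" using t01 by (intro mult_right_mono) auto
    then have "t ^ 4 \<le> (1/2) * t ^ 3" by (simp add: power_numeral_reduce)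
    moreover have "0 \<le> t ^ 3" "0 \<le> t ^ 5" "0 \<le> t ^ 6" using t01 by auto
    ultimately have "24 * t\<^sup>2 + 4 * t - 9 + 10 * t ^ 4 - 16 * t ^ 3 - 6 * t ^ 5 - 7 * t ^ 6 < 0"
      using t01 by linarith
    then show ?thesis by (simp add: power2_eq_square power_numeral_reduce algebra_simps)
  qed
  ultimately show "\<exists>d. DERIV crit t :> d \<and> d < 0" by blast
qed

lemma crit_signs: "0 < crit (43504117069 / 10 ^ 11)" "crit (43504117070 / 10 ^ 11) < 0"
  by (simp_all add: crit_def power2_eq_square power_numeral_reduce)

locale critical_parameter = cantor_parameter +
  assumes crit_zero: "crit r = 0"
begin

lemma r_approx: "43504117069 / 10 ^ 11 < r" "r < 43504117070 / 10 ^ 11"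
proof -
  show "43504117069 / 10 ^ 11 < r"
  proof (rule ccontr)
    assume "\<not> 43504117069 / 10 ^ 11 < r"
    then have "r < 43504117069 / 10 ^ 11" using crit_signs(1) crit_zero by (cases "r = 43504117069 / 10 ^ 11") auto
    from crit_decreasing[OF _ this] r_pos crit_signs(1) crit_zero show False by simp
  qed
  show "r < 43504117070 / 10 ^ 11"
  proof (rule ccontr)
    assume "\<not> r < 43504117070 / 10 ^ 11"
    then have "43504117070 / 10 ^ 11 < r" using crit_signs(2) crit_zero by (cases "r = 43504117070 / 10 ^ 11") auto
    from crit_decreasing[OF _ this] r_less crit_signs(2) crit_zero show False by simp
  qed
qed

lemma q_approx: "0.189260820 < r\<^sup>2" "r\<^sup>2 < 0.189260821"
proof -
  have "(43504117069 / 10 ^ 11)\<^sup>2 < r\<^sup>2" using r_approx by (intro power_strict_mono) auto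
  then show "0.189260820 < r\<^sup>2" by (simp add: power2_eq_square)
  have "r\<^sup>2 < (43504117070 / 10 ^ 11)\<^sup>2" using r_approx r_pos by (intro power_strict_mono) auto
  then show "r\<^sup>2 < 0.189260821" by (simp add: power2_eq_square)
qed

lemma V_approx: "0.0984220593 < V" "V < 0.0984220595"
proof -
  have "0 < 4 * (1 + r)" using r_pos by simp
  then show "0.0984220593 < V" "V < 0.0984220595"
    unfolding V_def using r_approx by (simp_all add: pos_less_divide_eq pos_divide_less_eq)
qed

definition D :: real where "D = (1/2 - r) / r"

lemma D_approx: "\<bar>D - 0.14931651\<bar> \<le> 1 / 10 ^ 10"
  unfolding D_def abs_le_iff using r_approx r_pos by (simp add: field_simps)

subsection \<open>Soundness of the table of values of \<open>G\<close>\<close>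

lemma G_le_half:
  assumes "0 \<le> b" "b \<le> 1" shows "G b \<le> b / 2"
  using G_chord[OF assms, of "1/2" 0] by (simp add: G_nonpos G_ge_1)

lemma int_div_bounds:
  assumes "0 < (n::int)"
  shows "real_of_int (m div n) \<le> real_of_int m / real_of_int n"
        "real_of_int m / real_of_int n < real_of_int (m div n) + 1"
  using floor_divide_of_int_eq[of m n, where 'a = real] by linarith+

lemma G_upper_boundary: "x \<le> 0 \<Longrightarrow> G_upper k x = 0" "100000000 \<le> x \<Longrightarrow> G_upper k x = x - 50000000"
  by (subst G_upper.simps; simp)+

lemma G_upper_Suc: "0 < x \<Longrightarrow> x < 100000000 \<Longrightarrow> G_upper (Suc k) x =
    43504117070 * (G_upper k (x * 100000000000 div 43504117069 + 1)
      + G_upper k (100000000 - (100000000 - x) * 100000000000 div 43504117070)) div 200000000000 + 1"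
  by (rule trans[OF G_upper.simps]) simp

text \<open>\<open>G\<close> is increasing, so the recursion may be applied to rounded-up arguments.\<close>

lemma G_upper_sound: "G (real_of_int x / 10 ^ 8) \<le> real_of_int (G_upper k x) / 10 ^ 8"
proof (induction k arbitrary: x)
  case (0 x)
  show ?case
  proof (cases "x \<le> 0 \<or> 100000000 \<le> x")
    case True
    then show ?thesis by (auto simp: G_upper_boundary G_nonpos G_ge_1)
  next
    case False
    then have "G (real_of_int x / 10 ^ 8) \<le> real_of_int x / 10 ^ 8 / 2" by (intro G_le_half) auto
    also have "\<dots> \<le> real_of_int (x div 2 + 1) / 10 ^ 8" using int_div_bounds[of 2 x] by simp
    also have "x div 2 + 1 = G_upper 0 x" using False by (subst G_upper.simps) simp
    finally show ?thesis .
  qed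
next
  case (Suc k x)
  show ?case
  proof (cases "x \<le> 0 \<or> 100000000 \<le> x")
    case True
    then show ?thesis by (auto simp: G_upper_boundary G_nonpos G_ge_1)
  next
    case False
    let ?y = "x * 100000000000 div 43504117069 + 1"
    let ?z = "100000000 - (100000000 - x) * 100000000000 div 43504117070"
    let ?b = "real_of_int x / 10 ^ 8"
    have x: "0 < real_of_int x" "real_of_int x < 10 ^ 8" using False by auto
    have "?b / r \<le> ?b / (43504117069 / 10 ^ 11)"
      using x r_approx by (intro divide_left_mono) auto
    also have "\<dots> \<le> real_of_int ?y / 10 ^ 8"
      using int_div_bounds(2)[of 43504117069 "x * 100000000000"] by simp
    finally have y: "G (?b / r) \<le> real_of_int (G_upper k ?y) / 10 ^ 8"
      using G_mono Suc.IH[of ?y] by (meson order_trans)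
    have "(1 - ?b) / (43504117070 / 10 ^ 11) \<le> (1 - ?b) / r"
      using x r_approx r_pos by (intro divide_left_mono) auto
    moreover have "real_of_int ((100000000 - x) * 100000000000 div 43504117070) / 10 ^ 8
        \<le> (1 - ?b) / (43504117070 / 10 ^ 11)"
      using int_div_bounds(1)[of 43504117070 "(100000000 - x) * 100000000000"] by simp
    moreover have "real_of_int ?z / 10 ^ 8
        = 1 - real_of_int ((100000000 - x) * 100000000000 div 43504117070) / 10 ^ 8"
      by (simp add: diff_divide_distrib)
    ultimately have "1 - (1 - ?b) / r \<le> real_of_int ?z / 10 ^ 8" by linarith
    then have z: "G (1 - (1 - ?b) / r) \<le> real_of_int (G_upper k ?z) / 10 ^ 8"
      using G_mono Suc.IH[of ?z] by (meson order_trans)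
    have "G ?b = r / 2 * (G (?b / r) + G (1 - (1 - ?b) / r))"
      using G_step[of ?b] by (simp add: distrib_left)
    also have "\<dots> \<le> 43504117070 / 10 ^ 11 / 2 * (real_of_int (G_upper k ?y) / 10 ^ 8 + real_of_int (G_upper k ?z) / 10 ^ 8)"
      using r_approx r_pos y z by (intro mult_mono add_mono) (auto simp: G_nonneg)
    also have "\<dots> = real_of_int (43504117070 * (G_upper k ?y + G_upper k ?z)) / real_of_int 200000000000 / 10 ^ 8"
      by simp
    also have "\<dots> \<le> real_of_int (43504117070 * (G_upper k ?y + G_upper k ?z) div 200000000000 + 1) / 10 ^ 8"
      using int_div_bounds(2)[of 200000000000 "43504117070 * (G_upper k ?y + G_upper k ?z)"]
      by (intro divide_right_mono) auto
    also have "43504117070 * (G_upper k ?y + G_upper k ?z) div 200000000000 + 1 = G_upper (Suc k) x"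
      using False G_upper_Suc[of x k] by simp
    finally show ?thesis .
  qed
qed

lemma gval_upper: assumes "i \<le> 68" shows "G (149 / 10 ^ 4 * real_of_int i) \<le> real_of_int (gval i) / 10 ^ 6"
proof (cases "i \<le> 0")
  case True
  then show ?thesis by (simp add: gval_def G_nonpos)
next
  case False
  then have "nat i \<in> set [0..<69]" using assms by auto
  then have "G_upper 12 (1490000 * i) \<le> 100 * gval i"
    using gtable_check[rule_format, of "nat i"] False by (simp add: gval_def)
  then have "real_of_int (G_upper 12 (1490000 * i)) \<le> real_of_int (100 * gval i)" by (rule of_int_le_iff[THEN iffD2])
  with G_upper_sound[of "1490000 * i" 12] show ?thesis by simp
qed

lemma slope_upper:
  assumes "i \<le> j" "j \<le> 68" "real_of_int i \<le> B" "B \<le> real_of_int j"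
  shows "G (149 / 10 ^ 4 * B) \<le> (real_of_int (slope i j) * B + real_of_int (gval i - slope i j * i)) / 10 ^ 6"
proof -
  have s: "gval j \<le> slope i j * j + (gval i - slope i j * i)"
  proof (cases "i = j")
    case False
    then have "0 < j - i" using assms by simp
    then have "(gval i - gval j) div (j - i) * (j - i) \<le> gval i - gval j"
      by (simp add: minus_mod_eq_div_mult[symmetric])
    then show ?thesis by (simp add: slope_def algebra_simps)
  qed (simp add: slope_def)
  let ?u = "real_of_int (slope i j)" and ?w = "real_of_int (gval i - slope i j * i)"
  have "G (149 / 10 ^ 4 * B) \<le> ?u / 10 ^ 6 * 10 ^ 4 / 149 * (149 / 10 ^ 4 * B) + ?w / 10 ^ 6"
  proof (rule G_chord)
    show "149 / 10 ^ 4 * real_of_int i \<le> 149 / 10 ^ 4 * B" "149 / 10 ^ 4 * B \<le> 149 / 10 ^ 4 * real_of_int j"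
      using assms by auto
    have "real_of_int (gval j) \<le> real_of_int (slope i j * j + (gval i - slope i j * i))"
      using s by (rule of_int_le_iff[THEN iffD2])
    then show "G (149 / 10 ^ 4 * real_of_int j) \<le> ?u / 10 ^ 6 * 10 ^ 4 / 149 * (149 / 10 ^ 4 * real_of_int j) + ?w / 10 ^ 6"
      using gval_upper[OF assms(2)] by (simp add: field_simps)
    show "G (149 / 10 ^ 4 * real_of_int i) \<le> ?u / 10 ^ 6 * 10 ^ 4 / 149 * (149 / 10 ^ 4 * real_of_int i) + ?w / 10 ^ 6"
      using gval_upper[of i] assms by (simp add: field_simps)
  qed
  then show ?thesis by (simp add: add_divide_distrib mult.commute)
qed

end

text \<open>A polynomial of degree two is a convex combination of its Bernstein coefficients.\<close>

lemma bernstein_min_le: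
  assumes "real_of_int a \<le> C" "C \<le> real_of_int b"
  shows "real_of_int (bernstein_min p q a b) / 2 \<le> real_of_int p * C\<^sup>2 + real_of_int q * C"
proof (cases "a = b")
  case True
  then have "C = real_of_int a" using assms by simp
  moreover have "bernstein_min p q a b \<le> 2 * p * a * a + 2 * q * a" by (simp add: bernstein_min_def)
  then have "real_of_int (bernstein_min p q a b) \<le> real_of_int (2 * p * a * a + 2 * q * a)" by (rule of_int_le_iff[THEN iffD2])
  ultimately show ?thesis by (simp add: power2_eq_square)
next
  case False
  let ?a = "real_of_int a" and ?b = "real_of_int b" and ?p = "real_of_int p" and ?q = "real_of_int q"
  let ?m = "real_of_int (bernstein_min p q a b)"
  define t where "t = (C - ?a) / (?b - ?a)"
  have ab: "?a < ?b" using False assms by linarith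
  then have t: "0 \<le> t" "t \<le> 1" using assms by (auto simp: t_def)
  have "t * (?b - ?a) = C - ?a" using ab by (simp add: t_def)
  then have C: "C = (1 - t) * ?a + t * ?b" by (simp add: algebra_simps)
  have "?m \<le> real_of_int (2 * p * a * a + 2 * q * a)" "?m \<le> real_of_int (2 * p * a * b + q * (a + b))"
    "?m \<le> real_of_int (2 * p * b * b + 2 * q * b)"
    unfolding of_int_le_iff by (simp_all add: bernstein_min_def)
  then have m: "?m \<le> 2 * ?p * ?a * ?a + 2 * ?q * ?a" "?m \<le> 2 * ?p * ?a * ?b + ?q * (?a + ?b)"
    "?m \<le> 2 * ?p * ?b * ?b + 2 * ?q * ?b"
    by simp_all
  have "?m = (1 - t)\<^sup>2 * ?m + 2 * t * (1 - t) * ?m + t\<^sup>2 * ?m"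
    by (simp add: power2_eq_square algebra_simps)
  also have "\<dots> \<le> (1 - t)\<^sup>2 * (2 * ?p * ?a * ?a + 2 * ?q * ?a) + 2 * t * (1 - t) * (2 * ?p * ?a * ?b + ?q * (?a + ?b))
      + t\<^sup>2 * (2 * ?p * ?b * ?b + 2 * ?q * ?b)"
    using t m by (intro add_mono mult_left_mono) auto
  also have "\<dots> = 2 * (?p * C\<^sup>2 + ?q * C)" unfolding C by (simp add: power2_eq_square algebra_simps)
  finally show ?thesis by simp
qed

text \<open>The unit of length of the boxes.\<close>

definition grid :: real where "grid = 149 / 5000"

definition in_boxes :: "(int \<times> int) list \<Rightarrow> real list \<Rightarrow> bool" where
  "in_boxes bx Cs \<longleftrightarrow> list_all2 (\<lambda>I C. real_of_int (fst I) \<le> C \<and> C \<le> real_of_int (snd I)) bx Cs"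

lemma in_boxes_simps [simp]:
  "in_boxes [] Cs \<longleftrightarrow> Cs = []"
  "in_boxes ((a, b) # bx) Cs \<longleftrightarrow> (\<exists>C Cs'. Cs = C # Cs' \<and> real_of_int a \<le> C \<and> C \<le> real_of_int b \<and> in_boxes bx Cs')"
  by (auto simp: in_boxes_def list_all2_Cons1)

lemma unsorted_sound: "unsorted bx \<Longrightarrow> in_boxes bx Cs \<Longrightarrow> \<not> sorted Cs"
proof (induction bx arbitrary: Cs rule: unsorted.induct)
  case (1 a b a' b' bs)
  then show ?case by (fastforce split: if_splits)
qed auto

lemma cut_box_sound: "in_boxes bx Cs \<Longrightarrow> cut_box w bx = (l, u) \<Longrightarrow> in_boxes l Cs \<or> in_boxes u Cs"
proof (induction w bx arbitrary: Cs l u rule: cut_box.induct)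
  case (2 w a b bs)
  from "2.prems"(1) obtain C Cs' where C: "Cs = C # Cs'" "real_of_int a \<le> C" "C \<le> real_of_int b" "in_boxes bs Cs'"
    by auto
  show ?case
  proof (cases "b - a = w")
    case True
    then show ?thesis using "2.prems" C by (cases "C \<le> real_of_int ((a + b) div 2)") auto
  next
    case False
    obtain l' u' where lu: "cut_box w bs = (l', u')" by fastforce
    then show ?thesis using "2.IH"[OF False C(4) lu] "2.prems"(2) False C by auto
  qed
qed auto

lemma cut_box_le:
  "cut_box w bx = (l, u) \<Longrightarrow> \<forall>(a, b)\<in>set bx. a \<le> m \<and> b \<le> m \<Longrightarrow>
    (\<forall>(a, b)\<in>set l. a \<le> m \<and> b \<le> m) \<and> (\<forall>(a, b)\<in>set u. a \<le> m \<and> b \<le> m)"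
proof (induction w bx arbitrary: l u rule: cut_box.induct)
  case (2 w a b bs)
  show ?case
  proof (cases "b - a = w")
    case True
    then show ?thesis using "2.prems" by auto
  next
    case False
    obtain l' u' where lu: "cut_box w bs = (l', u')" by fastforce
    then show ?thesis using "2.IH"[OF False lu] "2.prems" False by auto
  qed
qed auto

context critical_parameter
begin

text \<open>The factor \<open>149 / (5 * 10 ^ 9)\<close> is the product of the grid width and the unit \<open>10 ^ (- 6)\<close> of the
  table; a further factor two comes from \<open>2 (c' - c)\<close>.\<close>

lemma box_bound_le:
  assumes "in_boxes bx (C # Cs)" "sorted (C # Cs)" "\<forall>(a, b)\<in>set bx. a \<le> 34 \<and> b \<le> 34"
  shows "149 / (5 * 10 ^ 9) * (real_of_int (box_bound p q bx) / 2 + real_of_int p * C\<^sup>2 + real_of_int q * C) * 2 + V + 1/4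
     \<le> lower_val (grid * C) (map ((*) grid) Cs)"
  using assms
proof (induction p q bx arbitrary: C Cs rule: box_bound.induct)
  case (2 p q a b)
  then have C: "real_of_int a \<le> C" "C \<le> real_of_int b" and [simp]: "Cs = []" by auto
  have "real_of_int (bernstein_min (14900 - p) (- 500000 - q) a b) / 2 \<le> (14900 - real_of_int p) * C\<^sup>2 + (- 500000 - real_of_int q) * C"
    using bernstein_min_le[OF C, of "14900 - p" "- 500000 - q"] by simp
  then show ?case by (simp add: grid_def power2_eq_square field_simps)
next
  case (3 p q a b a' b' bs)
  from "3.prems"(1) obtain C' Cs' where C: "real_of_int a \<le> C" "C \<le> real_of_int b"
    "Cs = C' # Cs'" "real_of_int a' \<le> C'" "C' \<le> real_of_int b'" "in_boxes bs Cs'"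
    by auto
  define s where "s = slope (a + a') (b + b')"
  define w where "w = gval (a + a') - s * (a + a')"
  have le: "C \<le> C'" using "3.prems"(2) C by simp
  have "G (149 / 10 ^ 4 * (C + C')) \<le> (real_of_int s * (C + C') + real_of_int w) / 10 ^ 6"
    unfolding s_def w_def
  proof (rule slope_upper)
    show "real_of_int (a + a') \<le> C + C'" "C + C' \<le> real_of_int (b + b')" using C by auto
    then show "a + a' \<le> b + b'" by linarith
    show "b + b' \<le> 68" using "3.prems"(3) by auto
  qed
  moreover have "0 \<le> 2 * (grid * C' - grid * C)" using le by (simp add: grid_def)
  ultimately have "2 * (grid * C' - grid * C) * G (149 / 10 ^ 4 * (C + C'))
      \<le> 2 * (grid * C' - grid * C) * ((real_of_int s * (C + C') + real_of_int w) / 10 ^ 6)"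
    by (rule mult_left_mono)
  also have "\<dots> = 149 / (5 * 10 ^ 9) * 2 * ((real_of_int s * C'\<^sup>2 + real_of_int w * C') - (real_of_int s * C\<^sup>2 + real_of_int w * C))"
    by (simp add: grid_def power2_eq_square field_simps)
  finally have G: "2 * (grid * C' - grid * C) * G (149 / 10 ^ 4 * (C + C'))
      \<le> 149 / (5 * 10 ^ 9) * 2 * ((real_of_int s * C'\<^sup>2 + real_of_int w * C') - (real_of_int s * C\<^sup>2 + real_of_int w * C))" .
  have IH: "149 / (5 * 10 ^ 9) * (real_of_int (box_bound s w ((a', b') # bs)) / 2 + real_of_int s * C'\<^sup>2 + real_of_int w * C') * 2 + V + 1/4
     \<le> lower_val (grid * C') (map ((*) grid) Cs')"
    using "3.IH"[OF s_def w_def, of C' Cs'] "3.prems" C by auto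
  have bound: "real_of_int (bernstein_min (s - p) (w - q) a b) / 2 \<le> (real_of_int s - real_of_int p) * C\<^sup>2 + (real_of_int w - real_of_int q) * C"
    using bernstein_min_le[OF C(1,2), of "s - p" "w - q"] by simp
  have eq: "box_bound p q ((a, b) # (a', b') # bs) = bernstein_min (s - p) (w - q) a b + box_bound s w ((a', b') # bs)"
    by (simp add: s_def w_def Let_def)
  have mid: "(grid * C + grid * C') / 2 = 149 / 10 ^ 4 * (C + C')" by (simp add: grid_def)
  have "lower_val (grid * C) (map ((*) grid) Cs)
      = lower_val (grid * C') (map ((*) grid) Cs')
        - 2 * (grid * C' - grid * C) * G (149 / 10 ^ 4 * (C + C'))"
    unfolding C(3) list.map lower_val.simps mid ..
  moreover define X Y where "X = lower_val (grid * C) (map ((*) grid) Cs)" and "Y = lower_val (grid * C') (map ((*) grid) Cs')"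
  ultimately show ?case
    using IH G bound unfolding eq of_int_add X_def[symmetric] Y_def[symmetric] by (simp add: field_simps)
qed simp

lemma box_check_sound:
  assumes "box_check n d thr bx" "in_boxes bx Cs" "sorted (- real_of_int d # Cs)"
    "\<forall>(a, b)\<in>set bx. a \<le> 34 \<and> b \<le> 34" "- d \<le> 34"
  shows "149 / (5 * 10 ^ 9) * real_of_int thr + V + 1/4
     \<le> lower_val (- (grid * real_of_int d)) (map ((*) grid) Cs)"
  using assms
proof (induction n arbitrary: bx)
  case (Suc n)
  obtain l u where lu: "cut_box (width bx) bx = (l, u)" by fastforce
  have nu: "\<not> unsorted bx" using unsorted_sound[OF _ Suc.prems(2)] Suc.prems(3) by auto
  show ?case
  proof (cases "thr \<le> box_bound 0 0 ((- d, - d) # bx)")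
    case True
    then have "real_of_int thr \<le> real_of_int (box_bound 0 0 ((- d, - d) # bx))" by (rule of_int_le_iff[THEN iffD2])
    moreover have "149 / (5 * 10 ^ 9) * (real_of_int (box_bound 0 0 ((- d, - d) # bx)) / 2 + real_of_int 0 * (- real_of_int d)\<^sup>2
        + real_of_int 0 * (- real_of_int d)) * 2 + V + 1/4
       \<le> lower_val (grid * (- real_of_int d)) (map ((*) grid) Cs)"
      by (rule box_bound_le) (use Suc.prems in auto)
    ultimately show ?thesis by simp
  next
    case False
    then have "box_check n d thr l" "box_check n d thr u"
      using Suc.prems(1) nu lu by (auto split: if_splits)
    then show ?thesis
      using Suc.IH cut_box_sound[OF Suc.prems(2) lu] cut_box_le[OF lu Suc.prems(4)] Suc.prems(3,5) by blast
  qed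
qed simp

subsection \<open>Codebooks with one point outside the unit interval\<close>

text \<open>Points to the left of the support are the less useful the farther away they are.\<close>

lemma err_insert_mono:
  assumes "finite C" "0 \<le> d" "d \<le> d'"
  shows "err (insert (- d) C) \<le> err (insert (- d') C)"
  unfolding err_def
proof (intro E_mono continuous_on_sq_dist)
  fix x :: real assume x: "0 \<le> x" "x \<le> 1"
  show "sq_dist (insert (- d) C) x \<le> sq_dist (insert (- d') C) x"
  proof (rule sq_dist_geI)
    fix a assume "a \<in> insert (- d') C"
    then show "sq_dist (insert (- d) C) x \<le> (x - a)\<^sup>2"
    proof
      assume a: "a = - d'"
      have "sq_dist (insert (- d) C) x \<le> (x - (- d))\<^sup>2" using assms by (intro sq_dist_le) auto
      also have "\<dots> \<le> (x - a)\<^sup>2" unfolding a using assms x by (intro power_mono) auto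
      finally show ?thesis .
    qed (use assms in \<open>auto intro: sq_dist_le\<close>)
  qed (use assms in auto)
qed (use assms in auto)

lemma err_clip:
  assumes "finite \<alpha>" "\<alpha> \<noteq> {}"
  shows "err (min 1 ` \<alpha>) \<le> err \<alpha>"
  unfolding err_def
proof (intro E_mono continuous_on_sq_dist)
  fix x :: real assume x: "0 \<le> x" "x \<le> 1"
  show "sq_dist (min 1 ` \<alpha>) x \<le> sq_dist \<alpha> x"
  proof (rule sq_dist_geI)
    fix a assume a: "a \<in> \<alpha>"
    then have "sq_dist (min 1 ` \<alpha>) x \<le> (x - min 1 a)\<^sup>2" using assms by (intro sq_dist_le) auto
    also have "\<dots> \<le> (x - a)\<^sup>2"
    proof (cases "a \<le> 1")
      case False
      then have "(1 - x)\<^sup>2 \<le> (a - x)\<^sup>2" using x by (intro power_mono) auto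
      then show ?thesis using False by (simp add: power2_commute min_def)
    qed simp
    finally show "sq_dist (min 1 ` \<alpha>) x \<le> (x - a)\<^sup>2" .
  qed (use assms in auto)
qed (use assms in auto)

text \<open>Codepoints beyond \<open>1\<close> may be moved to \<open>1\<close>, the outside point may be moved towards \<open>0\<close>, and all
  positions then lie in the box \<open>[d, 34]\<close> of the grid, as \<open>34 * 0.0298 > 1\<close>.\<close>

lemma err_ge_box_check:
  assumes check: "box_check n d thr (replicate (card C) (d, 34))" and d: "1 \<le> d" "d \<le> 33"
    and C: "finite C" "\<And>c. c \<in> C \<Longrightarrow> grid * real_of_int d \<le> c"
    and d': "grid * real_of_int d \<le> d'"
  shows "149 / (5 * 10 ^ 9) * real_of_int thr + V + 1/4 \<le> err (insert (- d') C)"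
proof -
  let ?h = "grid"
  have grid: "0 < grid" "grid * 33 \<le> 1" "1 \<le> grid * 34" by (simp_all add: grid_def)
  define cs where "cs = map (min 1) (sorted_list_of_set C)"
  have sorted: "sorted cs"
    unfolding cs_def by (rule sorted_map_mono) (auto intro!: monoI mono_onI)
  have set: "set cs = min 1 ` C" and len: "length cs = card C"
    using C by (simp_all add: cs_def)
  have range: "?h * real_of_int d \<le> c" "c \<le> 1" if "c \<in> set cs" for c
  proof -
    have "?h * real_of_int d \<le> ?h * 33" using d grid by (intro mult_left_mono) auto
    then have "?h * real_of_int d \<le> 1" using grid(2) by linarith
    then show "?h * real_of_int d \<le> c" "c \<le> 1" using that C(2) unfolding set by (auto simp: min_def)
  qed
  let ?Cs = "map (\<lambda>c. c / ?h) cs"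
  have "in_boxes (replicate (card C) (d, 34)) ?Cs"
  proof -
    have "real_of_int d \<le> c / ?h" "c / ?h \<le> 34" if "c \<in> set cs" for c
      using range[OF that] grid by (simp_all add: pos_le_divide_eq pos_divide_le_eq mult.commute)
    then show ?thesis
      unfolding in_boxes_def list_all2_conv_all_nth using len by auto
  qed
  moreover have "sorted (- real_of_int d # ?Cs)"
  proof -
    have "sorted ?Cs" using sorted grid by (simp add: sorted_iff_nth_mono divide_right_mono)
    moreover have "- real_of_int d \<le> c / ?h" if "c \<in> set cs" for c
    proof -
      have "0 \<le> ?h * real_of_int d" using d grid by simp
      also have "\<dots> \<le> c" by (rule range(1)[OF that])
      finally have "0 \<le> c / ?h" using grid by simp
      moreover have "- real_of_int d \<le> 0" using d by simp
      ultimately show ?thesis by linarith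
    qed
    ultimately show ?thesis by auto
  qed
  ultimately have "149 / (5 * 10 ^ 9) * real_of_int thr + V + 1/4 \<le> lower_val (- (?h * real_of_int d)) (map ((*) ?h) ?Cs)"
    using d by (intro box_check_sound[OF check]) auto
  also have "map ((*) ?h) ?Cs = cs" using grid by (simp add: o_def)
  also have "lower_val (- (?h * real_of_int d)) cs \<le> err (set (- (?h * real_of_int d) # cs))"
  proof (rule err_ge_lower_val)
    have "- (?h * real_of_int d) \<le> 0" "0 \<le> ?h * real_of_int d" using d grid by simp_all
    then have "- (?h * real_of_int d) \<le> c" if "c \<in> set cs" for c using range(1)[OF that] by linarith
    then show "sorted (- (?h * real_of_int d) # cs)" using sorted by auto
  qed
  also have "set (- (?h * real_of_int d) # cs) = min 1 ` insert (- (?h * real_of_int d)) C"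
  proof -
    have "0 \<le> ?h * real_of_int d" using d grid by simp
    then show ?thesis by (simp add: set min_def)
  qed
  also have "err \<dots> \<le> err (insert (- (?h * real_of_int d)) C)" using C by (intro err_clip) auto
  also have "\<dots> \<le> err (insert (- d') C)" using C d d' grid by (intro err_insert_mono) auto
  finally show ?thesis .
qed

text \<open>The threshold is chosen such that the resulting bound just exceeds \<open>0.28 V\<close>; the thresholds in
  the next two lemmas arise in the same way. The constants are chosen below the true minima and large
  enough for the estimates with at most seven points.\<close>

lemma err_one_point:
  assumes "finite C" "card C = 1" "\<And>c. c \<in> C \<Longrightarrow> d \<le> c" "0.0298 \<le> d"
  shows "0.28 * V \<le> err (insert (- d) C)"
proof -
  have "149 / (5 * 10 ^ 9) * real_of_int (-10767243) + V + 1/4 \<le> err (insert (- d) C)"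
    by (rule err_ge_box_check[of 14 1]) (use assms box_check_1 in \<open>auto simp: grid_def numeral_eq_Suc intro: order_trans\<close>)
  then show ?thesis using V_approx by simp
qed

lemma err_two_points:
  assumes "finite C" "card C = 2" "\<And>c. c \<in> C \<Longrightarrow> d \<le> c"
  shows "0.0298 \<le> d \<Longrightarrow> 0.133 * V \<le> err (insert (- d) C)"
    and "0.149 \<le> d \<Longrightarrow> 0.169 * V \<le> err (insert (- d) C)"
proof -
  have rep: "replicate (card C) I = [I, I]" for I :: "int \<times> int" using assms by (simp add: numeral_eq_Suc)
  show "0.133 * V \<le> err (insert (- d) C)" if "0.0298 \<le> d"
  proof -
    have "149 / (5 * 10 ^ 9) * real_of_int (-11252748) + V + 1/4 \<le> err (insert (- d) C)"
      by (rule err_ge_box_check[of 14 1]) (use assms that box_check_2(1) rep in \<open>auto simp: grid_def intro: order_trans\<close>)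
    then show ?thesis using V_approx by simp
  qed
  show "0.169 * V \<le> err (insert (- d) C)" if "0.149 \<le> d"
  proof -
    have "149 / (5 * 10 ^ 9) * real_of_int (-11133849) + V + 1/4 \<le> err (insert (- d) C)"
      by (rule err_ge_box_check[of 14 5]) (use assms that box_check_2(2) rep in \<open>auto simp: grid_def intro: order_trans\<close>)
    then show ?thesis using V_approx by simp
  qed
qed

lemma err_three_points:
  assumes "finite C" "card C = 3" "\<And>c. c \<in> C \<Longrightarrow> d \<le> c"
  shows "0.0298 \<le> d \<Longrightarrow> 0.0563 * V \<le> err (insert (- d) C)"
    and "0.149 \<le> d \<Longrightarrow> 0.0923 * V \<le> err (insert (- d) C)"
proof -
  have rep: "replicate (card C) I = [I, I, I]" for I :: "int \<times> int" using assms by (simp add: numeral_eq_Suc)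
  show "0.0563 * V \<le> err (insert (- d) C)" if "0.0298 \<le> d"
  proof -
    have "149 / (5 * 10 ^ 9) * real_of_int (-11506069) + V + 1/4 \<le> err (insert (- d) C)"
      by (rule err_ge_box_check[of 14 1]) (use assms that box_check_3a rep in \<open>auto simp: grid_def intro: order_trans\<close>)
    then show ?thesis using V_approx by simp
  qed
  show "0.0923 * V \<le> err (insert (- d) C)" if "0.149 \<le> d"
  proof -
    have "149 / (5 * 10 ^ 9) * real_of_int (-11387170) + V + 1/4 \<le> err (insert (- d) C)"
      by (rule err_ge_box_check[of 14 5]) (use assms that box_check_3b rep in \<open>auto simp: grid_def intro: order_trans\<close>)
    then show ?thesis using V_approx by simp
  qed
qed

end

section \<open>Three points\<close>

text \<open>Suppose that each of two codebooks consists of an outside point and one further point, that the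
  distances of the outside points from \<open>0\<close> add up to \<open>2 D\<close>, and that \<open>b, c\<close> are the cut positions with values
  \<open>g = G b\<close>, \<open>h = G c\<close>. The sum of the two distortions is a quadratic polynomial in the difference of the two
  distances. Its minimum over this difference is the present form, up to the additive constant
  \<open>V * (1 + r\<^sup>2)\<close>, if \<open>w = V * (1 - r\<^sup>2)\<close>.\<close>

definition pair_form :: "real \<Rightarrow> real \<Rightarrow> real \<Rightarrow> real \<Rightarrow> real \<Rightarrow> real \<Rightarrow> real" where
  "pair_form D w b g c h = 2 * (b + c + D - 1/2)\<^sup>2 - 2 * (g - h)\<^sup>2 - 4 * ((c + D) * g + (b + D) * h) + w"

lemma pair_form_swap: "pair_form D w b g c h = pair_form D w c h b g"
  unfolding pair_form_def by (simp add: power2_eq_square algebra_simps)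

text \<open>Bernstein expansion along a segment on which the first cut and its value move together.\<close>

lemma pair_form_bernstein:
  "pair_form D w ((1 - t) * b + t * b') ((1 - t) * g + t * g') c h
   = (1 - t)\<^sup>2 * pair_form D w b g c h
     + t * (1 - t) * (4 * pair_form D w ((b + b') / 2) ((g + g') / 2) c h
         - pair_form D w b g c h - pair_form D w b' g' c h)
     + t\<^sup>2 * pair_form D w b' g' c h"
  unfolding pair_form_def by (simp add: power2_eq_square field_simps)

lemma pair_form_bernstein':
  "pair_form D w b g ((1 - t) * c + t * c') ((1 - t) * h + t * h')
   = (1 - t)\<^sup>2 * pair_form D w b g c h
     + t * (1 - t) * (4 * pair_form D w b g ((c + c') / 2) ((h + h') / 2)
         - pair_form D w b g c h - pair_form D w b g c' h')
     + t\<^sup>2 * pair_form D w b g c' h'"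
  using pair_form_bernstein[of D w t c c' h h' b g] by (simp only: pair_form_swap[of D w _ _ b g])

text \<open>Hence \<open>G\<close> may be replaced by an upper bound.\<close>

lemma pair_form_decreasing:
  assumes "g \<le> g'" "2 * h \<le> g + g' + 2 * (c + D)"
  shows "pair_form D w b g' c h \<le> pair_form D w b g c h"
proof -
  have "pair_form D w b g c h - pair_form D w b g' c h = 2 * (g' - g) * (g + g' - 2 * h + 2 * (c + D))"
    unfolding pair_form_def by (simp add: power2_eq_square algebra_simps)
  also have "\<dots> \<ge> 0" using assms by (intro mult_nonneg_nonneg) auto
  finally show ?thesis by simp
qed

lemma pair_val_real:
  "real_of_int (pair_val b g c h) = 10 ^ 16 * pair_form 0.14931651 0.079794589
     (real_of_int b / 10 ^ 8) (real_of_int g / 10 ^ 8) (real_of_int c / 10 ^ 8) (real_of_int h / 10 ^ 8)"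
  unfolding pair_val_def pair_form_def by (simp add: power2_eq_square field_simps)

lemma pair_box_sound:
  assumes box: "pair_box (b, g) (b', g') (c, h) (c', h')"
    and even: "even b" "even b'" "even g" "even g'" "even c" "even c'" "even h" "even h'"
    and t: "0 \<le> t" "t \<le> 1" and s: "0 \<le> s" "s \<le> 1"
  shows "0 \<le> pair_form 0.14931651 0.079794589
     ((1 - t) * (real_of_int b / 10 ^ 8) + t * (real_of_int b' / 10 ^ 8))
     ((1 - t) * (real_of_int g / 10 ^ 8) + t * (real_of_int g' / 10 ^ 8))
     ((1 - s) * (real_of_int c / 10 ^ 8) + s * (real_of_int c' / 10 ^ 8))
     ((1 - s) * (real_of_int h / 10 ^ 8) + s * (real_of_int h' / 10 ^ 8))"
proof -
  define F where "F b g c h = pair_form 0.14931651 0.079794589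
     (b / 10 ^ 8) (g / 10 ^ 8) (c / 10 ^ 8) (h / 10 ^ 8)" for b g c h
  define bm gm cm hm where "bm = (b + b') div 2" and "gm = (g + g') div 2" and "cm = (c + c') div 2" and "hm = (h + h') div 2"
  have mid: "real_of_int bm = (real_of_int b + real_of_int b') / 2" "real_of_int gm = (real_of_int g + real_of_int g') / 2"
    "real_of_int cm = (real_of_int c + real_of_int c') / 2" "real_of_int hm = (real_of_int h + real_of_int h') / 2"
    using even by (auto simp: bm_def gm_def cm_def hm_def elim!: evenE)
  define f00 f02 f20 f22 where "f00 = pair_val b g c h" and "f02 = pair_val b g c' h'"
    and "f20 = pair_val b' g' c h" and "f22 = pair_val b' g' c' h'"
  define f10 f12 f01 f21 f11 where "f10 = pair_val bm gm c h" and "f12 = pair_val bm gm c' h'"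
    and "f01 = pair_val b g cm hm" and "f21 = pair_val b' g' cm hm" and "f11 = pair_val bm gm cm hm"
  have chk: "0 \<le> f00" "0 \<le> f02" "0 \<le> f20" "0 \<le> f22"
    "0 \<le> 4 * f10 - f00 - f20" "0 \<le> 4 * f12 - f02 - f22" "0 \<le> 4 * f01 - f00 - f02" "0 \<le> 4 * f21 - f20 - f22"
    "0 \<le> 16 * f11 - 4 * (f01 + f21 + f10 + f12) + f00 + f02 + f20 + f22"
  proof -
    have if_False_then: "(if A then False else B) \<longleftrightarrow> \<not> A \<and> B" for A B by simp
    \<comment> \<open>The nested conditionals of the checker are turned into conjunctions.\<close>
    note box' = box[unfolded pair_box_def prod.case Let_def if_False_then not_less, folded bm_def gm_def cm_def hm_def,
        folded f00_def f02_def f20_def f22_def f10_def f12_def f01_def f21_def f11_def]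
    then show "0 \<le> f00" "0 \<le> f02" "0 \<le> f20" "0 \<le> f22"
      "0 \<le> 4 * f10 - f00 - f20" "0 \<le> 4 * f12 - f02 - f22" "0 \<le> 4 * f01 - f00 - f02" "0 \<le> 4 * f21 - f20 - f22"
      "0 \<le> 16 * f11 - 4 * (f01 + f21 + f10 + f12) + f00 + f02 + f20 + f22"
      by linarith+
  qed
  have val: "real_of_int (pair_val u v x y) = 10 ^ 16 * F (real_of_int u) (real_of_int v) (real_of_int x) (real_of_int y)"
    for u v x y unfolding F_def by (rule pair_val_real)
  let ?r = real_of_int
  have pos: "0 \<le> F (?r b) (?r g) (?r c) (?r h)" "0 \<le> F (?r b) (?r g) (?r c') (?r h')"
    "0 \<le> F (?r b') (?r g') (?r c) (?r h)" "0 \<le> F (?r b') (?r g') (?r c') (?r h')"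
    "0 \<le> 4 * F (?r bm) (?r gm) (?r c) (?r h) - F (?r b) (?r g) (?r c) (?r h) - F (?r b') (?r g') (?r c) (?r h)"
    "0 \<le> 4 * F (?r bm) (?r gm) (?r c') (?r h') - F (?r b) (?r g) (?r c') (?r h') - F (?r b') (?r g') (?r c') (?r h')"
    "0 \<le> 4 * F (?r b) (?r g) (?r cm) (?r hm) - F (?r b) (?r g) (?r c) (?r h) - F (?r b) (?r g) (?r c') (?r h')"
    "0 \<le> 4 * F (?r b') (?r g') (?r cm) (?r hm) - F (?r b') (?r g') (?r c) (?r h) - F (?r b') (?r g') (?r c') (?r h')"
    "0 \<le> 16 * F (?r bm) (?r gm) (?r cm) (?r hm)
       - 4 * (F (?r b) (?r g) (?r cm) (?r hm) + F (?r b') (?r g') (?r cm) (?r hm)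
            + F (?r bm) (?r gm) (?r c) (?r h) + F (?r bm) (?r gm) (?r c') (?r h'))
       + F (?r b) (?r g) (?r c) (?r h) + F (?r b) (?r g) (?r c') (?r h')
       + F (?r b') (?r g') (?r c) (?r h) + F (?r b') (?r g') (?r c') (?r h')"
    using chk[THEN of_int_0_le_iff[where 'a = real, THEN iffD2]]
    unfolding f00_def f02_def f20_def f22_def f10_def f12_def f01_def f21_def f11_def
      of_int_add of_int_diff of_int_mult val
    by auto
  define x y where "x = (1 - s) * ?r c + s * ?r c'" and "y = (1 - s) * ?r h + s * ?r h'"
  have scale: "(1 - u) * (?r m / 10 ^ 8) + u * (?r n / 10 ^ 8) = ((1 - u) * ?r m + u * ?r n) / 10 ^ 8" for u m n
    by (simp add: add_divide_distrib)
  have inner: "F u v x y = (1 - s)\<^sup>2 * F u v (?r c) (?r h)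
      + s * (1 - s) * (4 * F u v (?r cm) (?r hm) - F u v (?r c) (?r h) - F u v (?r c') (?r h'))
      + s\<^sup>2 * F u v (?r c') (?r h')" for u v
    using pair_form_bernstein'[of "0.14931651" "0.079794589" "u / 10 ^ 8" "v / 10 ^ 8" s
        "?r c / 10 ^ 8" "?r c' / 10 ^ 8" "?r h / 10 ^ 8" "?r h' / 10 ^ 8"]
    unfolding F_def x_def y_def mid scale[symmetric] by (simp add: add_divide_distrib)
  have outer: "F ((1 - t) * ?r b + t * ?r b') ((1 - t) * ?r g + t * ?r g') x y
      = (1 - t)\<^sup>2 * F (?r b) (?r g) x y
      + t * (1 - t) * (4 * F (?r bm) (?r gm) x y - F (?r b) (?r g) x y - F (?r b') (?r g') x y)
      + t\<^sup>2 * F (?r b') (?r g') x y"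
    using pair_form_bernstein[of "0.14931651" "0.079794589" t
        "?r b / 10 ^ 8" "?r b' / 10 ^ 8" "?r g / 10 ^ 8" "?r g' / 10 ^ 8" "x / 10 ^ 8" "y / 10 ^ 8"]
    unfolding F_def mid scale[symmetric] by (simp add: add_divide_distrib)
  have "0 \<le> F (?r b) (?r g) x y" "0 \<le> F (?r b') (?r g') x y"
    unfolding inner using pos s by (auto intro!: add_nonneg_nonneg mult_nonneg_nonneg)
  moreover have "0 \<le> 4 * F (?r bm) (?r gm) x y - F (?r b) (?r g) x y - F (?r b') (?r g') x y"
  proof -
    have "4 * F (?r bm) (?r gm) x y - F (?r b) (?r g) x y - F (?r b') (?r g') x y
      = (1 - s)\<^sup>2 * (4 * F (?r bm) (?r gm) (?r c) (?r h) - F (?r b) (?r g) (?r c) (?r h) - F (?r b') (?r g') (?r c) (?r h))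
      + s * (1 - s) * (16 * F (?r bm) (?r gm) (?r cm) (?r hm)
       - 4 * (F (?r b) (?r g) (?r cm) (?r hm) + F (?r b') (?r g') (?r cm) (?r hm)
            + F (?r bm) (?r gm) (?r c) (?r h) + F (?r bm) (?r gm) (?r c') (?r h'))
       + F (?r b) (?r g) (?r c) (?r h) + F (?r b) (?r g) (?r c') (?r h')
       + F (?r b') (?r g') (?r c) (?r h) + F (?r b') (?r g') (?r c') (?r h'))
      + s\<^sup>2 * (4 * F (?r bm) (?r gm) (?r c') (?r h') - F (?r b) (?r g) (?r c') (?r h') - F (?r b') (?r g') (?r c') (?r h'))"
      unfolding inner by (simp add: algebra_simps)
    also have "\<dots> \<ge> 0"
    proof -
      have s': "0 \<le> (1 - s)\<^sup>2" "0 \<le> s * (1 - s)" "0 \<le> s\<^sup>2" using s by auto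
      show ?thesis
        using mult_nonneg_nonneg[OF s'(1) pos(5)] mult_nonneg_nonneg[OF s'(2) pos(9)]
          mult_nonneg_nonneg[OF s'(3) pos(6)] by linarith
    qed
    finally show ?thesis .
  qed
  ultimately have "0 \<le> F ((1 - t) * ?r b + t * ?r b') ((1 - t) * ?r g + t * ?r g') x y"
    unfolding outer using t by (intro add_nonneg_nonneg mult_nonneg_nonneg) auto
  then show ?thesis unfolding F_def x_def y_def scale .
qed

lemma pair_nodes_le: "\<forall>x\<in>set pair_nodes. 0 \<le> fst x \<and> fst x \<le> 100000000 \<and> snd x \<le> fst x"
  by (simp add: pair_nodes_def)

lemma segment_parameter:
  fixes p q a :: real
  assumes "p \<le> a" "a \<le> q"
  shows "\<exists>t. 0 \<le> t \<and> t \<le> 1 \<and> a = (1 - t) * p + t * q"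
proof (cases "p = q")
  case True
  then show ?thesis using assms by (intro exI[of _ 0]) auto
next
  case False
  then have "p < q" using assms by simp
  define t where "t = (a - p) / (q - p)"
  have "t * (q - p) = a - p" using \<open>p < q\<close> by (simp add: t_def)
  then have "a = (1 - t) * p + t * q" by (simp add: algebra_simps)
  moreover have "0 \<le> t" "t \<le> 1" using assms \<open>p < q\<close> by (auto simp: t_def)
  ultimately show ?thesis by blast
qed

context critical_parameter
begin

definition pair_excess :: "real \<Rightarrow> real \<Rightarrow> real" where
  "pair_excess b c = pair_form D (V * (1 - r\<^sup>2)) b (G b) c (G c)"

text \<open>The numerical form used in the computation lies below the true one.\<close>

lemma pair_form_approx:
  assumes "0 \<le> b" "b \<le> 1" "0 \<le> c" "c \<le> 1" "0 \<le> g" "g \<le> 1" "0 \<le> h" "h \<le> 1"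
  shows "pair_form 0.14931651 0.079794589 b g c h \<le> pair_form D (V * (1 - r\<^sup>2)) b g c h"
proof -
  define e where "e = D - 0.14931651"
  have e: "\<bar>e\<bar> \<le> 1 / 10 ^ 10" using D_approx by (simp add: e_def)
  have w: "0.0797946 \<le> V * (1 - r\<^sup>2)"
  proof -
    have "0.0984220593 * 0.810739179 \<le> V * (1 - r\<^sup>2)"
      using V_approx q_approx by (intro mult_mono) auto
    then show ?thesis by simp
  qed
  let ?m = "4 * (b + c) + 2 * e + 4 * 0.14931651 - 2 - 4 * (g + h)"
  have "pair_form D (V * (1 - r\<^sup>2)) b g c h - pair_form 0.14931651 0.079794589 b g c h
     = e * ?m + (V * (1 - r\<^sup>2) - 0.079794589)"
    unfolding pair_form_def e_def by (simp add: power2_eq_square field_simps)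
  moreover have "\<bar>e * ?m\<bar> \<le> 1 / 10 ^ 10 * 20"
    unfolding abs_mult using assms e by (intro mult_mono) auto
  then have "- (1 / 10 ^ 8) \<le> e * ?m" by simp
  ultimately show ?thesis using w by simp
qed

text \<open>On the gap between the first two quarters \<open>G\<close> is affine, and the form becomes a sum of two
  squares and a constant. The constant is a multiple of \<open>crit r\<close>: this is where the defining equation of the
  critical parameter enters.\<close>

lemma pair_excess_tie:
  assumes "0.18927 \<le> b" "b \<le> 0.24577" "0.18927 \<le> c" "c \<le> 0.24577"
  shows "0 \<le> pair_excess b c"
proof -
  define e where "e = r\<^sup>2 / 2"
  have gap: "G x = (x - e) / 4" if "0.18927 \<le> x" "x \<le> 0.24577" for x
  proof -
    have x: "r * r \<le> x" "x \<le> r * (1 - r)" 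
      using that q_approx r_approx by (auto simp: power2_eq_square algebra_simps)
    have "G (r * (x / r)) = r / 2 * G (x / r)"
      using that r_pos r_less by (intro G_mult_r) (auto simp: algebra_simps)
    also have "G (x / r) = (x / r - r / 2) / 2"
      using x r_pos by (intro G_gap) (auto simp: pos_le_divide_eq pos_divide_le_eq mult.commute)
    finally have "G x = r / 2 * ((x / r - r / 2) / 2)" using r_pos by simp
    also have "\<dots> = (x - e) / 4"
      using r_pos by (simp add: e_def power2_eq_square right_diff_distrib diff_divide_distrib)
    finally show ?thesis .
  qed
  let ?w = "V * (1 - r\<^sup>2)"
  let ?K = "6 * (2 * (D - 1/2)\<^sup>2 + 2 * D * e + ?w) - (3 * D - 2 + e)\<^sup>2"
  have Dr: "D * r = 1/2 - r" using r_pos by (simp add: D_def)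
  have "4 * (r\<^sup>2 * (1 + r) * ?K)
      = 4 * ((1 + r) * (12 * (D * r - r / 2)\<^sup>2 + 12 * (D * r) * e * r - (3 * (D * r) - 2 * r + e * r)\<^sup>2))
        + 6 * (4 * V * (1 + r)) * (1 - r\<^sup>2) * r\<^sup>2"
    by (simp add: power2_eq_square algebra_simps)
  also have "\<dots> = crit r"
    unfolding Dr V_mult e_def crit_def by (simp add: power2_eq_square power_numeral_reduce field_simps)
  finally have "r\<^sup>2 * (1 + r) * ?K = 0" using crit_zero by simp
  then have K: "?K = 0" using r_pos by auto
  have "pair_excess b c = 3 / 2 * (b + c + (3 * D - 2 + e) / 3)\<^sup>2 + 3 / 8 * (b - c)\<^sup>2 + ?K / 6"
    unfolding pair_excess_def pair_form_def gap[OF assms(1,2)] gap[OF assms(3,4)]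
    by (simp add: power2_eq_square field_simps)
  then show ?thesis unfolding K by simp
qed

text \<open>On a box the two values of \<open>G\<close> are replaced by chords one after the other.\<close>

lemma pair_box_excess:
  assumes box: "pair_box u v y z" and nodes: "{u, v, y, z} \<subseteq> set pair_nodes"
    and b: "real_of_int (fst u) \<le> 10 ^ 8 * b" "10 ^ 8 * b \<le> real_of_int (fst v)"
    and c: "real_of_int (fst y) \<le> 10 ^ 8 * c" "10 ^ 8 * c \<le> real_of_int (fst z)"
  shows "0 \<le> pair_excess b c"
proof -
  have node: "even (fst x)" "even (snd x)" "G (real_of_int (fst x) / 10 ^ 8) \<le> real_of_int (snd x) / 10 ^ 8"
    "0 \<le> real_of_int (fst x) / 10 ^ 8" "real_of_int (fst x) / 10 ^ 8 \<le> 1"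
    "real_of_int (snd x) / 10 ^ 8 \<le> real_of_int (fst x) / 10 ^ 8"
    if "x \<in> {u, v, y, z}" for x
  proof -
    have x: "x \<in> set pair_nodes" using that nodes by auto
    show "even (fst x)" "even (snd x)" using pair_nodes_check x by auto
    have "real_of_int (G_upper 14 (fst x)) \<le> real_of_int (snd x)"
      using pair_nodes_check x by auto
    then show "G (real_of_int (fst x) / 10 ^ 8) \<le> real_of_int (snd x) / 10 ^ 8"
      using G_upper_sound[of "fst x" 14] by simp
    show "0 \<le> real_of_int (fst x) / 10 ^ 8" "real_of_int (fst x) / 10 ^ 8 \<le> 1"
      "real_of_int (snd x) / 10 ^ 8 \<le> real_of_int (fst x) / 10 ^ 8"
      using pair_nodes_le x by auto
  qed
  have seg: "\<exists>t. 0 \<le> t \<and> t \<le> 1 \<and> a = (1 - t) * (real_of_int (fst x) / 10 ^ 8) + t * (real_of_int (fst x') / 10 ^ 8)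
      \<and> G a \<le> (1 - t) * (real_of_int (snd x) / 10 ^ 8) + t * (real_of_int (snd x') / 10 ^ 8)
      \<and> (1 - t) * (real_of_int (snd x) / 10 ^ 8) + t * (real_of_int (snd x') / 10 ^ 8) \<le> a \<and> 0 \<le> a \<and> a \<le> 1"
    if x: "x \<in> {u, v, y, z}" "x' \<in> {u, v, y, z}"
      and a: "real_of_int (fst x) \<le> 10 ^ 8 * a" "10 ^ 8 * a \<le> real_of_int (fst x')" for a x x'
  proof -
    let ?p = "real_of_int (fst x) / 10 ^ 8" and ?p' = "real_of_int (fst x') / 10 ^ 8"
    have a': "?p \<le> a" "a \<le> ?p'" using a by auto
    obtain t where t: "0 \<le> t" "t \<le> 1" "a = (1 - t) * ?p + t * ?p'"
      using segment_parameter[OF a'] by blast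
    have "G a \<le> (1 - t) * G ?p + t * G ?p'" unfolding t(3) by (rule G_convex) fact+
    also have "\<dots> \<le> (1 - t) * (real_of_int (snd x) / 10 ^ 8) + t * (real_of_int (snd x') / 10 ^ 8)"
      using t node(3) x by (intro add_mono mult_left_mono) auto
    finally have "G a \<le> (1 - t) * (real_of_int (snd x) / 10 ^ 8) + t * (real_of_int (snd x') / 10 ^ 8)" .
    moreover have "(1 - t) * (real_of_int (snd x) / 10 ^ 8) + t * (real_of_int (snd x') / 10 ^ 8) \<le> a"
      unfolding t(3) using t node(6) x by (intro add_mono mult_left_mono) auto
    moreover have "0 \<le> a" "a \<le> 1" using a' node(4)[OF x(1)] node(5)[OF x(2)] by auto
    ultimately show ?thesis using t by blast
  qed
  obtain t where t: "0 \<le> t" "t \<le> 1" "b = (1 - t) * (real_of_int (fst u) / 10 ^ 8) + t * (real_of_int (fst v) / 10 ^ 8)"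
    and g: "G b \<le> (1 - t) * (real_of_int (snd u) / 10 ^ 8) + t * (real_of_int (snd v) / 10 ^ 8)"
      "(1 - t) * (real_of_int (snd u) / 10 ^ 8) + t * (real_of_int (snd v) / 10 ^ 8) \<le> b" "0 \<le> b" "b \<le> 1"
    using seg[OF _ _ b] by auto
  obtain s where s: "0 \<le> s" "s \<le> 1" "c = (1 - s) * (real_of_int (fst y) / 10 ^ 8) + s * (real_of_int (fst z) / 10 ^ 8)"
    and h: "G c \<le> (1 - s) * (real_of_int (snd y) / 10 ^ 8) + s * (real_of_int (snd z) / 10 ^ 8)"
      "(1 - s) * (real_of_int (snd y) / 10 ^ 8) + s * (real_of_int (snd z) / 10 ^ 8) \<le> c" "0 \<le> c" "c \<le> 1"
    using seg[OF _ _ c] by auto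
  define g' h' where "g' = (1 - t) * (real_of_int (snd u) / 10 ^ 8) + t * (real_of_int (snd v) / 10 ^ 8)"
    and "h' = (1 - s) * (real_of_int (snd y) / 10 ^ 8) + s * (real_of_int (snd z) / 10 ^ 8)"
  have G0: "0 \<le> G b" "0 \<le> G c" by (rule G_nonneg)+
  have D0: "0 \<le> D" using r_pos r_less by (simp add: D_def)
  let ?w = "V * (1 - r\<^sup>2)"
  obtain bb gg bb' gg' cc hh cc' hh' where uv: "u = (bb, gg)" "v = (bb', gg')" "y = (cc, hh)" "z = (cc', hh')"
    by (metis surj_pair)
  have even: "even bb" "even bb'" "even gg" "even gg'" "even cc" "even cc'" "even hh" "even hh'"
    using node(1,2)[of u] node(1,2)[of v] node(1,2)[of y] node(1,2)[of z] by (simp_all add: uv)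
  have "0 \<le> pair_form 0.14931651 0.079794589 b g' c h'"
    unfolding t(3) s(3) g'_def h'_def
    using pair_box_sound[OF box[unfolded uv] even t(1,2) s(1,2)] unfolding uv by simp
  also have "\<dots> \<le> pair_form D ?w b g' c h'"
    using g h G0 by (intro pair_form_approx) (auto simp: g'_def h'_def)
  also have "\<dots> = pair_form D ?w c h' b g'" by (rule pair_form_swap)
  also have "\<dots> \<le> pair_form D ?w c (G c) b g'"
    using g h G0 D0 by (intro pair_form_decreasing) (auto simp: g'_def h'_def)
  also have "\<dots> = pair_form D ?w b g' c (G c)" by (rule pair_form_swap)
  also have "\<dots> \<le> pair_form D ?w b (G b) c (G c)"
    using g h G0 D0 by (intro pair_form_decreasing) (auto simp: g'_def h'_def)
  finally show ?thesis unfolding pair_excess_def .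
qed

lemma pair_check_sound:
  assumes "pair_check n xs ys" "xs \<noteq> []" "ys \<noteq> []" "set xs \<subseteq> set pair_nodes" "set ys \<subseteq> set pair_nodes"
    "real_of_int (fst (hd xs)) \<le> 10 ^ 8 * b" "10 ^ 8 * b \<le> real_of_int (fst (last xs))"
    "real_of_int (fst (hd ys)) \<le> 10 ^ 8 * c" "10 ^ 8 * c \<le> real_of_int (fst (last ys))" "b \<le> c"
  shows "0 \<le> pair_excess b c"
  using assms
proof (induction n arbitrary: xs ys)
  case (Suc n)
  have half: "\<exists>zs\<in>{take (Suc k) ws, drop k ws}. zs \<noteq> [] \<and> set zs \<subseteq> set pair_nodes
      \<and> real_of_int (fst (hd zs)) \<le> 10 ^ 8 * a \<and> 10 ^ 8 * a \<le> real_of_int (fst (last zs))"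
    if "ws \<noteq> []" "set ws \<subseteq> set pair_nodes" "k = length ws div 2"
      "real_of_int (fst (hd ws)) \<le> 10 ^ 8 * a" "10 ^ 8 * a \<le> real_of_int (fst (last ws))" for ws k a
  proof -
    have k: "k < length ws" using that by (cases ws) auto
    have "last (take (Suc k) ws) = ws ! k" "hd (drop k ws) = ws ! k"
      using k by (simp_all add: take_Suc_conv_app_nth hd_drop_conv_nth)
    moreover have "hd (take (Suc k) ws) = hd ws" "last (drop k ws) = last ws"
      using k that(1) by (simp_all add: hd_take)
    moreover have "take (Suc k) ws \<noteq> []" "drop k ws \<noteq> []" using k that(1) by auto
    ultimately show ?thesis
      using that set_take_subset[of "Suc k" ws] set_drop_subset[of k ws]
      by (cases "10 ^ 8 * a \<le> real_of_int (fst (ws ! k))") (auto intro: order_trans)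
  qed
  have order: "\<not> fst (last ys) < fst (hd xs)"
  proof
    assume "fst (last ys) < fst (hd xs)"
    then have "real_of_int (fst (last ys)) < real_of_int (fst (hd xs))" by (rule of_int_less_iff[THEN iffD2])
    moreover have "10 ^ 8 * b \<le> 10 ^ 8 * c" using Suc.prems(10) by simp
    ultimately show False using Suc.prems(6,9) by linarith
  qed
  consider (tie) "18927000 \<le> fst (hd xs)" "fst (last xs) \<le> 24577000" "18927000 \<le> fst (hd ys)" "fst (last ys) \<le> 24577000"
    | (box) "pair_box (hd xs) (last xs) (hd ys) (last ys)"
    | (ys) "pair_check n xs (take (Suc (length ys div 2)) ys)" "pair_check n xs (drop (length ys div 2) ys)"
    | (xs) "pair_check n (take (Suc (length xs div 2)) xs) ys" "pair_check n (drop (length xs div 2) xs) ys"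
    using Suc.prems(1) order by (auto simp: Let_def split: if_splits)
  then show ?case
  proof cases
    case tie
    then have "18927000 \<le> real_of_int (fst (hd xs))" "real_of_int (fst (last xs)) \<le> 24577000"
      "18927000 \<le> real_of_int (fst (hd ys))" "real_of_int (fst (last ys)) \<le> 24577000" by simp_all
    then show ?thesis using Suc.prems(6-9) by (intro pair_excess_tie) auto
  next
    case box
    then show ?thesis
      by (rule pair_box_excess) (use Suc.prems in auto)
  next
    case ys
    then show ?thesis using half[OF Suc.prems(3,5) refl Suc.prems(8,9)] Suc.prems Suc.IH by blast
  next
    case xs
    then show ?thesis using half[OF Suc.prems(2,4) refl Suc.prems(6,7)] Suc.prems Suc.IH by blast
  qed
qed simp

lemma pair_excess_nonneg:
  assumes "0 \<le> b" "b \<le> 1" "0 \<le> c" "c \<le> 1"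
  shows "0 \<le> pair_excess b c"
proof -
  have *: "0 \<le> pair_excess b c" if "0 \<le> b" "b \<le> 1" "0 \<le> c" "c \<le> 1" "b \<le> c" for b c
  proof -
    have "hd pair_nodes = (0, 0)" "fst (last pair_nodes) = 100000000" "pair_nodes \<noteq> []"
      by (simp_all add: pair_nodes_def)
    then show ?thesis using that by (intro pair_check_sound[OF pair_check_nodes]) auto
  qed
  show ?thesis
  proof (cases "b \<le> c")
    case True
    then show ?thesis using * assms by blast
  next
    case False
    then have "0 \<le> pair_excess c b" using * assms by simp
    then show ?thesis unfolding pair_excess_def by (subst pair_form_swap)
  qed
qed

text \<open>This is the case of three points, rescaled: one point serves both halves, and each half has one
  further point. The bound is attained by the two halves of the codebook \<open>rival\<close>.\<close>

lemma err_two_pairs: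
  assumes d: "d1 + d2 = 2 * D"
    and c: "\<bar>d1\<bar> \<le> c1" "c1 - d1 \<le> 2" "\<bar>d2\<bar> \<le> c2" "c2 - d2 \<le> 2"
  shows "V * (1 + r\<^sup>2) \<le> err {- d1, c1} + err {- d2, c2}"
proof -
  define b1 b2 where "b1 = (c1 - d1) / 2" and "b2 = (c2 - d2) / 2"
  define s where "s = D - d1"
  have s: "d1 = D - s" "d2 = D + s" and cb: "c1 = 2 * b1 + d1" "c2 = 2 * b2 + d2"
    using d by (simp_all add: s_def b1_def b2_def field_simps)
  have lower_val: "lower_val (- x) [y] \<le> err {- x, y}" if "\<bar>x\<bar> \<le> y" for x y
    using err_ge_lower_val[of "- x" "[y]"] that by simp
  have lower_val_eq: "lower_val (- d1) [c1] = V + (c1 - 1/2)\<^sup>2 - 2 * (c1 + d1) * G b1"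
    "lower_val (- d2) [c2] = V + (c2 - 1/2)\<^sup>2 - 2 * (c2 + d2) * G b2"
    by (simp_all add: b1_def b2_def)
  have "lower_val (- d1) [c1] + lower_val (- d2) [c2]
      = V * (1 + r\<^sup>2) + pair_excess b1 b2 + 2 * (s + (b2 - b1) + (G b1 - G b2))\<^sup>2"
    unfolding lower_val_eq pair_excess_def pair_form_def cb s by (simp add: power2_eq_square field_simps)
  moreover have "0 \<le> pair_excess b1 b2"
    using c by (intro pair_excess_nonneg) (auto simp: b1_def b2_def)
  ultimately have "V * (1 + r\<^sup>2) \<le> lower_val (- d1) [c1] + lower_val (- d2) [c2]" by simp
  also have "\<dots> \<le> err {- d1, c1} + err {- d2, c2}" using c by (intro add_mono lower_val) auto
  finally show ?thesis .
qed

end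

section \<open>Crossing codebooks\<close>

context cantor_parameter
begin

text \<open>The pieces of level \<open>k\<close> other than the first one lie to the right of \<open>r ^ k\<close>.\<close>

lemma E_first_piece:
  assumes "continuous_on UNIV f" "\<And>x. r ^ k \<le> x \<Longrightarrow> x \<le> 1 \<Longrightarrow> 0 \<le> f x"
  shows "E (\<lambda>y. f (r ^ k * y)) / 2 ^ k \<le> E f"
  using assms
proof (induction k arbitrary: f)
  case (Suc k)
  have comp: "continuous_on UNIV (\<lambda>x. f (s * x + t))" for s t
    by (rule continuous_on_compose2[OF Suc.prems(1)]) (auto intro!: continuous_intros)
  have rk: "r ^ Suc k \<le> 1 - r"
  proof -
    have "r ^ Suc k \<le> r" using r_bounds by (simp add: mult_left_le power_le_one)
    then show ?thesis using r_less by simp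
  qed
  have "0 \<le> E (\<lambda>x. f (r * x + (1 - r)))"
  proof (rule E_nonneg[OF comp])
    fix x :: real assume "0 \<le> x" "x \<le> 1"
    then have "0 \<le> r * x" "r * x \<le> r" using r_bounds by (auto simp: mult_left_le)
    then show "0 \<le> f (r * x + (1 - r))" using rk by (intro Suc.prems(2)) auto
  qed
  moreover have "E (\<lambda>y. f (r * (r ^ k * y))) / 2 ^ k \<le> E (\<lambda>y. f (r * y))"
  proof (rule Suc.IH)
    show "continuous_on UNIV (\<lambda>y. f (r * y))" using comp[of r 0] by simp
    fix x assume x: "r ^ k \<le> x" "x \<le> 1"
    have "0 \<le> r ^ k" using r_bounds by simp
    then have "0 \<le> x" using x by linarith
    then have "r * r ^ k \<le> r * x" "r * x \<le> 1"
      using x r_bounds by (auto intro!: mult_left_mono mult_le_one)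
    then show "0 \<le> f (r * x)" by (intro Suc.prems(2)) auto
  qed
  ultimately show ?case
    using E_split[OF Suc.prems(1)] by (simp add: mult.assoc add_diff_eq)
qed simp

text \<open>Replace the outside point \<open>- d\<close> by the midpoint of the first piece of level \<open>k\<close>. Outside that piece the
  new codebook is at least as good. On the piece the old one pays at least the square of \<open>d - x\<close>, because none
  of its points lies between \<open>- d\<close> and \<open>d\<close>, whereas the new one pays at most the variance of the piece. Thus a
  bound \<open>v\<close> for codebooks with one more point is transferred and improved.\<close>

lemma err_insert_ge:
  assumes C: "finite C" "\<And>c. c \<in> C \<Longrightarrow> d \<le> c"
    and IH: "\<And>\<alpha>. finite \<alpha> \<Longrightarrow> \<alpha> \<noteq> {} \<Longrightarrow> card \<alpha> \<le> card C + 1 \<Longrightarrow> v \<le> err \<alpha>"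
  shows "v - r ^ (2 * k) * V / 2 ^ k + E (\<lambda>y. (max 0 (d - r ^ k * y))\<^sup>2) / 2 ^ k \<le> err (insert (- d) C)"
proof (cases "0 \<le> d")
  case False
  have "E (\<lambda>y. (max 0 (d - r ^ k * y))\<^sup>2) = E (\<lambda>_. 0)"
  proof (intro E_cong continuous_intros)
    fix x :: real assume "0 \<le> x"
    then have "0 \<le> r ^ k * x" using r_bounds by simp
    then show "(max 0 (d - r ^ k * x))\<^sup>2 = 0" using False by (simp add: max_def)
  qed
  moreover have "v \<le> err (insert (- d) C)"
    using C by (intro IH) (auto simp: card_insert_if)
  moreover have "0 \<le> r ^ (2 * k) * V / 2 ^ k" using r_bounds V_pos by simp
  ultimately show ?thesis by (simp add: E_const)
next
  case True
  define m where "m = r ^ k / 2"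
  let ?A = "insert (- d) C" and ?B = "insert m C"
  have fin: "finite ?A" "?A \<noteq> {}" "finite ?B" "?B \<noteq> {}" using C by auto
  have rk: "0 < r ^ k" using r_bounds by simp
  have B: "v \<le> err ?B" using C by (intro IH) (auto simp: card_insert_if)
  have "E (\<lambda>y. (sq_dist ?A (r ^ k * y) - sq_dist ?B (r ^ k * y))) / 2 ^ k \<le> E (\<lambda>x. sq_dist ?A x - sq_dist ?B x)"
  proof (rule E_first_piece)
    show "continuous_on UNIV (\<lambda>x. sq_dist ?A x - sq_dist ?B x)"
      by (intro continuous_on_diff continuous_on_sq_dist fin)
    fix x assume x: "r ^ k \<le> x" "x \<le> 1"
    have "sq_dist ?B x \<le> sq_dist ?A x"
    proof (rule sq_dist_geI)
      fix a assume "a \<in> ?A"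
      then show "sq_dist ?B x \<le> (x - a)\<^sup>2"
      proof
        assume a: "a = - d"
        have "sq_dist ?B x \<le> (x - m)\<^sup>2" using fin by (intro sq_dist_le) auto
        also have "\<dots> \<le> (x - a)\<^sup>2"
          using x rk True by (intro power_mono) (auto simp: m_def a)
        finally show ?thesis .
      qed (use fin in \<open>auto intro: sq_dist_le\<close>)
    qed (use fin in auto)
    then show "0 \<le> sq_dist ?A x - sq_dist ?B x" by simp
  qed
  also have "E (\<lambda>x. sq_dist ?A x - sq_dist ?B x) = err ?A - err ?B"
    unfolding err_def by (intro E_diff continuous_on_sq_dist fin)
  finally have diff: "E (\<lambda>y. sq_dist ?A (r ^ k * y) - sq_dist ?B (r ^ k * y)) / 2 ^ k \<le> err ?A - err ?B" .
  have "E (\<lambda>y. (max 0 (d - r ^ k * y))\<^sup>2 - (r ^ k * y + - m)\<^sup>2)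
      \<le> E (\<lambda>y. sq_dist ?A (r ^ k * y) - sq_dist ?B (r ^ k * y))"
  proof (intro E_mono continuous_intros fin)
    fix y :: real assume y: "0 \<le> y" "y \<le> 1"
    then have ry: "0 \<le> r ^ k * y" using rk by simp
    have "(max 0 (d - r ^ k * y))\<^sup>2 \<le> sq_dist ?A (r ^ k * y)"
    proof (rule sq_dist_geI)
      fix a assume "a \<in> ?A"
      then have "max 0 (d - r ^ k * y) \<le> \<bar>r ^ k * y - a\<bar>"
        using ry True C(2) by fastforce
      then show "(max 0 (d - r ^ k * y))\<^sup>2 \<le> (r ^ k * y - a)\<^sup>2"
        by (subst power2_abs[symmetric, of "r ^ k * y - a"]) (intro power_mono, auto)
    qed (use fin in auto)
    moreover have "sq_dist ?B (r ^ k * y) \<le> (r ^ k * y - m)\<^sup>2" using fin by (intro sq_dist_le) auto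
    ultimately show "(max 0 (d - r ^ k * y))\<^sup>2 - (r ^ k * y + - m)\<^sup>2 \<le> sq_dist ?A (r ^ k * y) - sq_dist ?B (r ^ k * y)"
      by simp
  qed
  also have "E (\<lambda>y. (max 0 (d - r ^ k * y))\<^sup>2 - (r ^ k * y + - m)\<^sup>2)
      = E (\<lambda>y. (max 0 (d - r ^ k * y))\<^sup>2) - E (\<lambda>y. (r ^ k * y + - m)\<^sup>2)"
    by (intro E_diff continuous_intros)
  also have "E (\<lambda>y. (r ^ k * y + - m)\<^sup>2) = r ^ (2 * k) * V"
    unfolding E_square_affine by (simp add: m_def power_mult power2_eq_square power_mult_distrib)
  finally have "(E (\<lambda>y. (max 0 (d - r ^ k * y))\<^sup>2) - r ^ (2 * k) * V) / 2 ^ k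
      \<le> E (\<lambda>y. sq_dist ?A (r ^ k * y) - sq_dist ?B (r ^ k * y)) / 2 ^ k"
    by (intro divide_right_mono) auto
  with diff B show ?thesis by (simp add: diff_divide_distrib)
qed

text \<open>The left half lies between \<open>- d\<close> and \<open>d\<close>, where there is no codepoint.\<close>

lemma err_far:
  assumes C: "finite C" "\<And>c. c \<in> C \<Longrightarrow> d \<le> c" and d: "r \<le> d"
  shows "(r\<^sup>2 * V + (d - r / 2)\<^sup>2) / 2 \<le> err (insert (- d) C)"
proof -
  let ?A = "insert (- d) C"
  have fin: "finite ?A" "?A \<noteq> {}" using C by auto
  have "E (\<lambda>y. sq_dist ?A (r ^ 1 * y)) / 2 ^ 1 \<le> E (sq_dist ?A)"
    by (rule E_first_piece) (intro continuous_on_sq_dist fin sq_dist_nonneg)+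
  moreover have "E (\<lambda>y. (r * y + - d)\<^sup>2) \<le> E (\<lambda>y. sq_dist ?A (r * y))"
  proof (intro E_mono continuous_intros fin)
    fix y :: real assume y: "0 \<le> y" "y \<le> 1"
    then have ry: "0 \<le> r * y" "r * y \<le> r" using r_bounds by (auto simp: mult_left_le)
    show "(r * y + - d)\<^sup>2 \<le> sq_dist ?A (r * y)"
    proof (rule sq_dist_geI)
      fix a assume "a \<in> ?A"
      then have "\<bar>r * y + - d\<bar> \<le> \<bar>r * y - a\<bar>" using ry d C(2) by fastforce
      then show "(r * y + - d)\<^sup>2 \<le> (r * y - a)\<^sup>2" by (simp add: abs_le_square_iff)
    qed (use fin in auto)
  qed
  moreover have "(r / 2 + - d)\<^sup>2 = (d - r / 2)\<^sup>2" by (simp add: power2_commute)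
  ultimately show ?thesis unfolding E_square_affine err_def by simp
qed

end

context critical_parameter
begin

abbreviation sv :: "nat \<Rightarrow> real" where "sv \<equiv> split_val (r\<^sup>2)"

lemma sv_values:
  "sv 1 = 1" "sv 2 = r\<^sup>2" "sv 3 = r\<^sup>2 * (1 + r\<^sup>2) / 2" "sv 4 = (r\<^sup>2)\<^sup>2"
  "sv 5 = (r\<^sup>2)\<^sup>2 * (3 + r\<^sup>2) / 4" "sv 6 = (r\<^sup>2)\<^sup>2 * (1 + r\<^sup>2) / 2"
proof -
  show 1: "sv 1 = 1" by simp
  show 2: "sv 2 = r\<^sup>2" using split_val_step[of 2 "r\<^sup>2"] by simp
  show 3: "sv 3 = r\<^sup>2 * (1 + r\<^sup>2) / 2" using split_val_step[of 3 "r\<^sup>2"] 2 by simp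
  show 4: "sv 4 = (r\<^sup>2)\<^sup>2" using split_val_step[of 4 "r\<^sup>2"] 2 by (simp add: power2_eq_square)
  show "sv 5 = (r\<^sup>2)\<^sup>2 * (3 + r\<^sup>2) / 4" 
  proof -
    have "sv 5 = r\<^sup>2 / 2 * (r\<^sup>2 + r\<^sup>2 * (1 + r\<^sup>2) / 2)" using split_val_step[of 5 "r\<^sup>2"] 2 3 by simp
    then show ?thesis by (simp add: power2_eq_square field_simps)
  qed
  show "sv 6 = (r\<^sup>2)\<^sup>2 * (1 + r\<^sup>2) / 2" using split_val_step[of 6 "r\<^sup>2"] 3 by (simp add: power2_eq_square field_simps)
qed

lemma D_bounds: "0.1493165 \<le> D" "D \<le> 0.1493166"
  using D_approx unfolding abs_le_iff by simp_all

text \<open>The sum of the two rescaled distortions that an even distribution of \<open>n\<close> points achieves, in units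
  of \<open>V\<close>. A crossing codebook has to be shown not to fall below it.\<close>

definition target :: "nat \<Rightarrow> real" where
  "target n = sv (n div 2) + sv (n - n div 2)"

lemma target_le: "1 \<le> p \<Longrightarrow> 1 \<le> m \<Longrightarrow> target (p + m) \<le> sv p + sv m"
  using split_val_add_ge[OF q_bounds, of p m] split_val_add_ge[OF q_bounds, of m p]
  by (cases "p \<le> m") (auto simp: target_def add.commute)

lemma sv_target: "2 \<le> n \<Longrightarrow> sv n = r\<^sup>2 / 2 * target n"
  unfolding target_def by (rule split_val_step)

lemma target_values:
  "target 3 = 1 + r\<^sup>2" "target 4 = 2 * r\<^sup>2" "target 5 = r\<^sup>2 + r\<^sup>2 * (1 + r\<^sup>2) / 2"
  "target 6 = r\<^sup>2 * (1 + r\<^sup>2)" "target 7 = r\<^sup>2 * (1 + r\<^sup>2) / 2 + (r\<^sup>2)\<^sup>2"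
  using sv_values by (simp_all add: target_def)

lemma target_le_2:
  assumes "2 \<le> n" shows "target n \<le> 2"
proof -
  have "1 \<le> n div 2" "1 \<le> n - n div 2" using assms by auto
  then show ?thesis
    using split_val_antimono[OF q_bounds, of 1 "n div 2"] split_val_antimono[OF q_bounds, of 1 "n - n div 2"]
    by (simp add: target_def)
qed

lemma q2_approx: "0.0358196 \<le> (r\<^sup>2)\<^sup>2" "(r\<^sup>2)\<^sup>2 \<le> 0.0358197"
proof -
  have "(0.189260820)\<^sup>2 \<le> (r\<^sup>2)\<^sup>2" "(r\<^sup>2)\<^sup>2 \<le> (0.189260821)\<^sup>2"
    using q_approx by (intro power_mono; simp)+
  then show "0.0358196 \<le> (r\<^sup>2)\<^sup>2" "(r\<^sup>2)\<^sup>2 \<le> 0.0358197" by (simp_all add: power2_eq_square)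
qed

lemma sv_approx:
  "0.112540 \<le> sv 3" "sv 3 \<le> 0.112541" "0.02855 \<le> sv 5" "0.02129 \<le> sv 6"
proof -
  have e: "r\<^sup>2 * (1 + r\<^sup>2) = r\<^sup>2 + (r\<^sup>2)\<^sup>2" by (simp add: power2_eq_square algebra_simps)
  show "0.112540 \<le> sv 3" "sv 3 \<le> 0.112541"
    unfolding sv_values e using q_approx q2_approx by simp_all
  have "0.0358196 * (3 + 0.18926) \<le> (r\<^sup>2)\<^sup>2 * (3 + r\<^sup>2)" "0.0358196 * (1 + 0.18926) \<le> (r\<^sup>2)\<^sup>2 * (1 + r\<^sup>2)"
    using q_approx q2_approx by (intro mult_mono; simp)+
  then show "0.02855 \<le> sv 5" "0.02129 \<le> sv 6" unfolding sv_values by simp_all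
qed

lemma target_approx: "target 4 \<le> 0.378522" "target 5 \<le> 0.301802" "target 6 \<le> 0.225081" "target 7 \<le> 0.148361"
proof -
  have e: "r\<^sup>2 * (1 + r\<^sup>2) = r\<^sup>2 + (r\<^sup>2)\<^sup>2" by (simp add: power2_eq_square algebra_simps)
  show "target 4 \<le> 0.378522" "target 5 \<le> 0.301802" "target 6 \<le> 0.225081" "target 7 \<le> 0.148361"
    unfolding target_values e using q_approx q2_approx by (simp_all add: field_simps)
qed

lemma target_approx': "target 6 - sv 5 \<le> 0.28" "target 7 - sv 6 \<le> 0.28" "target 5 - sv 4 \<le> 0.28" "target 4 - sv 3 \<le> 0.28"
  using target_approx sv_approx sv_values(4) q2_approx by simp_all

text \<open>One half is served by the shared point alone. If this point is close to that half, the other half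
  suffers (\<open>err_far\<close>); completing the square shows that the total is never below the distortion \<open>2 V\<close> of two
  points.\<close>

lemma crossing_empty:
  assumes d: "d1 + d2 = 2 * D" and C: "finite C" "\<And>c. c \<in> C \<Longrightarrow> d2 \<le> c"
  shows "2 * V \<le> err {- d1} + err (insert (- d2) C)"
proof (cases "r \<le> d2")
  case True
  define A where "A = - d1 - 1/2"
  define K where "K = 2 * D - r / 2 + 1/2"
  have "V + A\<^sup>2 + (r\<^sup>2 * V + (A + K)\<^sup>2) / 2 \<le> err {- d1} + err (insert (- d2) C)"
  proof -
    have "A + K = d2 - r / 2" using d by (simp add: A_def K_def)
    then show ?thesis using err_far[OF C True] by (simp add: err_singleton A_def)
  qed
  moreover have "A\<^sup>2 + (A + K)\<^sup>2 / 2 = 3 / 2 * (A + K / 3)\<^sup>2 + K\<^sup>2 / 3"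
    by (simp add: power2_eq_square field_simps)
  moreover have "0 \<le> 3 / 2 * (A + K / 3)\<^sup>2" by simp
  moreover have "0.58 \<le> K" using D_bounds r_approx by (simp add: K_def)
  then have "0.58\<^sup>2 \<le> K\<^sup>2" by (intro power_mono) auto
  then have "1/3 \<le> K\<^sup>2" by (simp add: power2_eq_square)
  moreover have "9/50 * V \<le> r\<^sup>2 * V" using q_approx V_pos by (intro mult_right_mono) auto
  moreover have "V \<le> 1/10" using V_approx by simp
  moreover have "2 * V \<le> R"
    if "V + a + (w + b) / 2 \<le> R" "a + b / 2 = s + k / 3" "0 \<le> s" "1/3 \<le> k" "9/50 * V \<le> w" "V \<le> 1/10"
    for a b w s k R using that by argo
  ultimately show ?thesis by blast
next
  case False
  then have "0.36 \<le> 1/2 + d1" using d D_bounds r_approx by simp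
  then have "0.36\<^sup>2 \<le> (1/2 + d1)\<^sup>2" by (intro power_mono) auto
  moreover have "(1/2 + d1)\<^sup>2 = (- d1 - 1/2)\<^sup>2" by (simp add: power2_eq_square algebra_simps)
  moreover have "0 \<le> err (insert (- d2) C)" using C by (intro err_nonneg) auto
  ultimately show ?thesis using V_approx by (simp add: err_singleton power2_eq_square)
qed

text \<open>If a codepoint is so far out that its cell is empty, the case of an empty side applies.\<close>

lemma crossing_three:
  assumes d: "d1 + d2 = 2 * D" and c: "\<bar>d1\<bar> \<le> c1" "\<bar>d2\<bar> \<le> c2"
  shows "V * target 3 \<le> err {- d1, c1} + err {- d2, c2}"
proof -
  have far: "err {- x} \<le> err {- x, y}" if "2 < y - x" "\<bar>x\<bar> \<le> y" for x y
    unfolding err_def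
  proof (intro E_mono continuous_on_sq_dist)
    fix t :: real assume t: "0 \<le> t" "t \<le> 1"
    have "(t + x)\<^sup>2 \<le> (t - y)\<^sup>2"
      unfolding abs_le_square_iff[symmetric] using that t by auto
    then show "sq_dist {- x} t \<le> sq_dist {- x, y} t" by (simp add: sq_dist_def)
  qed auto
  have two: "V * target 3 \<le> 2 * V" using target_le_2[of 3] V_pos by simp
  consider "2 < c1 - d1" | "2 < c2 - d2" | "c1 - d1 \<le> 2" "c2 - d2 \<le> 2" by linarith
  then show ?thesis
  proof cases
    case 1
    have "2 * V \<le> err {- d1} + err (insert (- d2) {c2})"
      by (rule crossing_empty) (use d c in auto)
    with far[OF 1 c(1)] two show ?thesis by simp
  next
    case 2
    have "2 * V \<le> err {- d2} + err (insert (- d1) {c1})"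
      by (rule crossing_empty) (use d c in auto)
    with far[OF 2 c(2)] two show ?thesis by simp
  next
    case 3
    then show ?thesis using err_two_pairs[OF d c(1) 3(1) c(2) 3(2)] target_values(1) by simp
  qed
qed

text \<open>Compare with codebooks of \<open>n + 1\<close> points in which each half has an additional point at the end that
  faces the gap. What the crossing codebook loses there, by convexity at least \<open>(D - r ^ 3 / 2)\<^sup>2 / 4\<close> in total,
  exceeds the value of one additional point once \<open>n \<ge> 8\<close>.\<close>

lemma crossing_many:
  assumes d: "d1 + d2 = 2 * D" and n: "n = card C1 + card C2 + 1" "8 \<le> n" "1 \<le> card C1" "1 \<le> card C2"
    and C1: "finite C1" "\<And>c. c \<in> C1 \<Longrightarrow> d1 \<le> c" and C2: "finite C2" "\<And>c. c \<in> C2 \<Longrightarrow> d2 \<le> c"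
    and IH: "\<And>m \<alpha>. m < n \<Longrightarrow> finite \<alpha> \<Longrightarrow> \<alpha> \<noteq> {} \<Longrightarrow> card \<alpha> \<le> m \<Longrightarrow> V * sv m \<le> err \<alpha>"
  shows "V * target n \<le> err (insert (- d1) C1) + err (insert (- d2) C2)"
proof -
  let ?p = "\<lambda>d. E (\<lambda>y. (max 0 (d - r ^ 3 * y))\<^sup>2)"
  have 1: "V * sv (card C1 + 1) - r ^ 6 * V / 8 + ?p d1 / 8 \<le> err (insert (- d1) C1)"
    using err_insert_ge[OF C1, of "V * sv (card C1 + 1)" 3] IH[of "card C1 + 1"] n by simp
  have 2: "V * sv (card C2 + 1) - r ^ 6 * V / 8 + ?p d2 / 8 \<le> err (insert (- d2) C2)"
    using err_insert_ge[OF C2, of "V * sv (card C2 + 1)" 3] IH[of "card C2 + 1"] n by simp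
  have r3: "r ^ 3 \<le> 0.0824"
  proof -
    have "r ^ 3 = r\<^sup>2 * r" by (simp add: power2_eq_square power3_eq_cube)
    also have "\<dots> \<le> 0.189260821 * 0.43505" using q_approx r_approx r_pos by (intro mult_mono) auto
    finally show ?thesis by simp
  qed
  have Dr: "0.1493 \<le> D" using D_bounds by simp
  have "2 * E (\<lambda>y. (r ^ 3 * y + - D)\<^sup>2) \<le> ?p d1 + ?p d2"
  proof -
    have "2 * E (\<lambda>y. (r ^ 3 * y + - D)\<^sup>2) = E (\<lambda>y. 2 * (r ^ 3 * y + - D)\<^sup>2)" by (rule E_cmult[symmetric])
    also have "\<dots> \<le> E (\<lambda>y. (max 0 (d1 - r ^ 3 * y))\<^sup>2 + (max 0 (d2 - r ^ 3 * y))\<^sup>2)"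
    proof (intro E_mono continuous_intros)
      fix y :: real assume y: "0 \<le> y" "y \<le> 1"
      let ?u = "max 0 (d1 - r ^ 3 * y)" and ?w = "max 0 (d2 - r ^ 3 * y)"
      have "r ^ 3 * y \<le> r ^ 3 * 1" using y r_bounds by (intro mult_left_mono) auto
      then have "0 \<le> 2 * (D - r ^ 3 * y)" using r3 Dr by simp
      moreover have "2 * (D - r ^ 3 * y) \<le> ?u + ?w" 
      proof -
        have "2 * (D - z) \<le> max 0 (d1 - z) + max 0 (d2 - z)" for z
          using d max.cobounded2[of "d1 - z" 0] max.cobounded2[of "d2 - z" 0] by argo
        then show ?thesis .
      qed
      ultimately have "(2 * (D - r ^ 3 * y))\<^sup>2 \<le> (?u + ?w)\<^sup>2" by (rule power_mono[rotated])
      moreover have "0 \<le> (?u - ?w)\<^sup>2" by simp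
      ultimately show "2 * (r ^ 3 * y + - D)\<^sup>2 \<le> ?u\<^sup>2 + ?w\<^sup>2"
        by (simp add: power2_eq_square algebra_simps)
    qed
    also have "\<dots> = ?p d1 + ?p d2" by (intro E_add continuous_intros)
    finally show ?thesis .
  qed
  then have p: "2 * (r ^ 6 * V + (D - r ^ 3 / 2)\<^sup>2) \<le> ?p d1 + ?p d2"
    unfolding E_square_affine by (simp add: power2_commute power_mult[symmetric])
  have gain: "V * (target n - target (Suc n)) \<le> (D - r ^ 3 / 2)\<^sup>2 / 4"
  proof -
    have "r\<^sup>2 / 2 * (target n - target (Suc n)) = drop_val (r\<^sup>2) n"
      using sv_target[of n] sv_target[of "Suc n"] n by (simp add: drop_val_def right_diff_distrib)
    also have "\<dots> \<le> drop_val (r\<^sup>2) 8" by (rule drop_val_antimono[OF q_bounds]) (use n in auto)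
    also have "\<dots> = r\<^sup>2 / 2 * (r\<^sup>2 / 2 * (r\<^sup>2 / 2 * (1 - r\<^sup>2)))"
      using drop_val_step[of 8 "r\<^sup>2"] drop_val_step[of 4 "r\<^sup>2"] drop_val_step[of 2 "r\<^sup>2"] drop_val_1[of "r\<^sup>2"] by simp
    finally have "target n - target (Suc n) \<le> r\<^sup>2 / 2 * (r\<^sup>2 / 2 * (1 - r\<^sup>2))"
      by (rule mult_left_le_imp_le) (use q_bounds in simp)
    also have "\<dots> \<le> 0.1 * (0.1 * 1)" using q_approx by (intro mult_mono) auto
    finally have "V * (target n - target (Suc n)) \<le> 0.0984220595 * 0.01"
      using V_approx V_pos by (intro order_trans[OF mult_left_mono mult_right_mono]) auto
    also have "\<dots> \<le> 0.108\<^sup>2 / 4" by (simp add: power2_eq_square)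
    also have "\<dots> \<le> (D - r ^ 3 / 2)\<^sup>2 / 4" using r3 Dr by (intro divide_right_mono power_mono) auto
    finally show ?thesis .
  qed
  have "target (Suc n) \<le> sv (card C1 + 1) + sv (card C2 + 1)"
    using target_le[of "card C1 + 1" "card C2 + 1"] n by simp
  then have "V * target (Suc n) \<le> V * sv (card C1 + 1) + V * sv (card C2 + 1)"
    using V_pos by (simp flip: distrib_left)
  with 1 2 p gain show ?thesis by (simp add: right_diff_distrib)
qed

text \<open>If the shared point is far from one half, at distance \<open>d2 \<ge> 0.26883\<close>, and that half has at least two further
  points, then it does not profit from the shared point: the argument of the preceding lemma with the first
  piece of level two shows that its distortion is not below the value for \<open>card C2\<close> points. Otherwise both distances are at least \<open>0.0298\<close>, the larger one is at
  least \<open>D\<close>, and the numerical bounds suffice.\<close>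

lemma crossing_few:
  assumes d: "d1 + d2 = 2 * D" "d1 \<le> d2"
    and n: "n = card C1 + card C2 + 1" "4 \<le> n" "n \<le> 7" "1 \<le> card C1" "1 \<le> card C2"
    and C1: "finite C1" "\<And>c. c \<in> C1 \<Longrightarrow> d1 \<le> c" and C2: "finite C2" "\<And>c. c \<in> C2 \<Longrightarrow> d2 \<le> c"
    and IH: "\<And>m \<alpha>. m < n \<Longrightarrow> finite \<alpha> \<Longrightarrow> \<alpha> \<noteq> {} \<Longrightarrow> card \<alpha> \<le> m \<Longrightarrow> V * sv m \<le> err \<alpha>"
  shows "V * target n \<le> err (insert (- d1) C1) + err (insert (- d2) C2)"
proof -
  let ?e1 = "err (insert (- d1) C1)" and ?e2 = "err (insert (- d2) C2)"
  have e1: "V * sv (card C1 + 1) \<le> ?e1" using C1 n by (intro IH) (auto simp: card_insert_if)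
  have e2: "V * sv (card C2 + 1) \<le> ?e2" using C2 n by (intro IH) (auto simp: card_insert_if)
  note Da = D_bounds
  have d2: "0.149 \<le> d2" using d Da by simp
  have scaled: "V * target n \<le> ?e1 + ?e2" if "x * V \<le> ?e1" "y * V \<le> ?e2" "target n \<le> x + y" for x y
  proof -
    have "V * target n \<le> V * (x + y)" using that V_pos by (intro mult_left_mono) auto
    then show ?thesis using that by (simp add: algebra_simps)
  qed
  have one: "V * target n \<le> ?e1 + ?e2"
    if i: "card C1 = 1 \<and> 0.28 * V \<le> ?e1 \<or> card C2 = 1 \<and> 0.28 * V \<le> ?e2"
  proof -
    \<comment> \<open>One half is worth at least \<open>0.28 V\<close>, the other one has all but one of the points.\<close>
    have "n = 4 \<or> n = 5 \<or> n = 6 \<or> n = 7" using n by auto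
    then have t: "target n \<le> 0.28 + sv (n - 1)" using target_approx' by auto
    from i show ?thesis
    proof
      assume "card C1 = 1 \<and> 0.28 * V \<le> ?e1"
      then show ?thesis using scaled[of "0.28" "sv (n - 1)"] e2 t n by (simp add: mult.commute)
    next
      assume "card C2 = 1 \<and> 0.28 * V \<le> ?e2"
      then show ?thesis using scaled[of "sv (n - 1)" "0.28"] e1 t n by (simp add: mult.commute)
    qed
  qed
  have two: "0.28 * V \<le> ?e2" if "card C2 = 1" using err_one_point[OF C2(1) that C2(2)] d2 by simp
  show ?thesis
  proof (cases "0.0298 \<le> d1")
    case True
    have "0.28 * V \<le> ?e1" if "card C1 = 1" using err_one_point[OF C1(1) that C1(2)] True by simp
    moreover have "i = 1 \<or> j = 1 \<or> i = 2 \<and> j = 2 \<or> i = 2 \<and> j = 3 \<or> i = 3 \<and> j = 2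
        \<or> i = 3 \<and> j = 3 \<or> i = 2 \<and> j = 4 \<or> i = 4 \<and> j = 2"
      if "1 \<le> i" "1 \<le> j" "i + j + 1 \<le> 7" for i j :: nat using that by presburger
    from this[of "card C1" "card C2"] have "card C1 = 1 \<or> card C2 = 1 \<or> card C1 = 2 \<and> card C2 = 2
        \<or> card C1 = 2 \<and> card C2 = 3 \<or> card C1 = 3 \<and> card C2 = 2
        \<or> card C1 = 3 \<and> card C2 = 3 \<or> card C1 = 2 \<and> card C2 = 4 \<or> card C1 = 4 \<and> card C2 = 2"
      using n by simp
    ultimately consider "card C1 = 1 \<and> 0.28 * V \<le> ?e1 \<or> card C2 = 1 \<and> 0.28 * V \<le> ?e2"
      | "card C1 = 2" "card C2 = 2" | "card C1 = 2" "card C2 = 3" | "card C1 = 3" "card C2 = 2"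
      | "card C1 = 3" "card C2 = 3" | "card C1 = 2" "card C2 = 4" | "card C1 = 4" "card C2 = 2"
      using two by blast
    then show ?thesis
    proof cases
      case 1
      then show ?thesis by (rule one)
    next
      case 2
      then show ?thesis
        using scaled[OF err_two_points(1)[OF C1(1) _ C1(2)] err_two_points(2)[OF C2(1) _ C2(2)]] True d2 n target_approx by simp
    next
      case 3
      then show ?thesis
        using scaled[OF err_two_points(1)[OF C1(1) _ C1(2)] err_three_points(2)[OF C2(1) _ C2(2)]] True d2 n target_approx by simp
    next
      case 4
      then show ?thesis
        using scaled[OF err_three_points(1)[OF C1(1) _ C1(2)] err_two_points(2)[OF C2(1) _ C2(2)]] True d2 n target_approx by simp
    next
      case 5
      then show ?thesis
        using scaled[OF err_three_points(1)[OF C1(1) _ C1(2)] err_three_points(2)[OF C2(1) _ C2(2)]] True d2 n target_approx by simp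
    next
      case 6
      then have "sv 5 * V \<le> ?e2" using e2 by (simp add: mult.commute)
      from 6 show ?thesis
        using scaled[OF err_two_points(1)[OF C1(1) _ C1(2)] \<open>sv 5 * V \<le> ?e2\<close>] True n target_approx sv_approx by simp
    next
      case 7
      then have "sv 5 * V \<le> ?e1" using e1 by (simp add: mult.commute)
      from 7 show ?thesis
        using scaled[OF \<open>sv 5 * V \<le> ?e1\<close> err_two_points(2)[OF C2(1) _ C2(2)]] d2 n target_approx sv_approx by simp
    qed
  next
    case False
    then have d2': "0.26883 \<le> d2" using d Da by simp
    show ?thesis
    proof (cases "card C2 = 1")
      case True
      then show ?thesis using one two by blast
    next
      case False
      then have j: "2 \<le> card C2" using n by auto
      have "V * sv (card C2 + 1) - r ^ 4 * V / 4 + E (\<lambda>y. (max 0 (d2 - r\<^sup>2 * y))\<^sup>2) / 4 \<le> ?e2"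
        using err_insert_ge[OF C2, of "V * sv (card C2 + 1)" 2] IH[of "card C2 + 1"] n by simp
      moreover have "E (\<lambda>y. (max 0 (d2 - r\<^sup>2 * y))\<^sup>2) = E (\<lambda>y. (r\<^sup>2 * y + - d2)\<^sup>2)"
      proof (intro E_cong continuous_intros)
        fix y :: real assume y: "0 \<le> y" "y \<le> 1"
        then have "r\<^sup>2 * y \<le> r\<^sup>2 * 1" by (intro mult_left_mono) auto
        then have "max 0 (d2 - r\<^sup>2 * y) = d2 - r\<^sup>2 * y" using q_approx d2' by simp
        then show "(max 0 (d2 - r\<^sup>2 * y))\<^sup>2 = (r\<^sup>2 * y + - d2)\<^sup>2" by (simp add: power2_commute)
      qed
      moreover have "E (\<lambda>y. (r\<^sup>2 * y + - d2)\<^sup>2) = r ^ 4 * V + (d2 - r\<^sup>2 / 2)\<^sup>2"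
        unfolding E_square_affine by (simp add: power2_commute power_mult[symmetric])
      ultimately have "V * sv (card C2 + 1) + (d2 - r\<^sup>2 / 2)\<^sup>2 / 4 \<le> ?e2" by (simp add: add_divide_distrib)
      moreover have "V * (sv (card C2) - sv (card C2 + 1)) \<le> (d2 - r\<^sup>2 / 2)\<^sup>2 / 4"
      proof -
        have "sv (card C2) - sv (card C2 + 1) \<le> drop_val (r\<^sup>2) 2"
          using drop_val_antimono[OF q_bounds, of 2 "card C2"] j by (simp add: drop_val_def)
        also have "\<dots> = r\<^sup>2 / 2 * (1 - r\<^sup>2)"
          using drop_val_step[of 2 "r\<^sup>2"] drop_val_1[of "r\<^sup>2"] by simp
        also have "\<dots> = (r\<^sup>2 - (r\<^sup>2)\<^sup>2) / 2" by (simp add: power2_eq_square algebra_simps)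
        also have "\<dots> \<le> 0.076721" using q_approx q2_approx by simp
        finally have "V * (sv (card C2) - sv (card C2 + 1)) \<le> 0.0984220595 * 0.076721"
          using V_approx V_pos by (intro order_trans[OF mult_left_mono mult_right_mono]) auto
        also have "\<dots> \<le> 0.17419\<^sup>2 / 4" by (simp add: power2_eq_square)
        also have "\<dots> \<le> (d2 - r\<^sup>2 / 2)\<^sup>2 / 4"
          using d2' q_approx by (intro divide_right_mono power_mono) auto
        finally show ?thesis .
      qed
      ultimately have "sv (card C2) * V \<le> ?e2" by (simp add: algebra_simps)
      moreover have "target n \<le> sv (card C1 + 1) + sv (card C2)"
        using target_le[of "card C1 + 1" "card C2"] n by (simp add: add.commute add.left_commute)
      ultimately show ?thesis using scaled[of "sv (card C1 + 1)" "sv (card C2)"] e1 by (simp add: mult.commute)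
    qed
  qed
qed

lemma crossing:
  assumes d: "d1 + d2 = 2 * D" and n: "n = card C1 + card C2 + 1" "2 \<le> n"
    and C1: "finite C1" "\<And>c. c \<in> C1 \<Longrightarrow> \<bar>d1\<bar> \<le> c" and C2: "finite C2" "\<And>c. c \<in> C2 \<Longrightarrow> \<bar>d2\<bar> \<le> c"
    and IH: "\<And>m \<alpha>. m < n \<Longrightarrow> finite \<alpha> \<Longrightarrow> \<alpha> \<noteq> {} \<Longrightarrow> card \<alpha> \<le> m \<Longrightarrow> V * sv m \<le> err \<alpha>"
  shows "V * target n \<le> err (insert (- d1) C1) + err (insert (- d2) C2)"
proof -
  have le: "d1 \<le> c" if "c \<in> C1" for c using C1(2)[OF that] by simp
  have le': "d2 \<le> c" if "c \<in> C2" for c using C2(2)[OF that] by simp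
  have 2: "V * target n \<le> 2 * V" using target_le_2[OF n(2)] V_pos by simp
  consider "C1 = {}" | "C2 = {}" | "card C1 = 1" "card C2 = 1"
    | "4 \<le> n" "n \<le> 7" "1 \<le> card C1" "1 \<le> card C2" | "8 \<le> n" "1 \<le> card C1" "1 \<le> card C2"
  proof -
    have "1 \<le> card C1" if "C1 \<noteq> {}" using that C1(1) by (simp add: Suc_leI card_gt_0_iff)
    moreover have "1 \<le> card C2" if "C2 \<noteq> {}" using that C2(1) by (simp add: Suc_leI card_gt_0_iff)
    ultimately show ?thesis using that n(1) by linarith
  qed
  then show ?thesis
  proof cases
    case 1
    then show ?thesis using crossing_empty[OF d C2(1) le'] 2 by simp
  next
    case 2
    then show ?thesis using crossing_empty[of d2 d1, OF _ C1(1) le] d \<open>V * target n \<le> 2 * V\<close> by simp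
  next
    case 3
    then obtain c1 c2 where c: "C1 = {c1}" "C2 = {c2}" by (auto simp: card_1_singleton_iff)
    then show ?thesis using crossing_three[OF d, of c1 c2] C1(2) C2(2) n(1) by (simp add: numeral_3_eq_3)
  next
    case 4
    show ?thesis
    proof (cases "d1 \<le> d2")
      case True
      then show ?thesis by (rule crossing_few[OF d _ n(1) 4 C1(1) le C2(1) le' IH])
    next
      case False
      then have "d2 + d1 = 2 * D" "d2 \<le> d1" "n = card C2 + card C1 + 1" using d n by auto
      then have "V * target n \<le> err (insert (- d2) C2) + err (insert (- d1) C1)"
        by (rule crossing_few[OF _ _ _ 4(1,2,4,3) C2(1) le' C1(1) le IH])
      then show ?thesis by simp
    qed
  next
    case 5
    then show ?thesis using crossing_many[OF d n(1) 5 C1(1) le C2(1) le' IH] by blast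
  qed
qed

section \<open>The lower bound\<close>

lemma square_le_iff:
  fixes a y t :: real assumes "a < y"
  shows "(t - a)\<^sup>2 \<le> (t - y)\<^sup>2 \<longleftrightarrow> 2 * t \<le> a + y"
proof -
  have "(t - y)\<^sup>2 - (t - a)\<^sup>2 = (y - a) * (a + y - 2 * t)" by (simp add: power2_eq_square algebra_simps)
  then have "(t - a)\<^sup>2 \<le> (t - y)\<^sup>2 \<longleftrightarrow> 0 \<le> (y - a) * (a + y - 2 * t)" by linarith
  then show ?thesis using assms by (simp add: zero_le_mult_iff)
qed

text \<open>Let \<open>a\<close> and \<open>b\<close> be points of the codebook nearest to the two ends of the central gap. If they can be told
  apart, the codebook splits and the induction hypothesis applies to both parts. Otherwise it is crossing.\<close>

lemma err_ge_split_val: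
  assumes "finite \<alpha>" "\<alpha> \<noteq> {}"
  shows "V * sv (card \<alpha>) \<le> err \<alpha>"
  using assms
proof (induction "card \<alpha>" arbitrary: \<alpha> rule: less_induct)
  case less
  define n where "n = card \<alpha>"
  note fin = less.prems
  have IH: "V * sv m \<le> err \<beta>" if "m < n" "finite \<beta>" "\<beta> \<noteq> {}" "card \<beta> \<le> m" for m \<beta>
  proof -
    have "1 \<le> card \<beta>" using that by (simp add: Suc_leI card_gt_0_iff)
    then have "V * sv m \<le> V * sv (card \<beta>)"
      using that V_pos by (intro mult_left_mono split_val_antimono[OF q_bounds]) auto
    also have "\<dots> \<le> err \<beta>" using less.hyps[of \<beta>] that n_def by simp
    finally show ?thesis .
  qed
  show ?case
  proof (cases "n = 1")
    case True
    then obtain a where "\<alpha> = {a}" unfolding n_def by (auto simp: card_1_singleton_iff)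
    then show ?thesis by (simp add: err_singleton)
  next
    case False
    have "n \<noteq> 0" using fin by (simp add: n_def)
    then have n2: "2 \<le> n" using False by simp
    have nearest: "\<exists>a\<in>\<alpha>. \<forall>y\<in>\<alpha>. (t - a)\<^sup>2 \<le> (t - y)\<^sup>2" for t
    proof -
      obtain a where "a \<in> \<alpha>" "sq_dist \<alpha> t = (t - a)\<^sup>2" using sq_dist_attained[OF fin] by blast
      then show ?thesis using sq_dist_le[OF fin(1), of _ t] by metis
    qed
    obtain a where a: "a \<in> \<alpha>" "\<And>y. y \<in> \<alpha> \<Longrightarrow> (r - a)\<^sup>2 \<le> (r - y)\<^sup>2" using nearest[of r] by blast
    obtain b where b: "b \<in> \<alpha>" "\<And>y. y \<in> \<alpha> \<Longrightarrow> (1 - r - b)\<^sup>2 \<le> (1 - r - y)\<^sup>2" using nearest[of "1 - r"] by blast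
    \<comment> \<open>The map from a position to its nearest codepoint is monotone.\<close>
    have ab: "a \<le> b"
    proof (rule ccontr)
      assume "\<not> a \<le> b"
      then have "b < a" by simp
      have "2 * (1 - r) \<le> b + a" using b(2)[OF a(1)] square_le_iff[OF \<open>b < a\<close>] by simp
      moreover have "b + a \<le> 2 * r"
      proof (rule ccontr)
        assume "\<not> b + a \<le> 2 * r"
        then have "(r - b)\<^sup>2 \<le> (r - a)\<^sup>2" using square_le_iff[OF \<open>b < a\<close>, of r] by simp
        then have "(r - b)\<^sup>2 = (r - a)\<^sup>2" using a(2)[OF b(1)] by simp
        then have "\<bar>r - b\<bar> = \<bar>r - a\<bar>" by (simp add: power2_eq_iff abs_eq_iff)
        then show False using \<open>b < a\<close> \<open>\<not> b + a \<le> 2 * r\<close> by linarith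
      qed
      ultimately show False using r_less by simp
    qed
    define L R where "L = {x \<in> \<alpha>. x \<le> a}" and "R = {x \<in> \<alpha>. b \<le> x}"
    have LR: "finite L" "finite R" "L \<noteq> {}" "R \<noteq> {}" using fin a b by (auto simp: L_def R_def)
    have left: "sq_dist L x \<le> sq_dist \<alpha> x" if "0 \<le> x" "x \<le> r" for x
    proof (rule sq_dist_geI[OF fin])
      fix y assume y: "y \<in> \<alpha>"
      show "sq_dist L x \<le> (x - y)\<^sup>2"
      proof (cases "y \<le> a")
        case True
        then show ?thesis using y LR by (intro sq_dist_le) (auto simp: L_def)
      next
        case False
        then have "a < y" by simp
        then have "2 * r \<le> a + y" using a(2)[OF y] by (simp add: square_le_iff)
        then have "(x - a)\<^sup>2 \<le> (x - y)\<^sup>2" using \<open>a < y\<close> that by (simp add: square_le_iff)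
        moreover have "sq_dist L x \<le> (x - a)\<^sup>2" using LR a by (intro sq_dist_le) (auto simp: L_def)
        ultimately show ?thesis by simp
      qed
    qed
    have right: "sq_dist R x \<le> sq_dist \<alpha> x" if "1 - r \<le> x" "x \<le> 1" for x
    proof (rule sq_dist_geI[OF fin])
      fix y assume y: "y \<in> \<alpha>"
      show "sq_dist R x \<le> (x - y)\<^sup>2"
      proof (cases "b \<le> y")
        case True
        then show ?thesis using y LR by (intro sq_dist_le) (auto simp: R_def)
      next
        case False
        then have "y < b" by simp
        have "y + b \<le> 2 * (1 - r)"
        proof (rule ccontr)
          assume *: "\<not> y + b \<le> 2 * (1 - r)"
          show False
          proof -
            have "(1 - r - y)\<^sup>2 - (1 - r - b)\<^sup>2 = (b - y) * (2 * (1 - r) - (y + b))"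
              by (simp add: power2_eq_square algebra_simps)
            also have "\<dots> < 0" using * \<open>y < b\<close> by (intro mult_pos_neg) auto
            finally show False using b(2)[OF y] by simp
          qed
        qed
        have "(x - y)\<^sup>2 - (x - b)\<^sup>2 = (b - y) * (2 * x - (y + b))"
          by (simp add: power2_eq_square algebra_simps)
        also have "\<dots> \<ge> 0" using \<open>y < b\<close> \<open>y + b \<le> 2 * (1 - r)\<close> that by (intro mult_nonneg_nonneg) auto
        finally have "(x - b)\<^sup>2 \<le> (x - y)\<^sup>2" by simp
        moreover have "sq_dist R x \<le> (x - b)\<^sup>2" using LR b by (intro sq_dist_le) (auto simp: R_def)
        ultimately show ?thesis by simp
      qed
    qed
    let ?L = "(\<lambda>x. x / r) ` L" and ?R = "(\<lambda>x. (x - (1 - r)) / r) ` R"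
    have split: "r\<^sup>2 / 2 * (err ?L + err ?R) \<le> err \<alpha>"
      by (rule err_split) (use fin LR left right in auto)
    have "V * target n \<le> err ?L + err ?R"
    proof (cases "a = b")
      case False
      then have disj: "L \<inter> R = {}" using ab by (auto simp: L_def R_def)
      have "card L + card R \<le> n"
        unfolding n_def card_Un_disjoint[OF LR(1,2) disj, symmetric]
        using fin by (intro card_mono) (auto simp: L_def R_def)
      moreover have pos: "1 \<le> card L" "1 \<le> card R" using LR by (simp_all add: Suc_leI card_gt_0_iff)
      ultimately have lt: "card L < n" "card R < n" by auto
      have "card ?L \<le> card L" "card ?R \<le> card R" using LR by (auto intro: card_image_le)
      then have "V * sv (card L) \<le> err ?L" "V * sv (card R) \<le> err ?R"
        using LR lt by (auto intro!: IH)
      moreover have "target n \<le> target (card L + card R)"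
      proof -
        have "sv n \<le> sv (card L + card R)"
          using \<open>card L + card R \<le> n\<close> pos by (intro split_val_antimono[OF q_bounds]) auto
        then have "r\<^sup>2 / 2 * target n \<le> r\<^sup>2 / 2 * target (card L + card R)"
          using sv_target[of n] sv_target[of "card L + card R"] n2 pos by simp
        then show ?thesis by (rule mult_left_le_imp_le) (use q_bounds in simp)
      qed
      then have "V * target n \<le> V * (sv (card L) + sv (card R))"
        using target_le[OF pos] V_pos by (intro mult_left_mono) auto
      ultimately show ?thesis by (simp add: distrib_left)
    next
      case True
      define C1 C2 where "C1 = (\<lambda>x. 1 - x / r) ` {x \<in> \<alpha>. x < a}" and "C2 = (\<lambda>x. (x - (1 - r)) / r) ` {x \<in> \<alpha>. a < x}"
      define d1 d2 where "d1 = (a - r) / r" and "d2 = (1 - r - a) / r"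
      have L: "L = insert a {x \<in> \<alpha>. x < a}" and R: "R = insert a {x \<in> \<alpha>. a < x}"
        using a(1) True by (auto simp: L_def R_def)
      have "err ?L = err ((\<lambda>x. 1 - x) ` ?L)" using LR by (intro err_reflect[symmetric]) auto
      also have "(\<lambda>x. 1 - x) ` ?L = insert (- d1) C1"
        unfolding L C1_def image_image d1_def using r_pos by (simp add: diff_divide_distrib)
      finally have eL: "err ?L = err (insert (- d1) C1)" .
      have eR: "err ?R = err (insert (- d2) C2)"
        unfolding R C2_def image_insert d2_def by (simp add: minus_divide_left)
      have "d1 + d2 = 2 * D" using r_pos by (simp add: d1_def d2_def D_def field_simps)
      moreover have "n = card C1 + card C2 + 1"
      proof -
        have "card C1 = card {x \<in> \<alpha>. x < a}" unfolding C1_def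
          using r_pos by (intro card_image inj_onI) simp
        moreover have "card C2 = card {x \<in> \<alpha>. a < x}" unfolding C2_def
          using r_pos by (intro card_image inj_onI) simp
        moreover have "\<alpha> = insert a ({x \<in> \<alpha>. x < a} \<union> {x \<in> \<alpha>. a < x})" using a(1) by auto
        then have "n = card (insert a ({x \<in> \<alpha>. x < a} \<union> {x \<in> \<alpha>. a < x}))" by (simp add: n_def)
        then have "n = card ({x \<in> \<alpha>. x < a} \<union> {x \<in> \<alpha>. a < x}) + 1" using fin by simp
        moreover have "card ({x \<in> \<alpha>. x < a} \<union> {x \<in> \<alpha>. a < x}) = card {x \<in> \<alpha>. x < a} + card {x \<in> \<alpha>. a < x}"
          using fin by (intro card_Un_disjoint) auto
        ultimately show ?thesis by simp
      qed
      moreover have "\<bar>d1\<bar> \<le> c" if "c \<in> C1" for c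
      proof -
        obtain x where x: "x \<in> \<alpha>" "x < a" "c = 1 - x / r" using \<open>c \<in> C1\<close> by (auto simp: C1_def)
        have "x + a \<le> 2 * r"
        proof (rule ccontr)
          assume *: "\<not> x + a \<le> 2 * r"
          have "(r - x)\<^sup>2 - (r - a)\<^sup>2 = (a - x) * (2 * r - (x + a))"
            by (simp add: power2_eq_square algebra_simps)
          also have "\<dots> < 0" using * \<open>x < a\<close> by (intro mult_pos_neg) auto
          finally show False using a(2)[OF x(1)] by simp
        qed
        then show ?thesis using x r_pos by (auto simp: d1_def abs_le_iff field_simps)
      qed
      moreover have "\<bar>d2\<bar> \<le> c" if "c \<in> C2" for c
      proof -
        obtain x where x: "x \<in> \<alpha>" "a < x" "c = (x - (1 - r)) / r" using \<open>c \<in> C2\<close> by (auto simp: C2_def)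
        have "2 * (1 - r) \<le> a + x" using b(2)[OF x(1)] x(2) True by (simp add: square_le_iff)
        then show ?thesis using x r_pos by (auto simp: d2_def abs_le_iff field_simps)
      qed
      moreover have "finite C1" "finite C2" using fin by (auto simp: C1_def C2_def)
      ultimately show ?thesis unfolding eL eR by (intro crossing n2 IH)
    qed
    then have "r\<^sup>2 / 2 * (V * target n) \<le> r\<^sup>2 / 2 * (err ?L + err ?R)"
      by (intro mult_left_mono) auto
    also have "r\<^sup>2 / 2 * (V * target n) = V * sv n" using sv_target[OF n2] by simp
    finally show ?thesis using split by (simp add: n_def)
  qed
qed

text \<open>The supremum in question is attained.\<close>

lemma beta_optimal_critical: "beta_optimal r"
  unfolding beta_optimal_def
proof (intro allI impI)
  fix n I assume n: "2 \<le> n" and "I \<subseteq> words (ell n) \<and> card I = n - 2 ^ ell n"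
  then have \<beta>: "beta_set r n I \<in> codebooks n" "err (beta_set r n I) \<le> V * sv n"
    using err_beta_set_le[of n I] by auto
  have lower: "V * sv n \<le> err \<alpha>" if "\<alpha> \<in> codebooks n" for \<alpha>
  proof -
    have \<alpha>: "finite \<alpha>" "\<alpha> \<noteq> {}" "card \<alpha> \<le> n" using that by (auto simp: codebooks_def)
    then have "1 \<le> card \<alpha>" by (simp add: Suc_leI card_gt_0_iff)
    then have "V * sv n \<le> V * sv (card \<alpha>)"
      using \<alpha> V_pos by (intro mult_left_mono split_val_antimono[OF q_bounds]) auto
    also have "\<dots> \<le> err \<alpha>" using \<alpha> by (intro err_ge_split_val)
    finally show ?thesis .
  qed
  have "quant_error P n = err (beta_set r n I)"
    unfolding quant_error_def
  proof (rule antisym)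
    show "(INF \<alpha>\<in>codebooks n. distortion P \<alpha>) \<le> err (beta_set r n I)"
      using lower \<beta> by (intro cINF_lower2[OF _ \<beta>(1)]) (auto simp: err_eq intro!: bdd_belowI)
    show "err (beta_set r n I) \<le> (INF \<alpha>\<in>codebooks n. distortion P \<alpha>)"
      using lower \<beta> by (intro cINF_greatest) (auto simp: err_eq intro: order_trans)
  qed
  then show "optimal_set P n (beta_set r n I)"
    using \<beta>(1) by (simp add: optimal_set_def err_eq)
qed

end

theorem theorem1p5:
  shows "\<exists>r0::real. 0 < r0 \<and> r0 < 1/2 \<and> critical_eq r0 \<and>
           (\<forall>r. 0 < r \<and> r < 1/2 \<and> critical_eq r \<longrightarrow> r = r0) \<and>
           \<bar>r0 - 0.4350411707\<bar> < 5 / 10^11 \<and>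
           isLub UNIV {r. 0 < r \<and> r < 1/2 \<and> beta_optimal r} r0"
proof -
  have "continuous_on {43504117069 / 10 ^ 11 .. 43504117070 / 10 ^ 11} crit"
    unfolding crit_def[abs_def] by (intro continuous_intros)
  then obtain r0 where r0: "43504117069 / 10 ^ 11 \<le> r0" "r0 \<le> 43504117070 / 10 ^ 11" "crit r0 = 0"
    using IVT2'[of crit "43504117070 / 10 ^ 11" 0 "43504117069 / 10 ^ 11"] crit_signs by auto
  then have range: "0 < r0" "r0 < 1/2" by auto
  interpret critical_parameter r0
    by unfold_locales (use range r0 in auto)
  have unique: "r = r0" if "0 < r" "r < 1/2" "critical_eq r" for r
    using that crit_decreasing[of r r0] crit_decreasing[of r0 r] range r0(3)
    by (cases r r0 rule: linorder_cases) (auto simp: critical_eq_iff)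
  have upper: "r \<le> r0" if "0 < r" "r < 1/2" "beta_optimal r" for r
  proof (rule ccontr)
    assume "\<not> r \<le> r0"
    then have "crit r < 0" using crit_decreasing[of r0 r] range r0(3) that by simp
    interpret R: cantor_parameter r by unfold_locales (use that in auto)
    show False using R.not_beta_optimal \<open>crit r < 0\<close> that unfolding crit_def by simp
  qed
  have "isLub UNIV {r. 0 < r \<and> r < 1/2 \<and> beta_optimal r} r0"
    using upper range beta_optimal_critical
    by (intro isLubI2 setleI isUbI) (auto simp: setge_def isUb_def setle_def)
  moreover have "\<bar>r0 - 0.4350411707\<bar> < 5 / 10^11"
    unfolding abs_less_iff using r0 by simp
  ultimately show ?thesis using range unique r0(3) critical_eq_iff by blast
qed

end
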